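(* On 7-dimensional non-abelian real nilpotent Lie algebras $\mathfrak{g}$ with a coclosed $\mathrm{G}_2$-structure there is no relation between $\dim\mathcal{M}^{\mathrm{cc}}(\mathfrak{g})$ and $b_3(\mathfrak{g})=b_4(\mathfrak{g})$. More precisely: (i) among 7-dimensional non-abelian decomposable nilpotent Lie algebras $\mathfrak{g}$ admitting a coclosed $\mathrm{G}_2$-structure, each of the three cases $\dim\mathcal{M}^{\mathrm{cc}}(\mathfrak{g})<b_3(\mathfrak{g})$, $\dim\mathcal{M}^{\mathrm{cc}}(\mathfrak{g})=b_3(\mathfrak{g})$ and $\dim\mathcal{M}^{\mathrm{cc}}(\mathfrak{g})>b_3(\mathfrak{g})$ occurs for some $\mathfrak{g}$; (ii) if $\mathfrak{g}$ is a 7-dimensional 2-step nilpotent indecomposable Lie algebra admitting a coclosed $\mathrm{G}_2$-structure, then $\dim\mathcal{M}^{\mathrm{cc}}(\mathfrak{g})<b_3(\mathfrak{g})$.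
   Context: A Lie algebra is decomposable if it is a direct sum of two non-trivial Lie algebras, and indecomposable otherwise. The lower central series is $\mathfrak{g}_0=\mathfrak{g}$, $\mathfrak{g}_i=[\mathfrak{g}_{i-1},\mathfrak{g}]$; $\mathfrak{g}$ is $m$-step nilpotent if $m$ is the smallest integer with $\mathfrak{g}_m=0$. $\mathrm{d}$ denotes the Chevalley–Eilenberg differential on $\Lambda^\bullet\mathfrak{g}^*$, and $b_k(\mathfrak{g})=\dim H^k(\mathfrak{g})$ is the dimension of the $k$-th Lie algebra cohomology with trivial real coefficients. A $\mathrm{G}_2$-structure on a 7-dimensional real Lie algebra $\mathfrak{g}$ is a 3-form $\varphi\in\Lambda^3\mathfrak{g}^*$ for which there is a basis $\{\eta^1,\dots,\eta^7\}$ of $\mathfrak{g}^*$ with $\varphi=\eta^{127}+\eta^{347}+\eta^{567}+\eta^{135}-\eta^{236}-\eta^{146}-\eta^{245}$, where $\eta^{ijk}=\eta^i\wedge\eta^j\wedge\eta^k$. It determines a scalar product $g_\varphi$ and a volume form $\mathrm{vol}_\varphi$ through $6g_\varphi(X,Y)\mathrm{vol}_\varphi=\iota_X\varphi\wedge\iota_Y\varphi\wedge\varphi$, hence a Hodge star $*_\varphi$. A 4-form $\psi\in\Lambda^4\mathfrak{g}^*$ determines a $\mathrm{G}_2$-structure if $\psi=*_\varphi\varphi$ for some $\mathrm{G}_2$-structure $\varphi$; the structure is coclosed if $\mathrm{d}\psi=0$. Set $V^{\mathrm{cc}}(\mathfrak{g})=\{\psi\in\Lambda^4\mathfrak{g}^*\mid\psi\text{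 determines a }\mathrm{G}_2\text{-structure and }\mathrm{d}\psi=0\}$, an open subset of the space $Z^4(\mathfrak{g}^* )$ of closed 4-forms, so that (when it is non-empty) $\dim V^{\mathrm{cc}}(\mathfrak{g})=\dim Z^4(\mathfrak{g}^* )$. The group $\mathrm{Aut}(\mathfrak{g})$ of Lie algebra automorphisms acts naturally on $V^{\mathrm{cc}}(\mathfrak{g})$; let $\mathcal{O}(\psi)\cong\mathrm{Aut}(\mathfrak{g})/\mathrm{Aut}(\mathfrak{g})_\psi$ be the orbit of $\psi$, where $\mathrm{Aut}(\mathfrak{g})_\psi$ is the stabilizer. The moduli space of coclosed $\mathrm{G}_2$-structures on $\mathfrak{g}$ is $\mathcal{M}^{\mathrm{cc}}(\mathfrak{g})=V^{\mathrm{cc}}(\mathfrak{g})/\mathrm{Aut}(\mathfrak{g})$, and its dimension is defined as $$\dim\mathcal{M}^{\mathrm{cc}}(\mathfrak{g})=\dim V^{\mathrm{cc}}(\mathfrak{g})-\dim\mathcal{O}(\psi)=\dim V^{\mathrm{cc}}(\mathfrak{g})-\bigl(\dim\mathrm{Aut}(\mathfrak{g})-\dim\mathrm{Aut}(\mathfrak{g})_\psi\bigr),$$ where $\psi\in V^{\mathrm{cc}}(\mathfrak{g})$ is chosen so that $\mathcal{O}(\psi)$ has maximal dimension among all orbits (equivalently, the stabilizer of $\psi$ has minimal dimension). *)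

theory Defs
  imports "HOL-Analysis.Analysis" "HOL-Library.Function_Algebras"
begin

section \<open>Function spaces as real vector spaces\<close>

text \<open>Pointwise scalar multiplication, completing the pointwise additive structure of
  \<^theory>\<open>HOL-Library.Function_Algebras\<close>.  It makes \<^const>\<open>dim\<close>, \<^const>\<open>span\<close> and
  \<^const>\<open>independent\<close> available for exterior forms and for endomorphisms.\<close>

instantiation "fun" :: (type, real_vector) real_vector
begin

definition scaleR_fun :: "real \<Rightarrow> ('a \<Rightarrow> 'b) \<Rightarrow> 'a \<Rightarrow> 'b"
  where "scaleR_fun c f = (\<lambda>x. c *\<^sub>R f x)"

instance
  by standard (auto simp: scaleR_fun_def fun_eq_iff algebra_simps)

end


section \<open>Lie algebras\<close>

definition lie_bracket :: "('a::real_vector \<Rightarrow> 'a \<Rightarrow> 'a) \<Rightarrow> bool" where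
  "lie_bracket br \<longleftrightarrow>
     bilinear br \<and> (\<forall>x. br x x = 0) \<and>
     (\<forall>x y z. br x (br y z) + br y (br z x) + br z (br x y) = 0)"

definition abelian :: "('a::real_vector \<Rightarrow> 'a \<Rightarrow> 'a) \<Rightarrow> bool" where
  "abelian br \<longleftrightarrow> (\<forall>x y. br x y = 0)"

fun lower_central :: "('a::real_vector \<Rightarrow> 'a \<Rightarrow> 'a) \<Rightarrow> nat \<Rightarrow> 'a set" where
  "lower_central br 0 = UNIV"
| "lower_central br (Suc i) = span {br x y | x y. x \<in> lower_central br i}"

definition step_nilpotent :: "nat \<Rightarrow> ('a::real_vector \<Rightarrow> 'a \<Rightarrow> 'a) \<Rightarrow> bool" where
  "step_nilpotent m br \<longleftrightarrow>
     lower_central br m = {0} \<and> (\<forall>k<m. lower_central br k \<noteq> {0})"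

definition nilpotent :: "('a::real_vector \<Rightarrow> 'a \<Rightarrow> 'a) \<Rightarrow> bool" where
  "nilpotent br \<longleftrightarrow> (\<exists>m. step_nilpotent m br)"

text \<open>Internal direct sum of two non-zero subalgebras that commute with each other.\<close>

definition decomposable :: "('a::real_vector \<Rightarrow> 'a \<Rightarrow> 'a) \<Rightarrow> bool" where
  "decomposable br \<longleftrightarrow>
     (\<exists>U W. subspace U \<and> subspace W \<and> U \<noteq> {0} \<and> W \<noteq> {0} \<and>
        U \<inter> W = {0} \<and> {u + w | u w. u \<in> U \<and> w \<in> W} = UNIV \<and>
        (\<forall>x\<in>U. \<forall>y\<in>U. br x y \<in> U) \<and> (\<forall>x\<in>W. \<forall>y\<in>W. br x y \<in> W) \<and>
        (\<forall>x\<in>U. \<forall>y\<in>W. br x y = 0))"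


section \<open>Exterior forms\<close>

text \<open>A \<open>k\<close>-form is an alternating multilinear function of lists of length \<open>k\<close>.  It is
  set to zero on lists of any other length, so that forms of degree \<open>k\<close> are a subspace of
  a single function space and equality of forms is equality of functions.\<close>

type_synonym 'a form = "'a list \<Rightarrow> real"

definition alt_forms :: "nat \<Rightarrow> ('a::real_vector) form set" where
  "alt_forms k = {\<alpha>.
     (\<forall>xs. length xs \<noteq> k \<longrightarrow> \<alpha> xs = 0) \<and>
     (\<forall>xs i. length xs = k \<and> i < k \<longrightarrow> linear (\<lambda>v. \<alpha> (xs[i := v]))) \<and>
     (\<forall>xs. length xs = k \<and> \<not> distinct xs \<longrightarrow> \<alpha> xs = 0)}"

text \<open>The wedge product as a sum over shuffles: \<open>A\<close> is the set of positions of the arguments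
  passed to \<open>\<alpha>\<close>, and the exponent counts the inversions of the shuffle.  Only sets \<open>A\<close> whose
  cardinality is the degree of \<open>\<alpha>\<close> contribute.  In particular
  \<open>(\<alpha>\<^sub>1 \<and> \<dots> \<and> \<alpha>\<^sub>k)(x\<^sub>1,\<dots>,x\<^sub>k) = det (\<alpha>\<^sub>i(x\<^sub>j))\<close> for 1-forms.\<close>

definition wedge :: "('a::real_vector) form \<Rightarrow> 'a form \<Rightarrow> 'a form" where
  "wedge \<alpha> \<beta> = (\<lambda>xs. \<Sum>A \<in> Pow {..<length xs}.
     (-1) ^ card {(i, j). i < j \<and> i < length xs \<and> i \<notin> A \<and> j \<in> A} *
     \<alpha> (nths xs A) * \<beta> (nths xs (- A)))"

definition interior :: "'a::real_vector \<Rightarrow> 'a form \<Rightarrow> 'a form" where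
  "interior x \<alpha> = (\<lambda>xs. \<alpha> (x # xs))"

text \<open>The Chevalley--Eilenberg differential with trivial real coefficients; on a 1-form,
  \<open>(d\<alpha>)(x, y) = - \<alpha>([x, y])\<close>.\<close>

definition ce_d :: "('a::real_vector \<Rightarrow> 'a \<Rightarrow> 'a) \<Rightarrow> 'a form \<Rightarrow> 'a form" where
  "ce_d br \<alpha> = (\<lambda>xs. \<Sum>(i, j) \<in> {(i, j). i < j \<and> j < length xs}.
     (-1) ^ (i + j) * \<alpha> (br (xs ! i) (xs ! j) # nths xs (- {i, j})))"

definition closed_forms :: "('a::real_vector \<Rightarrow> 'a \<Rightarrow> 'a) \<Rightarrow> nat \<Rightarrow> 'a form set" where
  "closed_forms br k = {\<alpha> \<in> alt_forms k. ce_d br \<alpha> = 0}"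

definition exact_forms :: "('a::real_vector \<Rightarrow> 'a \<Rightarrow> 'a) \<Rightarrow> nat \<Rightarrow> 'a form set" where
  "exact_forms br k = (case k of 0 \<Rightarrow> {0} | Suc j \<Rightarrow> ce_d br ` alt_forms j)"

text \<open>The dimension of the quotient of the closed by the exact \<open>k\<close>-forms.\<close>

definition betti :: "('a::real_vector \<Rightarrow> 'a \<Rightarrow> 'a) \<Rightarrow> nat \<Rightarrow> nat" where
  "betti br k = dim (closed_forms br k) - dim (exact_forms br k)"


section \<open>$G_2$-structures on a 7-dimensional vector space\<close>

definition coframe :: "(nat \<Rightarrow> ('a::real_vector) form) \<Rightarrow> bool" where
  "coframe \<eta> \<longleftrightarrow>
     inj_on \<eta> {1..7} \<and> independent (\<eta> ` {1..7}) \<and> span (\<eta> ` {1..7}) = alt_forms 1"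

definition wedge3 :: "(nat \<Rightarrow> ('a::real_vector) form) \<Rightarrow> nat \<Rightarrow> nat \<Rightarrow> nat \<Rightarrow> 'a form" where
  "wedge3 \<eta> i j k = wedge (\<eta> i) (wedge (\<eta> j) (\<eta> k))"

definition G2_structure :: "('a::real_vector) form \<Rightarrow> bool" where
  "G2_structure \<phi> \<longleftrightarrow>
     (\<exists>\<eta>. coframe \<eta> \<and>
        \<phi> = wedge3 \<eta> 1 2 7 + wedge3 \<eta> 3 4 7 + wedge3 \<eta> 5 6 7 + wedge3 \<eta> 1 3 5
            - wedge3 \<eta> 2 3 6 - wedge3 \<eta> 1 4 6 - wedge3 \<eta> 2 4 5)"

definition scalar_product :: "('a::real_vector \<Rightarrow> 'a \<Rightarrow> real) \<Rightarrow> bool" where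
  "scalar_product g \<longleftrightarrow>
     bilinear g \<and> (\<forall>x y. g x y = g y x) \<and> (\<forall>x. x \<noteq> 0 \<longrightarrow> 0 < g x x)"

definition orthonormal_frame :: "('a::euclidean_space \<Rightarrow> 'a \<Rightarrow> real) \<Rightarrow> 'a list \<Rightarrow> bool" where
  "orthonormal_frame g es \<longleftrightarrow>
     length es = DIM('a) \<and>
     (\<forall>i<length es. \<forall>j<length es. g (es ! i) (es ! j) = (if i = j then 1 else 0))"

text \<open>\<open>vol\<close> is one of the two volume forms of \<open>g\<close>.\<close>

definition volume_form :: "('a::euclidean_space \<Rightarrow> 'a \<Rightarrow> real) \<Rightarrow> 'a form \<Rightarrow> bool" where
  "volume_form g vol \<longleftrightarrow>
     vol \<in> alt_forms DIM('a) \<and> (\<exists>es. orthonormal_frame g es \<and> vol es = 1)"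

text \<open>The scalar product on \<open>k\<close>-forms induced by the scalar product for which \<open>es\<close> is
  orthonormal: the wedge products of \<open>k\<close> distinct elements of the dual basis, in increasing
  order, are orthonormal.  It does not depend on the choice of the orthonormal basis.\<close>

definition form_inner :: "'a list \<Rightarrow> nat \<Rightarrow> ('a::real_vector) form \<Rightarrow> 'a form \<Rightarrow> real" where
  "form_inner es k \<alpha> \<beta> = (\<Sum>I | I \<subseteq> {..<length es} \<and> card I = k. \<alpha> (nths es I) * \<beta> (nths es I))"

text \<open>\<open>\<psi>\<close> is the Hodge star of the \<open>k\<close>-form \<open>\<phi>\<close>, that is \<open>\<alpha> \<and> \<psi> = \<langle>\<alpha>, \<phi>\<rangle> vol\<close> for all
  \<open>k\<close>-forms \<open>\<alpha>\<close>.\<close>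

definition is_hodge_star ::
    "('a::euclidean_space \<Rightarrow> 'a \<Rightarrow> real) \<Rightarrow> 'a form \<Rightarrow> nat \<Rightarrow> 'a form \<Rightarrow> 'a form \<Rightarrow> bool" where
  "is_hodge_star g vol k \<phi> \<psi> \<longleftrightarrow>
     \<psi> \<in> alt_forms (DIM('a) - k) \<and>
     (\<exists>es. orthonormal_frame g es \<and>
        (\<forall>\<alpha>\<in>alt_forms k. wedge \<alpha> \<psi> = form_inner es k \<alpha> \<phi> *\<^sub>R vol))"

text \<open>The formula fixes \<open>g\<close> up to the scaling of \<open>vol\<close>; requiring \<open>vol\<close> to be a volume form
  of the (positive definite) \<open>g\<close> removes this freedom and fixes the orientation.\<close>

definition G2_metric ::
    "('a::euclidean_space) form \<Rightarrow> ('a \<Rightarrow> 'a \<Rightarrow> real) \<Rightarrow> 'a form \<Rightarrow> bool" where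
  "G2_metric \<phi> g vol \<longleftrightarrow>
     scalar_product g \<and> volume_form g vol \<and>
     (\<forall>x y. (6 * g x y) *\<^sub>R vol = wedge (interior x \<phi>) (wedge (interior y \<phi>) \<phi>))"

definition determines_G2 :: "('a::euclidean_space) form \<Rightarrow> bool" where
  "determines_G2 \<psi> \<longleftrightarrow>
     (\<exists>\<phi> g vol. G2_structure \<phi> \<and> G2_metric \<phi> g vol \<and> is_hodge_star g vol 3 \<phi> \<psi>)"

definition Vcc :: "('a::euclidean_space \<Rightarrow> 'a \<Rightarrow> 'a) \<Rightarrow> 'a form set" where
  "Vcc br = {\<psi> \<in> alt_forms 4. determines_G2 \<psi> \<and> ce_d br \<psi> = 0}"


section \<open>Automorphisms and the dimension of the moduli space\<close>

definition lie_aut :: "('a::real_vector \<Rightarrow> 'a \<Rightarrow> 'a) \<Rightarrow> ('a \<Rightarrow> 'a) set" where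
  "lie_aut br = {f. linear f \<and> bij f \<and> (\<forall>x y. f (br x y) = br (f x) (f y))}"

definition act :: "('a \<Rightarrow> 'a) \<Rightarrow> ('a::real_vector) form \<Rightarrow> 'a form" where
  "act f \<psi> = (\<lambda>xs. \<psi> (map (inv f) xs))"

definition aut_stabilizer :: "('a::real_vector \<Rightarrow> 'a \<Rightarrow> 'a) \<Rightarrow> 'a form \<Rightarrow> ('a \<Rightarrow> 'a) set" where
  "aut_stabilizer br \<psi> = {f \<in> lie_aut br. act f \<psi> = \<psi>}"

definition exp_end :: "('a \<Rightarrow> 'a) \<Rightarrow> 'a \<Rightarrow> 'a::euclidean_space" where
  "exp_end D x = (\<Sum>n. (D ^^ n) x /\<^sub>R fact n)"

text \<open>The dimension of a closed subgroup \<open>G\<close> of the general linear group, as a Lie group: the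
  dimension of its Lie algebra, which consists of the \<open>D\<close> with \<open>exp (t D) \<in> G\<close> for all real \<open>t\<close>.\<close>

definition group_dim :: "('a::euclidean_space \<Rightarrow> 'a) set \<Rightarrow> nat" where
  "group_dim G = dim {D. linear D \<and> (\<forall>t::real. exp_end (t *\<^sub>R D) \<in> G)}"

definition orbit_dim :: "('a::euclidean_space \<Rightarrow> 'a \<Rightarrow> 'a) \<Rightarrow> 'a form \<Rightarrow> int" where
  "orbit_dim br \<psi> = int (group_dim (lie_aut br)) - int (group_dim (aut_stabilizer br \<psi>))"

text \<open>\<^term>\<open>Vcc br\<close> is open in the space of closed 4-forms, so its dimension (if it is non-empty)
  is that of \<^term>\<open>closed_forms br 4\<close>.  The value is only meaningful for non-empty \<^term>\<open>Vcc br\<close>.\<close>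

definition moduli_dim :: "('a::euclidean_space \<Rightarrow> 'a \<Rightarrow> 'a) \<Rightarrow> int" where
  "moduli_dim br = int (dim (closed_forms br 4)) - Max (orbit_dim br ` Vcc br)"

end

theory Submission
  imports Defs
begin

text \<open>The Lie algebra of \<open>Aut(g)\<close> is the algebra of derivations, and the stabilizer of \<open>\<psi>\<close>
  consists of isometries of the metric of \<open>\<psi>\<close>, so orbits have dimension at least
  \<open>dim Der(g)\<close> minus the dimension of the space of skew derivations.  By Poincare duality,
  \<open>b\<^sub>3 = b\<^sub>4 = dim Z\<^sup>4 - r\<close>, where \<open>r\<close> is the rank of the differential on 3-forms.  The comparison of
  the dimension of the moduli space with \<open>b\<^sub>3\<close> therefore is the comparison of \<open>r\<close> with the maximal
  dimension of an orbit.  For 2-step nilpotent algebras both are estimated in terms of the dimension of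
  the derived algebra.  If it is 3 and \<open>\<psi>\<close> has too many symmetries, the brackets are those of imaginary
  quaternions, and the 4-form of a rescaled frame is closed and has a larger orbit.  The decomposable examples are explicit.\<close>

section \<open>Dimensions of subspaces of a real vector space\<close>

text \<open>The stabilizer of \<open>\<psi>\<close> is estimated only through its metric. Hence the
  frame in which \<open>\<psi>\<close> has its normal form may be exchanged for any frame
  orthonormal for the same metric, in particular for one whose last vectors span the derived
  algebra, and the two-step case becomes a count of linear equations in the codimension
  \<open>p\<close> of that algebra. Solving the Leibniz rule in such a frame leaves at least 28
  derivations for \<open>p = 6\<close> and 19 for \<open>p = 4\<close>. For \<open>p = 6\<close> at
  most 11 of them are skew, which suffices. For \<open>p = 5\<close> the grading and the maps into
  the centre already give 11 derivations without a skew one among them. The obstacle is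
  \<open>p = 4\<close>: the bound needs at most 4 independent skew derivations, while they embed
  into so(4), of dimension 6. A subalgebra of so(4) of dimension at least 5 contains both so(3)
  factors, which is what forces the quaternionic brackets; stretching one direction of the frame
  then destroys this symmetry without disturbing closedness.\<close>

definition fin_dim :: "'v::real_vector set \<Rightarrow> bool" where
  "fin_dim S \<longleftrightarrow> (\<exists>B. finite B \<and> S \<subseteq> span B)"

lemma fin_dim_subset: "fin_dim T \<Longrightarrow> S \<subseteq> T \<Longrightarrow> fin_dim S"
  by (auto simp: fin_dim_def)

lemma fin_dim_finite_independent:
  assumes "fin_dim S" "B \<subseteq> S" "independent B"
  shows "finite B"
  using assms real_vector.independent_span_bound[of _ B] by (auto simp: fin_dim_def dest: subset_trans)

lemma fin_dim_basis:
  assumes "fin_dim S"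
  obtains B where "B \<subseteq> S" "independent B" "S \<subseteq> span B" "card B = dim S" "finite B"
proof -
  obtain B where "B \<subseteq> S" "independent B" "S \<subseteq> span B" "card B = dim S"
    using real_vector.basis_exists[of S] by auto
  with fin_dim_finite_independent[OF assms] that show ?thesis by auto
qed

lemma independent_card_le_dim_fin:
  assumes "fin_dim S" "B \<subseteq> S" "independent B"
  shows "card B \<le> dim S"
proof -
  obtain C where C: "C \<subseteq> S" "independent C" "S \<subseteq> span C" "card C = dim S" "finite C"
    using fin_dim_basis[OF assms(1)] .
  have "B \<subseteq> span C" using assms C by auto
  then show ?thesis using real_vector.independent_span_bound[OF C(5) assms(3)] C by auto
qed

text \<open>Finite dimension has to be assumed: forms and endomorphisms live in infinite-dimensional
  function types, where \<open>dim\<close> of a set without a finite basis is 0.\<close>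

lemma dim_mono_fin:
  assumes "fin_dim T" "S \<subseteq> T"
  shows "dim S \<le> dim T"
proof -
  obtain B where B: "B \<subseteq> S" "independent B" "S \<subseteq> span B" "card B = dim S"
    using real_vector.basis_exists[of S] by auto
  show ?thesis using independent_card_le_dim_fin[OF assms(1) _ B(2)] B assms by auto
qed

lemma independent_union_direct:
  fixes A B :: "'v::real_vector set"
  assumes "independent A" "independent B" "span A \<inter> span B \<subseteq> {0}"
  shows "independent (A \<union> B)"
proof -
  have aux: "x \<notin> span (A \<union> B - {x})"
    if A: "independent A" and AB: "span A \<inter> span B \<subseteq> {0}" and x: "x \<in> A" for x and A B :: "'v set"
  proof
    assume "x \<in> span (A \<union> B - {x})"
    then have "x \<in> span ((A - {x}) \<union> B)" using real_vector.span_mono[of "A \<union> B - {x}" "(A - {x}) \<union> B"] by auto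
    then obtain s t where st: "x = s + t" "s \<in> span (A - {x})" "t \<in> span B"
      by (auto simp: real_vector.span_Un)
    have "s \<in> span A" using st(2) real_vector.span_mono[of "A - {x}" A] by auto
    then have "t \<in> span A" using st(1) real_vector.span_base[OF x] real_vector.span_diff[of x A s] by auto
    then have "t = 0" using st(3) AB by auto
    with st A x show False by (auto simp: real_vector.dependent_def)
  qed
  show ?thesis
    unfolding real_vector.dependent_def
    using aux[OF assms(1,3)] aux[of B A] assms by (auto simp: Un_commute Int_commute)
qed

lemma dim_add_le_fin:
  assumes W: "fin_dim W" and TS: "T \<subseteq> W" "S \<subseteq> W" "subspace T" "subspace S" "T \<inter> S \<subseteq> {0}"
  shows "dim T + dim S \<le> dim W"
proof -
  obtain A where A: "A \<subseteq> T" "independent A" "T \<subseteq> span A" "card A = dim T" "finite A"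
    using fin_dim_basis fin_dim_subset[OF W TS(1)] by metis
  obtain B where B: "B \<subseteq> S" "independent B" "S \<subseteq> span B" "card B = dim S" "finite B"
    using fin_dim_basis fin_dim_subset[OF W TS(2)] by metis
  have sp: "span A = T" "span B = S"
    using A B TS by (auto simp: real_vector.span_subspace)
  have "independent (A \<union> B)" using independent_union_direct A B sp TS by metis
  moreover have "A \<inter> B = {}"
  proof -
    have "A \<inter> B \<subseteq> {0}" using A(1) B(1) TS(5) by auto
    moreover have "0 \<notin> A" using A(2) real_vector.dependent_zero by auto
    ultimately show ?thesis by auto
  qed
  ultimately show ?thesis
    using independent_card_le_dim_fin[OF W, of "A \<union> B"] A(1,4,5) B(1,4,5) TS(1,2)
    by (metis Un_least card_Un_disjoint subset_trans)
qed

text \<open>Each functional costs at most one dimension: if \<open>f i\<close> does not vanish on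
  \<open>S\<close>, then \<open>S\<close> is the kernel of \<open>f i\<close> plus the line of any
  \<open>s\<close> with \<open>f i s\<close> non-zero.\<close>

lemma spanning_of_functionals:
  fixes f :: "'i \<Rightarrow> 'v::real_vector \<Rightarrow> real"
  assumes "finite I" "subspace S" "\<And>i. i \<in> I \<Longrightarrow> linear (f i)"
    "{x\<in>S. \<forall>i\<in>I. f i x = 0} \<subseteq> span B" "finite B"
  shows "\<exists>C. finite C \<and> card C \<le> card B + card I \<and> S \<subseteq> span C"
  using assms
proof (induction I arbitrary: S rule: finite_induct)
  case empty
  then show ?case by auto
next
  case (insert i I)
  define K where "K = {x\<in>S. f i x = 0}"
  have lin: "linear (f i)" using insert by auto
  have "subspace K" unfolding K_def
    using insert.prems(1) lin
    by (auto simp: real_vector.subspace_def linear_add linear_scale linear_0)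
  moreover have "{x\<in>K. \<forall>i\<in>I. f i x = 0} \<subseteq> span B"
    using insert.prems(3) by (auto simp: K_def)
  ultimately obtain C where C: "finite C" "card C \<le> card B + card I" "K \<subseteq> span C"
    using insert.IH[of K] insert.prems by auto
  show ?case
  proof (cases "K = S")
    case True
    then show ?thesis using C insert by (intro exI[of _ C]) auto
  next
    case False
    then obtain s where s: "s \<in> S" "f i s \<noteq> 0" by (auto simp: K_def)
    have "S \<subseteq> span (Set.insert s C)"
    proof
      fix x assume x: "x \<in> S"
      define y where "y = x - (f i x / f i s) *\<^sub>R s"
      have "y \<in> S" unfolding y_def
        using insert.prems(1) x s by (intro real_vector.subspace_diff real_vector.subspace_scale)
      moreover have "f i y = 0" using s lin by (simp add: y_def linear_diff linear_scale)
      ultimately have "y \<in> span (Set.insert s C)"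
        using C real_vector.span_mono[of C "Set.insert s C"] by (auto simp: K_def)
      then have "y + (f i x / f i s) *\<^sub>R s \<in> span (Set.insert s C)"
        by (intro real_vector.span_add real_vector.span_scale real_vector.span_base[of s]) auto
      then show "x \<in> span (Set.insert s C)" by (simp add: y_def)
    qed
    then show ?thesis using C insert
      by (intro exI[of _ "Set.insert s C"]) (auto simp: card_insert_if)
  qed
qed

text \<open>The tool for upper bounds: a family of functionals that separates the points of
  \<open>S\<close> has at least \<open>dim S\<close> members. For closed forms and derivations the
  functionals are chosen free coordinates.\<close>

lemma dim_le_functionals:
  fixes f :: "'i \<Rightarrow> 'v::real_vector \<Rightarrow> real"
  assumes "finite I" "subspace S" "\<And>i. i \<in> I \<Longrightarrow> linear (f i)"
    "\<And>x. x \<in> S \<Longrightarrow> (\<And>i. i \<in> I \<Longrightarrow> f i x = 0) \<Longrightarrow> x = 0"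
  shows "fin_dim S" "dim S \<le> card I"
proof -
  have "{x\<in>S. \<forall>i\<in>I. f i x = 0} \<subseteq> span {}" using assms by auto
  from spanning_of_functionals[OF assms(1,2,3) this]
  obtain C where C: "finite C" "card C \<le> card I" "S \<subseteq> span C" by auto
  then show "fin_dim S" "dim S \<le> card I"
    using real_vector.dim_le_card[of S C] by (auto simp: fin_dim_def)
qed

text \<open>The counterpart for lower bounds: a space cut out by linear equations loses at most one
  dimension per equation.\<close>

lemma dim_common_kernel_ge:
  fixes f :: "'i \<Rightarrow> 'v::real_vector \<Rightarrow> real"
  assumes "finite I" "subspace S" "fin_dim S" "\<And>i. i \<in> I \<Longrightarrow> linear (f i)"
  shows "dim S \<le> dim {x\<in>S. \<forall>i\<in>I. f i x = 0} + card I"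
proof -
  let ?K = "{x\<in>S. \<forall>i\<in>I. f i x = 0}"
  obtain B where B: "B \<subseteq> ?K" "independent B" "?K \<subseteq> span B" "card B = dim ?K" "finite B"
    using fin_dim_basis[OF fin_dim_subset[OF assms(3), of ?K]] by auto
  from spanning_of_functionals[OF assms(1,2,4) B(3,5)]
  obtain C where C: "finite C" "card C \<le> card B + card I" "S \<subseteq> span C" by auto
  then show ?thesis
    using real_vector.dim_le_card[of S C] B by auto
qed

lemma subspace_linear_image: "linear f \<Longrightarrow> subspace S \<Longrightarrow> subspace (f ` S)"
  by (rule linear_subspace_image)

lemma rank_nullity_fin:
  assumes "linear f" "subspace S" "fin_dim S"
  shows "dim S = dim {x\<in>S. f x = 0} + dim (f ` S)" "fin_dim (f ` S)"
proof -
  let ?K = "{x\<in>S. f x = 0}"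
  have subK: "subspace ?K" using assms
    by (auto simp: real_vector.subspace_def linear_add linear_scale linear_0)
  obtain A where A: "A \<subseteq> ?K" "independent A" "?K \<subseteq> span A" "card A = dim ?K" "finite A"
    using fin_dim_basis[OF fin_dim_subset[OF assms(3), of ?K]] by auto
  obtain C where C: "C \<subseteq> S" "independent C" "S \<subseteq> span C" "card C = dim S" "finite C"
    using fin_dim_basis[OF assms(3)] .
  have spC: "f ` S \<subseteq> span (f ` C)"
    using C(3) linear_span_image[OF assms(1), of C] by auto
  then show fd: "fin_dim (f ` S)" using C(5) by (auto simp: fin_dim_def)
  obtain B where B: "B \<subseteq> f ` S" "independent B" "f ` S \<subseteq> span B" "card B = dim (f ` S)" "finite B"
    using fin_dim_basis[OF fd] .
  obtain X where X: "X \<subseteq> S" "inj_on f X" "f ` X = B"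
    using B(1) by (metis subset_image_inj)
  have finX: "finite X" "card X = card B" using X B by (auto simp: finite_image_iff card_image)
  have indX: "independent X"
    unfolding real_vector.dependent_def
  proof
    assume "\<exists>x\<in>X. x \<in> span (X - {x})"
    then obtain x where x: "x \<in> X" "x \<in> span (X - {x})" by auto
    then have "f x \<in> span (f ` (X - {x}))"
      using linear_span_image[OF assms(1), of "X - {x}"] by auto
    moreover have "f ` (X - {x}) = B - {f x}" using X x by (auto simp: inj_on_def)
    ultimately show False using B(2) X x by (auto simp: real_vector.dependent_def)
  qed
  have injX: "inj_on f (span X)"
    using linear_inj_on_span_iff_independent_image[OF assms(1), of X] X B(2) by auto
  have "span A \<inter> span X \<subseteq> {0}"
  proof
    fix x assume x: "x \<in> span A \<inter> span X"
    have "span A \<subseteq> ?K" using A(1) subK by (rule real_vector.span_minimal)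
    then have "f x = f 0" using x assms(1) by (auto simp: linear_0)
    then show "x \<in> {0}" using injX x real_vector.span_zero[of X] by (auto simp: inj_on_def)
  qed
  then have ind: "independent (A \<union> X)" using independent_union_direct A indX by auto
  have disj: "A \<inter> X = {}"
  proof -
    have "f x \<noteq> 0" if "x \<in> X" for x
      using B(2) X(3) that real_vector.dependent_zero by (metis imageI)
    then show ?thesis using A by auto
  qed
  have "dim ?K + dim (f ` S) \<le> dim S"
    using independent_card_le_dim_fin[OF assms(3), of "A \<union> X"] A X B finX ind disj
    by (auto simp: card_Un_disjoint)
  moreover have "S \<subseteq> span (A \<union> X)"
  proof
    fix s assume s: "s \<in> S"
    then have "f s \<in> f ` span X" using B(3) X(3) linear_span_image[OF assms(1), of X] by auto
    then obtain x where x: "x \<in> span X" "f s = f x" by auto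
    have "x \<in> S" using x X(1) assms(2) real_vector.span_minimal by blast
    then have "s - x \<in> ?K" using s x assms(1,2) by (auto simp: linear_diff real_vector.subspace_diff)
    then have "s - x \<in> span (A \<union> X)" using A(3) real_vector.span_mono[of A "A \<union> X"] by auto
    moreover have "x \<in> span (A \<union> X)" using x real_vector.span_mono[of X "A \<union> X"] by auto
    ultimately show "s \<in> span (A \<union> X)" using real_vector.span_add by fastforce
  qed
  then have "dim S \<le> dim ?K + dim (f ` S)"
    using real_vector.dim_le_card[of S "A \<union> X"] A finX B card_Un_le[of A X] by auto
  ultimately show "dim S = dim ?K + dim (f ` S)" by simp
qed

lemma dual_family_independent:
  fixes f :: "'i \<Rightarrow> 'v::real_vector \<Rightarrow> real"
  assumes "\<And>i. i \<in> I \<Longrightarrow> linear (f i)"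
    "\<And>i j. i \<in> I \<Longrightarrow> j \<in> I \<Longrightarrow> f i (x j) = (if i = j then 1 else 0)"
  shows "inj_on x I" "independent (x ` I)"
proof -
  show "inj_on x I"
    using assms(2) by (metis (no_types, lifting) inj_onI zero_neq_one)
  show "independent (x ` I)"
    unfolding real_vector.dependent_def
  proof
    assume "\<exists>a\<in>x ` I. a \<in> span (x ` I - {a})"
    then obtain i where i: "i \<in> I" "x i \<in> span (x ` I - {x i})" by auto
    have "x ` I - {x i} \<subseteq> {v. f i v = 0}" using assms(2)[OF i(1)] by auto
    moreover have "subspace {v. f i v = 0}" using assms(1)[OF i(1)]
      by (auto simp: real_vector.subspace_def linear_add linear_scale linear_0)
    ultimately have "f i (x i) = 0" using i(2) real_vector.span_minimal by blast
    then show False using assms(2)[OF i(1) i(1)] by simp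
  qed
qed

lemma card_dual_family_le:
  fixes f :: "'i \<Rightarrow> 'v::real_vector \<Rightarrow> real"
  assumes "finite I" "fin_dim S" "\<And>i. i \<in> I \<Longrightarrow> x i \<in> S" "\<And>i. i \<in> I \<Longrightarrow> linear (f i)"
    "\<And>i j. i \<in> I \<Longrightarrow> j \<in> I \<Longrightarrow> f i (x j) = (if i = j then 1 else 0)"
  shows "card I \<le> dim S"
proof -
  have "inj_on x I" "independent (x ` I)"
    by (rule dual_family_independent[OF assms(4,5)]; assumption)+
  then show ?thesis
    using independent_card_le_dim_fin[OF assms(2), of "x ` I"] assms(3) by (auto simp: card_image)
qed

section \<open>Exterior forms and the differential\<close>

lemma zero_fun_app [simp]: "(0 :: 'a \<Rightarrow> 'b::zero) x = 0"
  by (simp add: zero_fun_def)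

lemma scaleR_fun_app [simp]: "(c *\<^sub>R f) x = c *\<^sub>R f x" for f :: "'a \<Rightarrow> 'b::real_vector"
  by (simp add: scaleR_fun_def)

lemma linear_apply: "linear (\<lambda>f :: 'a \<Rightarrow> 'b::real_vector. f x)"
  by (rule linearI) auto

lemma interior_add [simp]: "interior x (\<alpha> + \<beta>) = interior x \<alpha> + interior x \<beta>"
  by (auto simp: interior_def)
lemma interior_diff [simp]: "interior x (\<alpha> - \<beta>) = interior x \<alpha> - interior x \<beta>"
  by (auto simp: interior_def)
lemma interior_minus [simp]: "interior x (- \<alpha>) = - interior x \<alpha>"
  by (auto simp: interior_def)
lemma interior_scale [simp]: "interior x (c *\<^sub>R \<alpha>) = c *\<^sub>R interior x \<alpha>"
  by (auto simp: interior_def)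
lemma interior_zero_form [simp]: "interior x 0 = 0"
  by (auto simp: interior_def)
lemma interior_apply: "interior x \<alpha> xs = \<alpha> (x # xs)"
  by (simp add: interior_def)

lemma alt_forms_length: "\<alpha> \<in> alt_forms k \<Longrightarrow> length xs \<noteq> k \<Longrightarrow> \<alpha> xs = 0"
  by (auto simp: alt_forms_def)

lemma alt_forms_not_distinct: "\<alpha> \<in> alt_forms k \<Longrightarrow> \<not> distinct xs \<Longrightarrow> \<alpha> xs = 0"
  by (cases "length xs = k") (auto simp: alt_forms_def)

lemma subspace_alt_forms: "subspace (alt_forms k)"
  unfolding real_vector.subspace_def alt_forms_def
  by (auto intro!: linear_compose_add linear_zero
    linear_compose_scale_right[where 'b=real, unfolded real_scaleR_def])

lemmas alt_forms_0 [simp] = real_vector.subspace_0[OF subspace_alt_forms]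
lemmas alt_forms_add = real_vector.subspace_add[OF subspace_alt_forms]
lemmas alt_forms_diff = real_vector.subspace_diff[OF subspace_alt_forms]
lemmas alt_forms_neg = real_vector.subspace_neg[OF subspace_alt_forms]
lemmas alt_forms_scale = real_vector.subspace_scale[OF subspace_alt_forms]

lemma alt_forms_zero_deg_interior: "\<alpha> \<in> alt_forms 0 \<Longrightarrow> interior x \<alpha> = 0"
  by (auto simp: interior_def alt_forms_def)

lemma interior_alt_Suc: 
  assumes "\<alpha> \<in> alt_forms (Suc k)"
  shows "interior x \<alpha> \<in> alt_forms k"
proof -
  have "linear (\<lambda>v. \<alpha> (x # xs[i := v]))" if "length xs = k" "i < k" for xs i
  proof -
    have "linear (\<lambda>v. \<alpha> ((x # xs)[Suc i := v]))"
      using assms that by (simp add: alt_forms_def del: list_update.simps)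
    then show ?thesis by simp
  qed
  then show ?thesis using assms by (auto simp: alt_forms_def interior_def)
qed

text \<open>For \<open>k = 0\<close> the truncated difference is again 0, which is harmless because
  the contraction is then the zero form.\<close>

lemma interior_alt: "\<alpha> \<in> alt_forms k \<Longrightarrow> interior x \<alpha> \<in> alt_forms (k - 1)"
  by (cases k) (auto simp: interior_alt_Suc alt_forms_zero_deg_interior)

lemma alt_linear_head:
  assumes "\<alpha> \<in> alt_forms k"
  shows "linear (\<lambda>v. \<alpha> (v # xs))"
proof (cases "Suc (length xs) = k")
  case True
  then have "linear (\<lambda>v. \<alpha> ((undefined # xs)[0 := v]))"
    using assms by (simp add: alt_forms_def del: list_update.simps)
  then show ?thesis by simp
next
  case False
  then have "(\<lambda>v. \<alpha> (v # xs)) = (\<lambda>v. 0)" using assms by (auto simp: alt_forms_def)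
  then show ?thesis by (simp add: linear_zero)
qed

lemma linear_interior: 
  assumes "\<alpha> \<in> alt_forms k"
  shows "linear (\<lambda>v. interior v \<alpha>)"
  using linear_add[OF alt_linear_head[OF assms]] linear_scale[OF alt_linear_head[OF assms]]
  by (intro linearI ext) (auto simp: interior_def)

lemma interior_interior_same: "\<alpha> \<in> alt_forms k \<Longrightarrow> interior x (interior x \<alpha>) = 0"
  by (rule ext) (auto simp: interior_def intro: alt_forms_not_distinct)

lemma swap_of_polarization:
  assumes "\<And>xs. linear (\<lambda>v. \<alpha> (v # xs))" "\<And>x xs. linear (\<lambda>v. \<alpha> (x # v # xs))"
    "\<And>x xs. \<alpha> (x # x # xs) = (0::real)"
  shows "\<alpha> (x # y # zs) = - \<alpha> (y # x # zs)"
proof -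
  have "\<alpha> ((x + y) # (x + y) # zs) = \<alpha> (x # (x + y) # zs) + \<alpha> (y # (x + y) # zs)"
    by (rule linear_add[OF assms(1)])
  also have "\<dots> = (\<alpha> (x # x # zs) + \<alpha> (x # y # zs)) + (\<alpha> (y # x # zs) + \<alpha> (y # y # zs))"
    by (intro arg_cong2[where f="(+)"] linear_add[OF assms(2)])
  finally show ?thesis by (simp add: assms(3))
qed

lemma alt_swap: 
  assumes "\<alpha> \<in> alt_forms k"
  shows "\<alpha> (x # y # zs) = - \<alpha> (y # x # zs)"
proof (rule swap_of_polarization)
  show "linear (\<lambda>v. \<alpha> (v # xs))" for xs using alt_linear_head[OF assms] .
  show "linear (\<lambda>v. \<alpha> (x # v # xs))" for x xs
    using alt_linear_head[OF interior_alt[OF assms], of x xs] by (simp add: interior_def)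
  show "\<alpha> (x # x # xs) = 0" for x xs using alt_forms_not_distinct[OF assms] by auto
qed

lemma interior_swap: "\<alpha> \<in> alt_forms k \<Longrightarrow> interior x (interior y \<alpha>) = - interior y (interior x \<alpha>)"
  by (rule ext) (simp add: interior_def, rule alt_swap)

text \<open>A recursive test for alternating forms that mentions only contractions with the first
  argument; \<open>lact\<close>, \<open>wedge\<close> and \<open>ce_d\<close> pass it by their
  contraction formulas. A repetition involving a later position is brought to the front by swapping
  the first two arguments.\<close>

lemma alt_forms_SucI:
  assumes nil: "\<alpha> [] = 0" and int: "\<And>x. interior x \<alpha> \<in> alt_forms k"
    and lin: "linear (\<lambda>v. interior v \<alpha>)" and same: "\<And>x. interior x (interior x \<alpha>) = 0"
  shows "\<alpha> \<in> alt_forms (Suc k)"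
  unfolding alt_forms_def
proof (safe)
  have lin1: "linear (\<lambda>v. \<alpha> (v # xs))" for xs
    using linear_compose[OF lin linear_apply[of xs]] by (simp add: o_def interior_def)
  fix xs :: "'a list"
  show "\<alpha> xs = 0" if "length xs \<noteq> Suc k"
    using that nil alt_forms_length[OF int] by (cases xs) (auto simp: interior_def)
  show "linear (\<lambda>v. \<alpha> (xs[i := v]))" if "length xs = Suc k" "i < Suc k" for i
  proof (cases xs)
    case (Cons y ys)
    show ?thesis
    proof (cases i)
      case 0
      then show ?thesis using lin1 Cons by simp
    next
      case (Suc j)
      then have "linear (\<lambda>v. interior y \<alpha> (ys[j := v]))"
        using int[of y] that Cons by (auto simp: alt_forms_def)
      then show ?thesis using Suc Cons by (simp add: interior_def)
    qed
  qed (use that in auto)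
  assume len: "length xs = Suc k" and nd: "\<not> distinct xs"
  then obtain y ys where xs: "xs = y # ys" by (cases xs) auto
  have sw: "\<alpha> (x # y # zs) = - \<alpha> (y # x # zs)" for x y zs
  proof (rule swap_of_polarization)
    show "linear (\<lambda>v. \<alpha> (v # xs))" for xs using lin1 .
    show "linear (\<lambda>v. \<alpha> (x # v # xs))" for x xs
      using alt_linear_head[OF int, of x xs] by (simp add: interior_def)
    show "\<alpha> (x # x # xs) = 0" for x xs using fun_cong[OF same[of x], of xs] by (simp add: interior_def)
  qed
  show "\<alpha> xs = 0"
  proof (cases "distinct ys")
    case False
    then show ?thesis using alt_forms_not_distinct[OF int, of ys y] xs by (simp add: interior_def)
  next
    case True
    then have "y \<in> set ys" using nd xs by auto
    then obtain as bs where ys: "ys = as @ y # bs" by (auto dest: split_list)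
    show ?thesis
    proof (cases as)
      case Nil
      then show ?thesis using fun_cong[OF same[of y], of bs] xs ys by (simp add: interior_def)
    next
      case (Cons a as')
      have "interior a \<alpha> (y # as' @ y # bs) = 0" by (rule alt_forms_not_distinct[OF int]) auto
      then show ?thesis using xs ys Cons sw[of y a] by (simp add: interior_def)
    qed
  qed
qed

lemma alt_move:
  assumes "\<alpha> \<in> alt_forms k"
  shows "\<alpha> (x # ys @ zs) = (-1) ^ length ys * \<alpha> (ys @ x # zs)"
  using assms
proof (induction ys arbitrary: \<alpha> k)
  case (Cons y ys)
  have "\<alpha> (x # (y # ys) @ zs) = - interior y \<alpha> (x # ys @ zs)"
    using alt_swap[OF Cons.prems, of x y] by (simp add: interior_def)
  then show ?case using Cons.IH[OF interior_alt[OF Cons.prems], of y] by (simp add: interior_def)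
qed simp

text \<open>The derivation of the exterior algebra induced by \<open>D\<close>: up to sign, the
  infinitesimal action of \<open>D\<close> on forms, and for \<open>D = br x\<close> the Lie
  derivative. Recursion through contraction makes it fit inductions on the argument list.\<close>

fun lact :: "('a \<Rightarrow> 'a) \<Rightarrow> ('a::real_vector) form \<Rightarrow> 'a form" where
  "lact D \<alpha> [] = 0"
| "lact D \<alpha> (x # xs) = \<alpha> (D x # xs) + lact D (interior x \<alpha>) xs"

lemma lact_add: "lact D (\<alpha> + \<beta>) = lact D \<alpha> + lact D \<beta>"
proof
  show "lact D (\<alpha> + \<beta>) xs = (lact D \<alpha> + lact D \<beta>) xs" for xs
    by (induction xs arbitrary: \<alpha> \<beta>) auto
qed

lemma lact_scale: "lact D (c *\<^sub>R \<alpha>) = c *\<^sub>R lact D \<alpha>"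
proof
  show "lact D (c *\<^sub>R \<alpha>) xs = (c *\<^sub>R lact D \<alpha>) xs" for xs
    by (induction xs arbitrary: \<alpha>) (auto simp: algebra_simps)
qed

lemma linear_lact: "linear (lact D)"
  by (rule linearI) (auto simp: lact_add lact_scale)

lemma lact_0 [simp]: "lact D 0 = 0"
  using linear_0[OF linear_lact] .

lemma interior_lact: "interior x (lact D \<alpha>) = interior (D x) \<alpha> + lact D (interior x \<alpha>)"
  by (rule ext) (auto simp: interior_def)

lemma lact_alt:
  assumes "linear D" "\<alpha> \<in> alt_forms k"
  shows "lact D \<alpha> \<in> alt_forms k"
  using assms(2)
proof (induction k arbitrary: \<alpha>)
  case 0
  have "lact D \<alpha> xs = 0" for xs
    using alt_forms_zero_deg_interior[OF 0] alt_forms_length[OF 0] by (cases xs) auto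
  then have "lact D \<alpha> = 0" by auto
  then show ?case by (metis alt_forms_0)
next
  case (Suc k)
  show ?case
  proof (rule alt_forms_SucI)
    show "interior x (lact D \<alpha>) \<in> alt_forms k" for x
      unfolding interior_lact using Suc by (intro alt_forms_add interior_alt_Suc Suc.IH)
    have "linear (\<lambda>v. interior (D v) \<alpha>)"
      using linear_compose[OF assms(1) linear_interior[OF Suc.prems]] by (simp add: o_def)
    moreover have "linear (\<lambda>v. lact D (interior v \<alpha>))"
      using linear_compose[OF linear_interior[OF Suc.prems] linear_lact] by (simp add: o_def)
    ultimately show "linear (\<lambda>v. interior v (lact D \<alpha>))"
      unfolding interior_lact by (rule linear_compose_add)
    show "interior x (interior x (lact D \<alpha>)) = 0" for x
      using interior_swap[OF Suc.prems, of x "D x"]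
      by (simp add: interior_lact interior_interior_same[OF Suc.prems])
  qed simp
qed

lemma linear_lact_fst:
  assumes "\<alpha> \<in> alt_forms k" "\<And>x. linear (\<lambda>v. B v x)"
  shows "linear (\<lambda>v. lact (B v) \<alpha>)"
proof -
  have "linear (\<lambda>v. lact (B v) \<alpha> xs)" for xs
    using assms(1)
  proof (induction xs arbitrary: \<alpha> k)
    case Nil
    then show ?case by (simp add: linear_zero)
  next
    case (Cons x xs)
    have "linear (\<lambda>v. \<alpha> (B v x # xs))"
      using linear_compose[OF assms(2) alt_linear_head[OF Cons.prems]] by (simp add: o_def)
    then show ?case using Cons.IH[OF interior_alt[OF Cons.prems]]
      by (simp add: linear_compose_add)
  qed
  from linear_add[OF this] linear_scale[OF this] show ?thesis
    by (intro linearI ext) auto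
qed

section \<open>The wedge product as a recursive sum over signed shuffles\<close>

fun splits :: "'b list \<Rightarrow> (int \<times> 'b list \<times> 'b list) list" where
  "splits [] = [(1, [], [])]"
| "splits (x # xs) = map (\<lambda>(s, l, r). (s, x # l, r)) (splits xs) @
     map (\<lambda>(s, l, r). (s * (-1) ^ length l, l, x # r)) (splits xs)"

definition inversions :: "nat \<Rightarrow> nat set \<Rightarrow> nat" where
  "inversions n A = card {(i, j). i < j \<and> i < n \<and> i \<notin> A \<and> j \<in> A}"

lemma inversions_insert_0_Suc: "inversions (Suc n) (insert 0 (Suc ` A)) = inversions n A"
proof -
  have "{(i, j). i < j \<and> i < Suc n \<and> i \<notin> insert 0 (Suc ` A) \<and> j \<in> insert 0 (Suc ` A)}
      = map_prod Suc Suc ` {(i, j). i < j \<and> i < n \<and> i \<notin> A \<and> j \<in> A}" (is "?L = ?R")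
  proof (rule set_eqI, clarify)
    fix i j show "(i, j) \<in> ?L \<longleftrightarrow> (i, j) \<in> ?R"
      by (cases i; cases j) (auto simp: image_iff)
  qed
  then show ?thesis unfolding inversions_def by (simp add: card_image inj_on_def)
qed

lemma inversions_Suc: 
  assumes "A \<subseteq> {..<n}"
  shows "inversions (Suc n) (Suc ` A) = card A + inversions n A"
proof -
  let ?S = "{(i, j). i < j \<and> i < n \<and> i \<notin> A \<and> j \<in> A}"
  have fin: "finite A" using assms finite_subset by auto
  have "{(i, j). i < j \<and> i < Suc n \<and> i \<notin> Suc ` A \<and> j \<in> Suc ` A}
      = Pair 0 ` Suc ` A \<union> map_prod Suc Suc ` ?S" (is "?L = ?R")
  proof (rule set_eqI, clarify)
    fix i j show "(i, j) \<in> ?L \<longleftrightarrow> (i, j) \<in> ?R"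
      by (cases i; cases j) (auto simp: image_iff)
  qed
  moreover have "finite ?S"
    by (rule finite_subset[of _ "{..<n} \<times> A"]) (use fin in auto)
  moreover have "Pair 0 ` Suc ` A \<inter> map_prod Suc Suc ` ?S = {}" by auto
  ultimately show ?thesis unfolding inversions_def using fin
    by (simp add: card_Un_disjoint card_image inj_on_def)
qed

lemma Pow_lessThan_Suc_image:
  "Pow {..<Suc n} = (\<lambda>A. insert 0 (Suc ` A)) ` Pow {..<n} \<union> (\<lambda>A. Suc ` A) ` Pow {..<n}" (is "?L = ?R")
proof
  show "?L \<subseteq> ?R"
  proof
    fix A assume A: "A \<in> ?L"
    define B where "B = {j. Suc j \<in> A}"
    have B: "B \<in> Pow {..<n}" using A by (auto simp: B_def)
    have "A = (if 0 \<in> A then insert 0 (Suc ` B) else Suc ` B)"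
    proof (rule set_eqI)
      fix i show "i \<in> A \<longleftrightarrow> i \<in> (if 0 \<in> A then insert 0 (Suc ` B) else Suc ` B)"
        by (cases i) (auto simp: B_def)
    qed
    then show "A \<in> ?R" using B by (metis (no_types, lifting) UnCI image_eqI)
  qed
qed auto

text \<open>Links the sums over position sets in \<open>wedge_def\<close> and
  \<open>form_inner_def\<close> to the recursion. The sets are split by whether they contain 0; an
  entry sent to the right part jumps over the whole left part, which accounts for the factor
  \<open>(-1) ^ length l\<close> in \<open>splits\<close>.\<close>

lemma sum_splits:
  "(\<Sum>(s, l, r)\<leftarrow>splits xs. F s l r) =
    (\<Sum>A\<in>Pow {..<length xs}. F ((-1) ^ inversions (length xs) A) (nths xs A) (nths xs (- A)) :: real)"
proof (induction xs arbitrary: F)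
  case Nil
  then show ?case by (simp add: inversions_def)
next
  case (Cons x xs)
  let ?n = "length xs"
  have inj: "inj_on (\<lambda>A. insert 0 (Suc ` A)) (Pow {..<?n})" "inj_on (\<lambda>A. Suc ` A) (Pow {..<?n})"
    by (auto simp: inj_on_def dest!: insert_ident[THEN iffD1, rotated 2])
  have len: "length (nths xs A) = card A" if "A \<in> Pow {..<?n}" for A
  proof -
    have "{i. i < ?n \<and> i \<in> A} = A" using that by auto
    then show ?thesis by (simp add: length_nths)
  qed
  have e: "{j. Suc j \<in> - Suc ` A} = - A" "{j. Suc j \<in> - insert 0 (Suc ` A)} = - A"
    "{j. Suc j \<in> Suc ` A} = A" "{j. Suc j \<notin> Suc ` A} = - A" for A by auto
  have "(\<Sum>A\<in>Pow {..<Suc ?n}. F ((-1) ^ inversions (Suc ?n) A) (nths (x # xs) A) (nths (x # xs) (- A))) =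
    (\<Sum>A\<in>(\<lambda>A. insert 0 (Suc ` A)) ` Pow {..<?n}. F ((-1) ^ inversions (Suc ?n) A) (nths (x # xs) A) (nths (x # xs) (- A))) +
    (\<Sum>A\<in>(\<lambda>A. Suc ` A) ` Pow {..<?n}. F ((-1) ^ inversions (Suc ?n) A) (nths (x # xs) A) (nths (x # xs) (- A)))"
    unfolding Pow_lessThan_Suc_image by (rule sum.union_disjoint) auto
  also have "\<dots> = (\<Sum>A\<in>Pow {..<?n}. F ((-1) ^ inversions ?n A) (x # nths xs A) (nths xs (- A))) +
    (\<Sum>A\<in>Pow {..<?n}. F ((-1) ^ inversions ?n A * (-1) ^ length (nths xs A)) (nths xs A) (x # nths xs (- A)))"
    unfolding sum.reindex[OF inj(1)] sum.reindex[OF inj(2)]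
    by (intro arg_cong2[where f="(+)"] sum.cong)
       (auto simp: inversions_insert_0_Suc inversions_Suc nths_Cons len e power_add mult.commute)
  also have "\<dots> = (\<Sum>(s, l, r)\<leftarrow>splits (x # xs). F s l r)"
    using Cons.IH[of "\<lambda>s l r. F s (x # l) r"] Cons.IH[of "\<lambda>s l r. F (s * (-1) ^ length l) l (x # r)"]
    by (simp add: o_def case_prod_unfold)
  finally show ?case by simp
qed

lemma wedge_splits: "wedge \<alpha> \<beta> xs = (\<Sum>(s, l, r)\<leftarrow>splits xs. of_int s * \<alpha> l * \<beta> r)"
  unfolding sum_splits wedge_def inversions_def by simp

lemma splits_length: "(s, l, r) \<in> set (splits xs) \<Longrightarrow> length l + length r = length xs"
  by (induction xs arbitrary: s l r) auto

lemma wedge_add_left: "wedge (\<alpha> + \<alpha>') \<beta> = wedge \<alpha> \<beta> + wedge \<alpha>' \<beta>"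
  by (rule ext) (simp add: wedge_def algebra_simps sum.distrib)
lemma wedge_add_right: "wedge \<alpha> (\<beta> + \<beta>') = wedge \<alpha> \<beta> + wedge \<alpha> \<beta>'"
  by (rule ext) (simp add: wedge_def algebra_simps sum.distrib)
lemma wedge_scale_left: "wedge (c *\<^sub>R \<alpha>) \<beta> = c *\<^sub>R wedge \<alpha> \<beta>"
  by (rule ext) (simp add: wedge_def sum_distrib_left algebra_simps)
lemma wedge_scale_right: "wedge \<alpha> (c *\<^sub>R \<beta>) = c *\<^sub>R wedge \<alpha> \<beta>"
  by (rule ext) (simp add: wedge_def sum_distrib_left algebra_simps)
lemma linear_wedge_left: "linear (\<lambda>\<alpha>. wedge \<alpha> \<beta>)"
  by (rule linearI) (auto simp: wedge_add_left wedge_scale_left)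
lemma linear_wedge_right: "linear (wedge \<alpha>)"
  by (rule linearI) (auto simp: wedge_add_right wedge_scale_right)
lemmas wedge_0_left [simp] = linear_0[OF linear_wedge_left]
lemmas wedge_0_right [simp] = linear_0[OF linear_wedge_right]
lemmas wedge_diff_left = linear_diff[OF linear_wedge_left]
lemmas wedge_diff_right = linear_diff[OF linear_wedge_right]
lemmas wedge_minus_left = linear_neg[OF linear_wedge_left]
lemmas wedge_minus_right = linear_neg[OF linear_wedge_right]

text \<open>Contraction is an antiderivation. This formula replaces shuffles in everything that
  follows: identities between wedge products are proved by induction on the arguments.\<close>

lemma interior_wedge:
  assumes "\<alpha> \<in> alt_forms a"
  shows "interior x (wedge \<alpha> \<beta>) = wedge (interior x \<alpha>) \<beta> + (-1) ^ a *\<^sub>R wedge \<alpha> (interior x \<beta>)"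
proof
  fix xs
  \<comment> \<open>The sign depending on \<open>length l\<close> may be replaced by
    \<open>(-1) ^ a\<close>, since \<open>\<alpha> l\<close> vanishes for all other lengths.\<close>
  have "(\<Sum>(s, l, r)\<leftarrow>splits xs. of_int (s * (-1) ^ length l) * \<alpha> l * \<beta> (x # r)) =
    (\<Sum>(s, l, r)\<leftarrow>splits xs. (-1) ^ a * (of_int s * \<alpha> l * \<beta> (x # r)))"
    using alt_forms_length[OF assms]
    by (intro arg_cong[where f=sum_list] map_cong) (auto, metis+)
  then show "interior x (wedge \<alpha> \<beta>) xs =
      (wedge (interior x \<alpha>) \<beta> + (-1) ^ a *\<^sub>R wedge \<alpha> (interior x \<beta>)) xs"
    by (simp add: interior_def wedge_splits o_def case_prod_unfold sum_list_const_mult)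
qed

lemma wedge_length:
  assumes "\<alpha> \<in> alt_forms a" "\<beta> \<in> alt_forms b" "length xs \<noteq> a + b"
  shows "wedge \<alpha> \<beta> xs = 0"
proof -
  have z: "of_int s * \<alpha> l * \<beta> r = 0" if "(s, l, r) \<in> set (splits xs)" for s l r
    using assms(3) splits_length[OF that] alt_forms_length[OF assms(1), of l]
      alt_forms_length[OF assms(2), of r] by force
  have "wedge \<alpha> \<beta> xs = (\<Sum>(s, l, r)\<leftarrow>splits xs. 0)"
    unfolding wedge_splits using z by (intro arg_cong[where f=sum_list] map_cong) auto
  then show ?thesis by (simp add: case_prod_unfold)
qed

lemma wedge_alt:
  assumes "\<alpha> \<in> alt_forms a" "\<beta> \<in> alt_forms b"
  shows "wedge \<alpha> \<beta> \<in> alt_forms (a + b)"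
  using assms
proof (induction "a + b" arbitrary: a b \<alpha> \<beta>)
  case 0
  then show ?case using wedge_length[OF 0(2,3)] by (auto simp: alt_forms_def)
next
  case (Suc n)
  note A = Suc.prems(1) and B = Suc.prems(2)
  have iA: "wedge (interior x \<alpha>) \<beta> \<in> alt_forms n" for x
  proof (cases a)
    case 0
    then show ?thesis using alt_forms_zero_deg_interior[of \<alpha> x] A by auto
  next
    case (Suc a')
    then show ?thesis using Suc.hyps(1)[of a' b] Suc.hyps(2) interior_alt_Suc[of \<alpha> a' x] A B by auto
  qed
  have iB: "wedge \<alpha> (interior x \<beta>) \<in> alt_forms n" for x
  proof (cases b)
    case 0
    then show ?thesis using alt_forms_zero_deg_interior[of \<beta> x] B by auto
  next
    case (Suc b')
    then show ?thesis using Suc.hyps(1)[of a b'] Suc.hyps(2) interior_alt_Suc[of \<beta> b' x] A B by auto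
  qed
  have "wedge \<alpha> \<beta> \<in> alt_forms (Suc n)"
  proof (rule alt_forms_SucI)
    show "wedge \<alpha> \<beta> [] = 0" using wedge_length[OF A B, of "[]"] Suc.hyps(2) by (metis list.size(3) nat.distinct(1))
    show "interior x (wedge \<alpha> \<beta>) \<in> alt_forms n" for x
      unfolding interior_wedge[OF A] by (intro alt_forms_add alt_forms_scale iA iB)
    have "linear (\<lambda>x. wedge (interior x \<alpha>) \<beta>)" "linear (\<lambda>x. wedge \<alpha> (interior x \<beta>))"
      using linear_compose[OF linear_interior[OF A] linear_wedge_left[of \<beta>]]
        linear_compose[OF linear_interior[OF B] linear_wedge_right[of \<alpha>]] by (auto simp: o_def)
    then show "linear (\<lambda>x. interior x (wedge \<alpha> \<beta>))"
      unfolding interior_wedge[OF A] by (intro linear_compose_add linear_compose_scale_right)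
    show "interior x (interior x (wedge \<alpha> \<beta>)) = 0" for x
    proof (cases a)
      case 0
      then show ?thesis
        using A alt_forms_zero_deg_interior[of \<alpha>] interior_interior_same[OF B]
        by (simp add: interior_wedge[OF A])
    next
      case (Suc a')
      have A': "interior x \<alpha> \<in> alt_forms a'" using A Suc interior_alt_Suc by auto
      show ?thesis
        by (simp add: interior_wedge[OF A] interior_wedge[OF A'] interior_interior_same[OF A]
          interior_interior_same[OF B] Suc)
    qed
  qed
  then show ?case using Suc.hyps(2) by simp
qed

lemma lact_wedge:
  assumes "\<alpha> \<in> alt_forms a" "\<beta> \<in> alt_forms b" "linear D"
  shows "lact D (wedge \<alpha> \<beta>) = wedge (lact D \<alpha>) \<beta> + wedge \<alpha> (lact D \<beta>)"
proof
  fix xs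
  show "lact D (wedge \<alpha> \<beta>) xs = (wedge (lact D \<alpha>) \<beta> + wedge \<alpha> (lact D \<beta>)) xs"
    using assms(1,2)
  proof (induction xs arbitrary: \<alpha> \<beta> a b)
    case Nil
    then show ?case by (simp add: wedge_splits)
  next
    case (Cons x xs)
    note A = Cons.prems(1) and B = Cons.prems(2)
    note lA = lact_alt[OF assms(3) A]
    have "wedge \<gamma> \<delta> (y # xs) = interior y (wedge \<gamma> \<delta>) xs" for \<gamma> \<delta> y by (simp add: interior_def)
    then show ?case
      using Cons.IH[OF interior_alt[OF A] B] Cons.IH[OF A interior_alt[OF B]]
      by (simp add: interior_wedge[OF A] interior_wedge[OF lA] lact_add lact_scale interior_lact
        wedge_add_left wedge_add_right algebra_simps)
  qed
qed

section \<open>The Chevalley-Eilenberg differential and Cartan's formula\<close>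

lemma ce_d_add: "ce_d br (\<alpha> + \<beta>) = ce_d br \<alpha> + ce_d br \<beta>"
  by (rule ext) (simp add: ce_d_def case_prod_unfold algebra_simps sum.distrib)
lemma ce_d_scale: "ce_d br (c *\<^sub>R \<alpha>) = c *\<^sub>R ce_d br \<alpha>"
  by (rule ext) (simp add: ce_d_def case_prod_unfold sum_distrib_left algebra_simps)
lemma linear_ce_d: "linear (ce_d br)"
  by (rule linearI) (auto simp: ce_d_add ce_d_scale)
lemmas ce_d_0 [simp] = linear_0[OF linear_ce_d]

lemma lact_eq_sum:
  assumes "\<alpha> \<in> alt_forms k"
  shows "(\<Sum>j<length xs. (-1) ^ j * \<alpha> (f (xs ! j) # nths xs (- {j}))) = lact f \<alpha> xs"
  using assms
proof (induction xs arbitrary: \<alpha> k)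
  case (Cons x xs)
  have e: "{j. Suc j \<in> - {0}} = UNIV" "{j. Suc j \<in> - {Suc i}} = - {i}"
    "0 \<notin> - {0::nat}" "0 \<in> - {Suc i}" for i by auto
  have "\<alpha> (f (xs ! j) # x # ys) = - interior x \<alpha> (f (xs ! j) # ys)" for j ys
    using alt_swap[OF Cons.prems, of "f (xs ! j)" x] by (simp add: interior_def)
  then have "(\<Sum>j<length (x # xs). (-1) ^ j * \<alpha> (f ((x # xs) ! j) # nths (x # xs) (- {j})))
    = \<alpha> (f x # xs) + (\<Sum>j<length xs. (-1) ^ j * interior x \<alpha> (f (xs ! j) # nths xs (- {j})))"
    unfolding length_Cons sum.lessThan_Suc_shift by (simp add: nths_Cons e nths_all del: Compl_iff)
  then show ?case
    using Cons.IH[OF interior_alt[OF Cons.prems], of x] by simp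
qed simp

text \<open>Cartan's formula, with \<open>- lact (br x)\<close> as the Lie derivative along
  \<open>x\<close>. Among the index pairs of \<open>ce_d\<close>, those containing position 0 give
  the Lie derivative, the others the differential of the contraction.\<close>

lemma ce_d_Cons:
  assumes "\<alpha> \<in> alt_forms k"
  shows "ce_d br \<alpha> (x # xs) = - lact (br x) \<alpha> xs - ce_d br (interior x \<alpha>) xs"
proof -
  let ?n = "length xs" and ?P = "\<lambda>n. {(i, j). i < j \<and> j < (n::nat)}"
  let ?g = "\<lambda>p. (-1) ^ (fst p + snd p) * \<alpha> (br ((x # xs) ! fst p) ((x # xs) ! snd p) # nths (x # xs) (- {fst p, snd p}))"
  have set: "?P (Suc ?n) = (\<lambda>j. (0, Suc j)) ` {..<?n} \<union> map_prod Suc Suc ` ?P ?n" (is "?L = ?R")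
  proof (rule set_eqI, clarify)
    fix i j show "(i, j) \<in> ?L \<longleftrightarrow> (i, j) \<in> ?R"
      by (cases i; cases j) (auto simp: image_iff)
  qed
  have fin: "finite (?P ?n)"
    by (rule finite_subset[of _ "{..<?n} \<times> {..<?n}"]) auto
  have e: "{j. Suc j \<in> - {0, Suc i}} = - {i}" "{j. Suc j \<in> - {Suc i, Suc i'}} = - {i, i'}"
    "0 \<notin> - {0::nat, Suc i}" "0 \<in> - {Suc i, Suc i'}" "{j. j \<noteq> i \<and> j \<noteq> i'} = - {i, i'}" for i i' by auto
  have "ce_d br \<alpha> (x # xs) = sum ?g (?P (Suc ?n))"
    by (simp add: ce_d_def case_prod_unfold)
  also have "\<dots> = sum ?g ((\<lambda>j. (0, Suc j)) ` {..<?n}) + sum ?g (map_prod Suc Suc ` ?P ?n)"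
    unfolding set using fin by (intro sum.union_disjoint) auto
  also have "sum ?g ((\<lambda>j. (0, Suc j)) ` {..<?n}) = - lact (br x) \<alpha> xs"
    by (subst sum.reindex)
      (auto simp: inj_on_def nths_Cons e lact_eq_sum[OF assms, symmetric] sum_negf simp del: Compl_iff)
  also have "sum ?g (map_prod Suc Suc ` ?P ?n) = - ce_d br (interior x \<alpha>) xs"
  proof -
    have "\<alpha> (y # x # ys) = - interior x \<alpha> (y # ys)" for y ys
      using alt_swap[OF assms, of y x] by (simp add: interior_def)
    then show ?thesis
      by (subst sum.reindex)
        (auto simp: inj_on_def nths_Cons e ce_d_def sum_negf[symmetric] case_prod_unfold intro!: sum.cong)
  qed
  finally show ?thesis by simp
qed

lemma ce_d_Nil [simp]: "ce_d br \<alpha> [] = 0"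
  by (simp add: ce_d_def)

lemma interior_ce_d:
  "\<alpha> \<in> alt_forms k \<Longrightarrow> interior x (ce_d br \<alpha>) = - lact (br x) \<alpha> - ce_d br (interior x \<alpha>)"
  by (rule ext) (simp add: interior_def[of x "ce_d br \<alpha>"] ce_d_Cons)

lemma ce_d_alt:
  assumes "bilinear br" "\<And>x. br x x = 0" "\<alpha> \<in> alt_forms k"
  shows "ce_d br \<alpha> \<in> alt_forms (Suc k)"
  using assms(3)
proof (induction k arbitrary: \<alpha>)
  have lin1: "linear (br x)" for x using assms(1) by (simp add: bilinear_def)
  have lin2: "linear (\<lambda>v. br v x)" for x using assms(1) by (simp add: bilinear_def)
  have *: "ce_d br \<alpha> \<in> alt_forms (Suc k)" if A: "\<alpha> \<in> alt_forms k"
    and IH: "\<And>x. ce_d br (interior x \<alpha>) \<in> alt_forms k" for k and \<alpha> :: "'a form"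
  proof (rule alt_forms_SucI)
    show "interior x (ce_d br \<alpha>) \<in> alt_forms k" for x
      unfolding interior_ce_d[OF A] by (intro alt_forms_diff alt_forms_neg lact_alt lin1 A IH)
    have "linear (\<lambda>x. ce_d br (interior x \<alpha>))"
      using linear_compose[OF linear_interior[OF A] linear_ce_d[of br]] by (simp add: o_def)
    then show "linear (\<lambda>x. interior x (ce_d br \<alpha>))"
      unfolding interior_ce_d[OF A]
      by (intro linear_compose_sub linear_compose_neg linear_lact_fst[OF A] lin2)
    show "interior x (interior x (ce_d br \<alpha>)) = 0" for x
      using linear_0[OF linear_interior[OF A]]
      by (simp add: interior_ce_d[OF A] interior_ce_d[OF interior_alt[OF A]] interior_lact assms(2)
         interior_interior_same[OF A])
  qed simp
  {
    case 0
    have "ce_d br (interior x \<alpha>) \<in> alt_forms 0" for x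
      using alt_forms_zero_deg_interior[OF 0, of x] by simp
    then show ?case using *[OF 0] by auto
  next
    case (Suc k)
    then show ?case using * interior_alt_Suc by blast
  }
qed

text \<open>Cartan's formula reduces the antiderivation rule to the contracted forms; the remaining
  Lie derivative terms agree by \<open>lact_wedge\<close>.\<close>

lemma ce_d_wedge:
  assumes "bilinear br" "\<And>x. br x x = 0" "\<alpha> \<in> alt_forms a" "\<beta> \<in> alt_forms b"
  shows "ce_d br (wedge \<alpha> \<beta>) = wedge (ce_d br \<alpha>) \<beta> + (-1) ^ a *\<^sub>R wedge \<alpha> (ce_d br \<beta>)"
proof
  have lin1: "linear (br x)" for x using assms(1) by (simp add: bilinear_def)
  fix xs
  show "ce_d br (wedge \<alpha> \<beta>) xs = (wedge (ce_d br \<alpha>) \<beta> + (-1) ^ a *\<^sub>R wedge \<alpha> (ce_d br \<beta>)) xs"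
    using assms(3,4)
  proof (induction xs arbitrary: \<alpha> \<beta> a b)
    case Nil
    then show ?case by (simp add: wedge_splits)
  next
    case (Cons x xs)
    note A = Cons.prems(1) and B = Cons.prems(2)
    note dA = ce_d_alt[OF assms(1,2) A]
    have w: "wedge \<gamma> \<delta> (x # xs) = interior x (wedge \<gamma> \<delta>) xs" for \<gamma> \<delta> by (simp add: interior_def)
    \<comment> \<open>For \<open>a = 0\<close> the exponent \<open>a - 1\<close> is truncated and
      the sign rule would fail, but then the contraction of \<open>\<alpha>\<close> is zero.\<close>
    have sg: "(-1) ^ (a - 1) *\<^sub>R wedge (interior x \<alpha>) \<delta> = - ((-1) ^ a *\<^sub>R wedge (interior x \<alpha>) \<delta>)" for \<delta>
      using A alt_forms_zero_deg_interior[of \<alpha> x] by (cases a) auto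
    have sg': "(-1) ^ (a - 1) * wedge (interior x \<alpha>) \<delta> xs = - ((-1) ^ a * wedge (interior x \<alpha>) \<delta> xs)" for \<delta>
      using fun_cong[OF sg[of \<delta>], of xs] by simp
    show ?case
      unfolding ce_d_Cons[OF wedge_alt[OF A B]] w
      using Cons.IH[OF interior_alt[OF A] B, of x] Cons.IH[OF A interior_alt[OF B], of x]
      by (simp add: interior_wedge[OF A] interior_wedge[OF dA] ce_d_add ce_d_scale
        interior_ce_d[OF A] interior_ce_d[OF B] lact_wedge[OF A B lin1] sg'
        wedge_add_left wedge_add_right wedge_diff_left wedge_diff_right wedge_minus_left wedge_minus_right algebra_simps w
        del: One_nat_def)
  qed
qed

section \<open>Frames and bases of exterior forms\<close>

lemma increasing_list_split:
  "sorted_wrt (<) js \<Longrightarrow> (i::nat) \<notin> set js \<Longrightarrow>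
   \<exists>as bs. js = as @ bs \<and> (\<forall>a\<in>set as. a < i) \<and> (\<forall>b\<in>set bs. i < b)"
proof (induction js)
  case (Cons j js)
  show ?case
  proof (cases "j < i")
    case True
    obtain as bs where "js = as @ bs" "\<forall>a\<in>set as. a < i" "\<forall>b\<in>set bs. i < b"
      using Cons by auto
    then show ?thesis using True by (intro exI[of _ "j # as"] exI[of _ bs]) auto
  next
    case False
    then show ?thesis using Cons.prems
      by (intro exI[of _ "[]"] exI[of _ "j # js"]) (auto intro: less_trans)
  qed
qed auto

lemma sorted_nths_upt: "sorted_wrt (<) (nths [0..<n] A)"
  by (simp add: strict_sorted_iff sorted_nths)

lemma set_nths_upt: "set (nths [0..<n] A) = A \<inter> {..<n}"
  by (force simp: set_nths)

lemma nths_upt_eq: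
  assumes "sorted_wrt (<) js" "set js \<subseteq> {..<n}"
  shows "nths [0..<n] (set js) = js"
  using strict_sorted_equal[OF assms(1) sorted_nths_upt[of n "set js"]] assms(2)
  by (auto simp: set_nths_upt)

lemma length_nths_upt: "A \<subseteq> {..<n} \<Longrightarrow> length (nths [0..<n] A) = card A"
  using distinct_card[of "nths [0..<n] A"] by (simp add: set_nths_upt inf.absorb1)

lemma sorted_lt_distinct: "sorted_wrt (<) (js :: nat list) \<Longrightarrow> distinct js"
  by (simp add: strict_sorted_iff)

lemma wedge_vanish_left:
  assumes "\<And>y. y \<in> set xs \<Longrightarrow> \<alpha> [y] = 0" "\<alpha> \<in> alt_forms 1"
  shows "wedge \<alpha> \<beta> xs = 0"
proof -
  have sub: "set l \<subseteq> set xs" if "(s, l, r) \<in> set (splits xs)" for s l r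
    using that by (induction xs arbitrary: s l r) (auto, blast+)
  have z: "of_int s * \<alpha> l * \<beta> r = 0" if "(s, l, r) \<in> set (splits xs)" for s l r
  proof (cases "length l = 1")
    case True
    then obtain y where "l = [y]" by (auto simp: length_Suc_conv)
    then show ?thesis using assms(1)[of y] sub[OF that] by auto
  next
    case False
    then show ?thesis using alt_forms_length[OF assms(2)] by simp
  qed
  have "wedge \<alpha> \<beta> xs = (\<Sum>(s, l, r)\<leftarrow>splits xs. 0)"
    unfolding wedge_splits using z by (intro arg_cong[where f=sum_list] map_cong) auto
  then show ?thesis by (simp add: case_prod_unfold)
qed

definition one_form :: "('a \<Rightarrow> real) \<Rightarrow> ('a::real_vector) form" where
  "one_form f = (\<lambda>xs. case xs of [x] \<Rightarrow> f x | _ \<Rightarrow> 0)"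

lemma one_form_simps [simp]:
  "one_form f [] = 0" "one_form f [x] = f x" "one_form f (x # y # ys) = 0"
  by (auto simp: one_form_def)

lemma one_form_alt: "linear f \<Longrightarrow> one_form f \<in> alt_forms 1"
  by (auto simp: alt_forms_def length_Suc_conv one_form_def split: list.splits)

definition unit_form :: "('a::real_vector) form" where
  "unit_form xs = (if xs = [] then 1 else 0)"

lemma unit_form_alt: "unit_form \<in> alt_forms 0"
  by (auto simp: alt_forms_def unit_form_def)

lemma interior_one_form: "interior x (one_form f) = f x *\<^sub>R unit_form"
  by (rule ext) (auto simp: interior_def one_form_def unit_form_def split: list.splits)

lemma interior_unit_form [simp]: "interior x unit_form = 0"
  by (rule ext) (auto simp: interior_def unit_form_def)

lemma wedge_unit_left: "wedge unit_form \<beta> = \<beta>"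
proof
  show "wedge unit_form \<beta> xs = \<beta> xs" for xs
  proof (induction xs arbitrary: \<beta>)
    case Nil
    then show ?case by (simp add: wedge_splits unit_form_def)
  next
    case (Cons x xs)
    have "wedge unit_form \<beta> (x # xs) = interior x (wedge unit_form \<beta>) xs" by (simp add: interior_def)
    then show ?case using Cons[of "interior x \<beta>"]
      by (simp add: interior_wedge[OF unit_form_alt] interior_def[of x \<beta>])
  qed
qed

lemma wedge_unit_right: 
  assumes "\<alpha> \<in> alt_forms k"
  shows "wedge \<alpha> unit_form = \<alpha>"
proof
  show "wedge \<alpha> unit_form xs = \<alpha> xs" for xs
    using assms
  proof (induction xs arbitrary: \<alpha> k)
    case Nil
    then show ?case by (simp add: wedge_splits unit_form_def)
  next
    case (Cons x xs)
    have "wedge \<alpha> unit_form (x # xs) = interior x (wedge \<alpha> unit_form) xs" by (simp add: interior_def)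
    then show ?case using Cons.IH[OF interior_alt[OF Cons.prems], of x]
      by (simp add: interior_wedge[OF Cons.prems] interior_def[of x \<alpha>])
  qed
qed

locale frame =
  fixes n :: nat and e :: "nat \<Rightarrow> 'a::real_vector" and u :: "nat \<Rightarrow> 'a \<Rightarrow> real"
  assumes linear_u: "i < n \<Longrightarrow> linear (u i)"
    and u_e: "i < n \<Longrightarrow> j < n \<Longrightarrow> u i (e j) = (if i = j then 1 else 0)"
    and expand: "x = (\<Sum>i<n. u i x *\<^sub>R e i)"
begin

definition E :: "'a list" where "E = map e [0..<n]"

lemma length_E [simp]: "length E = n"
  by (simp add: E_def)

lemma nths_E: "nths E A = map e (nths [0..<n] A)"
  by (simp add: E_def nths_map)

lemma e_inj: "i < n \<Longrightarrow> j < n \<Longrightarrow> e i = e j \<longleftrightarrow> i = j"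
  using u_e by (metis zero_neq_one)

lemma linear_expand:
  assumes "linear f"
  shows "f x = (\<Sum>i<n. u i x *\<^sub>R f (e i))"
proof -
  have "f x = f (\<Sum>i<n. u i x *\<^sub>R e i)" by (rule arg_cong[OF expand])
  also have "\<dots> = (\<Sum>i<n. u i x *\<^sub>R f (e i))"
    by (simp add: linear_sum[OF assms] linear_scale[OF assms])
  finally show ?thesis .
qed

lemma linear_eqI:
  assumes "linear f" "linear g" "\<And>i. i < n \<Longrightarrow> f (e i) = g (e i)"
  shows "f = g"
proof
  show "f x = g x" for x
    unfolding linear_expand[OF assms(1), of x] linear_expand[OF assms(2), of x]
    using assms(3) by simp
qed

lemma coords_eqI: 
  assumes "\<And>i. i < n \<Longrightarrow> u i x = u i y"
  shows "x = y"
proof -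
  have "x = (\<Sum>i<n. u i x *\<^sub>R e i)" by (rule expand)
  also have "\<dots> = (\<Sum>i<n. u i y *\<^sub>R e i)" using assms by simp
  also have "\<dots> = y" by (rule expand[symmetric])
  finally show ?thesis .
qed

text \<open>Contraction with a basis vector lowers the degree. An index in front of an increasing
  list is either repeated, which gives 0, or can be moved to its sorted place at the cost of a
  sign.\<close>

lemma form_zero_sorted:
  assumes "\<alpha> \<in> alt_forms k"
    "\<And>js. sorted_wrt (<) js \<Longrightarrow> set js \<subseteq> {..<n} \<Longrightarrow> length js = k \<Longrightarrow> \<alpha> (map e js) = 0"
  shows "\<alpha> = 0"
  using assms
proof (induction k arbitrary: \<alpha>)
  case 0
  have "\<alpha> xs = 0" for xs
    using 0(2)[of "[]"] alt_forms_length[OF 0(1), of xs] by (cases xs) auto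
  then show ?case by auto
next
  case (Suc k)
  have "interior (e i) \<alpha> = 0" if i: "i < n" for i
  proof (rule Suc.IH[OF interior_alt_Suc[OF Suc.prems(1)]])
    fix js assume js: "sorted_wrt (<) js" "set js \<subseteq> {..<n}" "length js = k"
    show "interior (e i) \<alpha> (map e js) = 0"
    proof (cases "i \<in> set js")
      case True
      then have "\<not> distinct (e i # map e js)" by auto
      from alt_forms_not_distinct[OF Suc.prems(1) this] show ?thesis by (simp add: interior_def)
    next
      case False
      obtain as bs where ab: "js = as @ bs" "\<forall>a\<in>set as. a < i" "\<forall>b\<in>set bs. i < b"
        using increasing_list_split[OF js(1) False] by auto
      have "\<alpha> (map e (as @ i # bs)) = 0"
        using ab js i by (intro Suc.prems(2)) (auto simp: sorted_wrt_append intro: less_trans)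
      then show ?thesis
        using alt_move[OF Suc.prems(1), of "e i" "map e as" "map e bs"] ab
        by (simp add: interior_def)
    qed
  qed
  then have *: "\<alpha> (e i # xs) = 0" if "i < n" for i xs
    using fun_cong[OF \<open>\<And>i. i < n \<Longrightarrow> interior (e i) \<alpha> = 0\<close>[OF that], of xs] by (simp add: interior_def)
  have "\<alpha> xs = 0" for xs
  proof (cases xs)
    case Nil
    then show ?thesis using alt_forms_length[OF Suc.prems(1)] by simp
  next
    case (Cons x ys)
    show ?thesis unfolding Cons
      by (subst linear_expand[OF alt_linear_head[OF Suc.prems(1)]]) (simp add: *)
  qed
  then show ?case by auto
qed

lemma form_zero_nths:
  assumes "\<alpha> \<in> alt_forms k"
    "\<And>A. A \<subseteq> {..<n} \<Longrightarrow> card A = k \<Longrightarrow> \<alpha> (nths E A) = 0"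
  shows "\<alpha> = 0"
proof (rule form_zero_sorted[OF assms(1)])
  fix js assume js: "sorted_wrt (<) js" "set js \<subseteq> {..<n}" "length js = k"
  then have "card (set js) = k" using sorted_lt_distinct distinct_card by blast
  from assms(2)[OF js(2) this] show "\<alpha> (map e js) = 0"
    using nths_upt_eq[OF js(1,2)] by (simp add: nths_E)
qed

lemma forms_eq_nths:
  assumes "\<alpha> \<in> alt_forms k" "\<beta> \<in> alt_forms k"
    "\<And>A. A \<subseteq> {..<n} \<Longrightarrow> card A = k \<Longrightarrow> \<alpha> (nths E A) = \<beta> (nths E A)"
  shows "\<alpha> = \<beta>"
  using form_zero_nths[OF alt_forms_diff[OF assms(1,2)]] assms(3) by auto

section \<open>Monomials in the dual basis and dimensions of spaces of forms\<close>

primrec mon :: "nat list \<Rightarrow> 'a form" where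
  "mon [] = unit_form"
| "mon (i # js) = wedge (one_form (u i)) (mon js)"

lemma mon_alt: "set js \<subseteq> {..<n} \<Longrightarrow> mon js \<in> alt_forms (length js)"
proof (induction js)
  case (Cons i js)
  then have "wedge (one_form (u i)) (mon js) \<in> alt_forms (1 + length js)"
    by (intro wedge_alt one_form_alt linear_u) auto
  then show ?case by simp
qed (simp add: unit_form_alt)

lemma interior_mon_notin:
  "set js \<subseteq> {..<n} \<Longrightarrow> i < n \<Longrightarrow> i \<notin> set js \<Longrightarrow> interior (e i) (mon js) = 0"
proof (induction js)
  case (Cons j js)
  have alt: "one_form (u j) \<in> alt_forms 1" using Cons.prems by (intro one_form_alt linear_u) auto
  have "interior (e i) (mon js) = 0" "u j (e i) = 0" using Cons u_e[of j i] by auto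
  then show ?case
    unfolding mon.simps interior_wedge[OF alt] interior_one_form
    by (simp only: scale_zero_left scale_zero_right wedge_0_left wedge_0_right add_0_left)
qed simp

text \<open>Contract with the first vector \<open>e j\<close>. If the leading index \<open>i\<close>
  is not \<open>j\<close>, then either \<open>j\<close> is missing from \<open>ks\<close> and the
  contraction vanishes, or \<open>i < j\<close> and \<open>u i\<close> kills all remaining
  vectors.\<close>

lemma mon_eval:
  assumes "sorted_wrt (<) is" "sorted_wrt (<) js" "set is \<subseteq> {..<n}" "set js \<subseteq> {..<n}"
  shows "mon is (map e js) = (if is = js then 1 else 0)"
  using assms
proof (induction js arbitrary: "is")
  case Nil
  have "mon is [] = 0" if "is \<noteq> []" using alt_forms_length[OF mon_alt[OF Nil(3)], of "[]"] that by simp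
  then show ?case by (cases "is = []") (simp_all add: unit_form_def)
next
  case (Cons j js)
  show ?case
  proof (cases "is")
    case Nil
    then show ?thesis by (simp add: unit_form_def)
  next
    case C: (Cons i ks)
    have i: "i < n" "set ks \<subseteq> {..<n}" "\<And>k. k \<in> set ks \<Longrightarrow> i < k" "sorted_wrt (<) ks"
      using Cons.prems(1,3) C by auto
    have j: "j < n" "set js \<subseteq> {..<n}" "\<And>k. k \<in> set js \<Longrightarrow> j < k" "sorted_wrt (<) js"
      using Cons.prems(2,4) by auto
    have alt: "one_form (u i) \<in> alt_forms 1" by (intro one_form_alt linear_u i)
    have *: "mon is (map e (j # js)) = u i (e j) * mon ks (map e js)
        - wedge (one_form (u i)) (interior (e j) (mon ks)) (map e js)"
    proof -
      have "mon is (map e (j # js)) = interior (e j) (wedge (one_form (u i)) (mon ks)) (map e js)"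
        by (simp add: interior_def C)
      also have "\<dots> = u i (e j) * wedge unit_form (mon ks) (map e js)
        - wedge (one_form (u i)) (interior (e j) (mon ks)) (map e js)"
        unfolding interior_wedge[OF alt] interior_one_form wedge_scale_left by simp
      finally show ?thesis by (simp only: wedge_unit_left)
    qed
    show ?thesis
    proof (cases "i = j")
      case True
      have "interior (e j) (mon ks) = 0"
        by (rule interior_mon_notin[OF i(2) j(1)]) (use i(3) True in blast)
      then have "mon is (map e (j # js)) = mon ks (map e js)"
        unfolding * using True u_e[OF i(1) j(1)] by (simp only: wedge_0_right zero_fun_app) simp
      then show ?thesis using Cons.IH[OF i(4) j(4) i(2) j(2)] C True by simp
    next
      case False
      have "wedge (one_form (u i)) (interior (e j) (mon ks)) (map e js) = 0"
      proof (cases "j \<in> set ks")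
        case True
        then have "i < j" using i(3) by blast
        show ?thesis
        proof (rule wedge_vanish_left[OF _ alt])
          fix y assume "y \<in> set (map e js)"
          then obtain k where k: "y = e k" "k \<in> set js" by auto
          then have "k < n" "i \<noteq> k" using j(2,3) \<open>i < j\<close> by force+
          then show "one_form (u i) [y] = 0" using u_e[OF i(1), of k] k(1) by simp
        qed
      next
        case F: False
        then have "interior (e j) (mon ks) = 0" by (rule interior_mon_notin[OF i(2) j(1)])
        then show ?thesis by (simp only: wedge_0_right zero_fun_app)
      qed
      then show ?thesis using * C False u_e[OF i(1) j(1)] by simp
    qed
  qed
qed

definition theta :: "nat set \<Rightarrow> 'a form" where
  "theta A = mon (nths [0..<n] A)"

lemma theta_alt: "A \<subseteq> {..<n} \<Longrightarrow> card A = k \<Longrightarrow> theta A \<in> alt_forms k"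
  using mon_alt[of "nths [0..<n] A"] by (simp add: theta_def set_nths_upt length_nths_upt)

lemma theta_eval:
  assumes "A \<subseteq> {..<n}" "B \<subseteq> {..<n}"
  shows "theta A (nths E B) = (if A = B then 1 else 0)"
proof -
  have "nths [0..<n] A = nths [0..<n] B \<longleftrightarrow> A = B"
    using assms set_nths_upt[of n] by (metis inf.absorb1)
  then show ?thesis
    unfolding theta_def nths_E by (subst mon_eval) (auto simp: sorted_nths_upt set_nths_upt)
qed

lemma finite_subsets: "finite {A. A \<subseteq> {..<n} \<and> card A = k}"
  by (rule finite_subset[of _ "Pow {..<n}"]) auto

lemma fin_dim_alt_forms: "fin_dim (alt_forms k :: 'a form set)"
  by (rule dim_le_functionals(1)[OF finite_subsets[of k] subspace_alt_forms, where f="\<lambda>A \<alpha>. \<alpha> (nths E A)"])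
     (auto intro: linear_apply form_zero_nths)

lemma dim_alt_forms: "dim (alt_forms k :: 'a form set) = n choose k"
proof -
  have card: "card {A. A \<subseteq> {..<n} \<and> card A = k} = n choose k"
    using n_subsets[of "{..<n}" k] by simp
  have "dim (alt_forms k :: 'a form set) \<le> card {A. A \<subseteq> {..<n} \<and> card A = k}"
    by (rule dim_le_functionals(2)[OF finite_subsets[of k] subspace_alt_forms, where f="\<lambda>A \<alpha>. \<alpha> (nths E A)"])
       (auto intro: linear_apply form_zero_nths)
  moreover have "card {A. A \<subseteq> {..<n} \<and> card A = k} \<le> dim (alt_forms k :: 'a form set)"
    by (rule card_dual_family_le[OF finite_subsets[of k] fin_dim_alt_forms, where x=theta and f="\<lambda>A \<alpha>. \<alpha> (nths E A)"])
       (auto intro: linear_apply theta_alt simp: theta_eval)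
  ultimately show ?thesis using card by simp
qed

lemma nths_E_Compl: "nths E (- A) = nths E ({..<n} - A)"
proof -
  have "nths [0..<n] (- A) = nths [0..<n] ({..<n} - A)"
    by (rule strict_sorted_equal[OF sorted_nths_upt sorted_nths_upt]) (auto simp: set_nths_upt)
  then show ?thesis by (simp add: nths_E)
qed

lemma wedge_theta_left:
  assumes "A \<subseteq> {..<n}"
  shows "wedge (theta A) \<xi> E = (-1) ^ inversions n A * \<xi> (nths E (- A))"
proof -
  have "wedge (theta A) \<xi> E = (\<Sum>B\<in>Pow {..<n}. (-1) ^ inversions n B * theta A (nths E B) * \<xi> (nths E (- B)))"
    by (simp add: wedge_def inversions_def)
  also have "\<dots> = (\<Sum>B\<in>Pow {..<n}. if B = A then (-1) ^ inversions n A * \<xi> (nths E (- A)) else 0)"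
    using assms by (intro sum.cong) (auto simp: theta_eval)
  finally show ?thesis using assms by simp
qed

text \<open>Complementary degrees pair perfectly under the wedge product: each component of
  \<open>\<xi>\<close> is detected by the monomial on the complementary indices. Both Poincare
  duality and uniqueness of the Hodge star rest on this.\<close>

lemma wedge_nondegenerate_right:
  assumes "\<xi> \<in> alt_forms l" "k + l = n" "\<And>\<alpha>. \<alpha> \<in> alt_forms k \<Longrightarrow> wedge \<alpha> \<xi> E = 0"
  shows "\<xi> = 0"
proof (rule form_zero_nths[OF assms(1)])
  fix A assume A: "A \<subseteq> {..<n}" "card A = l"
  then have "card ({..<n} - A) = k" using assms(2) by (simp add: card_Diff_subset finite_subset)
  then have "wedge (theta ({..<n} - A)) \<xi> E = 0" by (intro assms(3) theta_alt) auto
  then have "\<xi> (nths E (- ({..<n} - A))) = 0" by (subst (asm) wedge_theta_left) auto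
  moreover have "{..<n} - ({..<n} - A) = A" using A by auto
  ultimately show "\<xi> (nths E A) = 0" by (simp only: nths_E_Compl[of "{..<n} - A"])
qed

lemma fin_dim_endos: "fin_dim {D :: 'a \<Rightarrow> 'a. linear D}"
  and dim_endos: "dim {D :: 'a \<Rightarrow> 'a. linear D} = n * n"
proof -
  let ?I = "{..<n} \<times> {..<n}" and ?f = "\<lambda>p (D :: 'a \<Rightarrow> 'a). u (fst p) (D (e (snd p)))"
  have sub: "subspace {D :: 'a \<Rightarrow> 'a. linear D}"
    unfolding real_vector.subspace_def
    by (auto simp: plus_fun_def scaleR_fun_def zero_fun_def
        intro!: linear_compose_add linear_zero linear_compose_scale_right)
  have lin: "linear (?f p)" if "p \<in> ?I" for p
    using linear_compose[OF linear_apply[of "e (snd p)"] linear_u[of "fst p"]] that by (auto simp: o_def)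
  have z: "D = 0" if D: "D \<in> {D. linear D}" and 0: "\<And>p. p \<in> ?I \<Longrightarrow> ?f p D = 0" for D
  proof -
    have "D (e j) = 0" if j: "j < n" for j
    proof (rule coords_eqI)
      fix i assume i: "i < n"
      show "u i (D (e j)) = u i 0" using 0[of "(i, j)"] i j linear_0[OF linear_u[OF i]] by simp
    qed
    then have "D = (\<lambda>x. 0)" using D by (intro linear_eqI) (auto simp: linear_zero)
    then show ?thesis by (simp only: zero_fun_def)
  qed
  have fd: "fin_dim {D :: 'a \<Rightarrow> 'a. linear D}"
    by (rule dim_le_functionals(1)[where I="?I" and f="?f", OF _ sub lin z]) auto
  have le: "dim {D :: 'a \<Rightarrow> 'a. linear D} \<le> card ?I"
    by (rule dim_le_functionals(2)[where I="?I" and f="?f", OF _ sub lin z]) auto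
  show "fin_dim {D :: 'a \<Rightarrow> 'a. linear D}" by (rule fd)
  have "card ?I \<le> dim {D :: 'a \<Rightarrow> 'a. linear D}"
  proof (rule card_dual_family_le[OF _ fd, where x="\<lambda>p x. u (snd p) x *\<^sub>R e (fst p)" and f="?f"])
    show "(\<lambda>x. u (snd p) x *\<^sub>R e (fst p)) \<in> {D. linear D}" if "p \<in> ?I" for p
      using that linear_u[of "snd p"]
      by (auto intro!: linearI simp: linear_add linear_scale scaleR_add_left)
    show "?f p (\<lambda>x. u (snd q) x *\<^sub>R e (fst q)) = (if p = q then 1 else 0)" if "p \<in> ?I" "q \<in> ?I" for p q
      using that by (auto simp: linear_scale[OF linear_u] linear_0[OF linear_u] u_e prod_eq_iff)
  qed (use lin in auto)
  then show "dim {D :: 'a \<Rightarrow> 'a. linear D} = n * n" using le by simp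
qed

end

lemma subspace_endos: "subspace {D :: 'a::real_vector \<Rightarrow> 'a. linear D}"
  unfolding real_vector.subspace_def
  by (auto simp: plus_fun_def scaleR_fun_def zero_fun_def
      intro!: linear_compose_add linear_zero linear_compose_scale_right)

lemma frame_of_basis:
  fixes e :: "nat \<Rightarrow> 'b::real_vector"
  assumes "inj_on e {..<n}" "independent (e ` {..<n})" "span (e ` {..<n}) = UNIV"
  shows "\<exists>u. frame n e u"
proof -
  let ?B = "e ` {..<n}" 
  let ?u = "\<lambda>i x. representation ?B x (e i)"
  have "frame n e ?u"
  proof (rule frame.intro)
    show "linear (?u i)" if "i < n" for i
      using assms(2,3) by (intro linearI) (auto simp: representation_add representation_scale)
    show "?u i (e j) = (if i = j then 1 else 0)" if "i < n" "j < n" for i j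
      using assms that by (auto simp: representation_basis inj_on_def)
    show "x = (\<Sum>i<n. ?u i x *\<^sub>R e i)" for x
    proof -
      have "x = (\<Sum>b\<in>?B. representation ?B x b *\<^sub>R b)"
        using sum_representation_eq[OF assms(2), of x ?B] assms(3) by auto
      also have "\<dots> = (\<Sum>i<n. ?u i x *\<^sub>R e i)" using assms(1) by (simp add: sum.reindex)
      finally show ?thesis .
    qed
  qed
  then show ?thesis by (intro exI[where x="?u"])
qed

section \<open>Betti numbers of nilpotent Lie algebras\<close>

lemma lie_bracket_swap:
  assumes "lie_bracket br"
  shows "br x y = - br y x"
proof -
  have b: "bilinear br" "\<And>z. br z z = 0" using assms by (auto simp: lie_bracket_def)
  have "br (x + y) (x + y) = br x y + br y x"
    unfolding bilinear_ladd[OF b(1)] bilinear_radd[OF b(1)] using b(2) by simp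
  then show ?thesis unfolding b(2) by (simp add: eq_neg_iff_add_eq_0)
qed

lemma subspace_closed_forms: "subspace (closed_forms br k)"
  unfolding closed_forms_def real_vector.subspace_def
  by (auto simp: ce_d_add ce_d_scale alt_forms_add alt_forms_scale)

context frame
begin

lemma closed_plus_rank:
  "dim (closed_forms br k) + dim (ce_d br ` alt_forms k) = n choose k" for br :: "'a \<Rightarrow> 'a \<Rightarrow> 'a"
  using rank_nullity_fin(1)[OF linear_ce_d subspace_alt_forms fin_dim_alt_forms, of k br]
  by (simp add: closed_forms_def dim_alt_forms)

lemma fin_dim_ce_d_image: "fin_dim (ce_d br ` alt_forms k)" for br :: "'a \<Rightarrow> 'a \<Rightarrow> 'a"
  by (rule rank_nullity_fin(2)[OF linear_ce_d subspace_alt_forms fin_dim_alt_forms])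

lemma fin_dim_closed: "fin_dim (closed_forms br k)" for br :: "'a \<Rightarrow> 'a \<Rightarrow> 'a"
  by (rule fin_dim_subset[OF fin_dim_alt_forms]) (auto simp: closed_forms_def)

text \<open>The rank of the differential is the codimension of the closed forms, so it is bounded by
  any number of functionals whose common zeros are closed.\<close>

lemma rank_le_functionals:
  fixes br :: "'a \<Rightarrow> 'a \<Rightarrow> 'a" and f :: "'i \<Rightarrow> 'a form \<Rightarrow> real"
  assumes "finite I" "\<And>i. i \<in> I \<Longrightarrow> linear (f i)"
    "\<And>\<alpha>. \<alpha> \<in> alt_forms k \<Longrightarrow> (\<And>i. i \<in> I \<Longrightarrow> f i \<alpha> = 0) \<Longrightarrow> ce_d br \<alpha> = 0"
  shows "dim (ce_d br ` alt_forms k) \<le> card I"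
proof -
  have "dim {\<alpha> \<in> alt_forms k. \<forall>i\<in>I. f i \<alpha> = 0} \<le> dim (closed_forms br k)"
    by (rule dim_mono_fin[OF fin_dim_closed]) (use assms(3) in \<open>auto simp: closed_forms_def\<close>)
  then show ?thesis
    using dim_common_kernel_ge[where S="alt_forms k" and f=f and I=I, OF assms(1) subspace_alt_forms fin_dim_alt_forms assms(2)]
      closed_plus_rank[of br k] by (simp add: dim_alt_forms)
qed

text \<open>Poincare duality for ranks. Because the differential kills forms of degree
  \<open>k + l = n - 1\<close>, the differentials on \<open>k\<close>-forms and on
  \<open>l\<close>-forms are adjoint up to sign for the wedge pairing. A form \<open>y\<close>
  orthogonal to all exact forms coming from degree \<open>k\<close> is therefore closed, and it is
  enough to test \<open>y\<close> against a basis of them.\<close>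

lemma rank_duality_le:
  fixes br :: "'a \<Rightarrow> 'a \<Rightarrow> 'a"
  assumes br: "bilinear br" "\<And>x. br x x = 0" and kl: "Suc (k + l) = n"
    and top: "\<And>\<gamma>. \<gamma> \<in> alt_forms (k + l) \<Longrightarrow> ce_d br \<gamma> = 0"
  shows "dim (ce_d br ` alt_forms l) \<le> dim (ce_d br ` alt_forms k)"
proof -
  obtain B where B: "B \<subseteq> ce_d br ` alt_forms k" "independent B" "ce_d br ` alt_forms k \<subseteq> span B"
    "card B = dim (ce_d br ` alt_forms k)" "finite B"
    using fin_dim_basis[OF fin_dim_ce_d_image] .
  have "dim (ce_d br ` alt_forms l) \<le> card B"
  proof (rule rank_le_functionals[where f="\<lambda>b y. wedge b y E"])
    show "finite B" by (rule B)
    show "linear (\<lambda>y. wedge b y E)" for b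
      using linear_compose[OF linear_wedge_right linear_apply] by (simp add: o_def)
    fix y :: "'a form" assume y: "y \<in> alt_forms l" and 0: "\<And>b. b \<in> B \<Longrightarrow> wedge b y E = 0"
    have "subspace {b. wedge b y E = 0}"
      by (auto simp: real_vector.subspace_def wedge_add_left wedge_scale_left)
    then have "span B \<subseteq> {b. wedge b y E = 0}" using 0 by (intro real_vector.span_minimal) auto
    then have dx: "wedge (ce_d br x) y E = 0" if "x \<in> alt_forms k" for x using B(3) that by auto
    have "wedge x (ce_d br y) E = 0" if x: "x \<in> alt_forms k" for x
    proof -
      have "0 = ce_d br (wedge x y) E" using top[OF wedge_alt[OF x y]] by simp
      also have "\<dots> = wedge (ce_d br x) y E + (-1) ^ k * wedge x (ce_d br y) E"
        unfolding ce_d_wedge[OF br x y] by simp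
      finally show ?thesis using dx[OF x] by simp
    qed
    then show "ce_d br y = 0"
      using wedge_nondegenerate_right[OF ce_d_alt[OF br y], of k] kl by simp
  qed
  then show ?thesis using B(4) by simp
qed

text \<open>Unimodularity in coordinates: \<open>[e i, e j]\<close> has no components along
  \<open>e i\<close> and \<open>e j\<close>, and its other components repeat a vector that is
  already among the remaining arguments.\<close>

lemma top_exact_zero:
  fixes br :: "'a \<Rightarrow> 'a \<Rightarrow> 'a"
  assumes br: "bilinear br" "\<And>x. br x x = 0" and n: "n = Suc k"
    and tri: "\<And>i j. i < n \<Longrightarrow> j < n \<Longrightarrow> u i (br (e i) (e j)) = 0 \<and> u j (br (e i) (e j)) = 0"
    and g: "\<gamma> \<in> alt_forms k"
  shows "ce_d br \<gamma> = 0"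
proof (rule form_zero_nths[OF ce_d_alt[OF br g]])
  fix A assume "A \<subseteq> {..<n}" "card A = Suc k"
  then have A: "A = {..<n}" using n by (metis card_lessThan card_subset_eq finite_lessThan)
  have "\<gamma> (br (E ! i) (E ! j) # nths E (- {i, j})) = 0" if ij: "i < j" "j < n" for i j
  proof -
    have "\<gamma> (e l # nths E (- {i, j})) = 0" if l: "l < n" "l \<noteq> i" "l \<noteq> j" for l
    proof -
      have "e l \<in> set (nths E (- {i, j}))" using l by (auto simp: nths_E set_nths_upt)
      then have "\<not> distinct (e l # nths E (- {i, j}))" by simp
      then show ?thesis by (rule alt_forms_not_distinct[OF g])
    qed
    then have "u l (br (e i) (e j)) * \<gamma> (e l # nths E (- {i, j})) = 0" if "l < n" for l
      using tri[of i j] ij that by (cases "l = i \<or> l = j") auto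
    moreover have "\<gamma> (br (e i) (e j) # nths E (- {i, j})) =
        (\<Sum>l<n. u l (br (e i) (e j)) *\<^sub>R \<gamma> (e l # nths E (- {i, j})))"
      by (rule linear_expand[OF alt_linear_head[OF g]])
    ultimately have "\<gamma> (br (e i) (e j) # nths E (- {i, j})) = 0" by (simp add: sum.neutral)
    moreover have "E ! i = e i" "E ! j = e j" using ij by (simp_all add: E_def)
    ultimately show ?thesis by simp
  qed
  then have "ce_d br \<gamma> E = 0" by (auto simp: ce_d_def case_prod_unfold intro!: sum.neutral)
  moreover have "nths E A = E" using A by (simp add: nths_all)
  ultimately show "ce_d br \<gamma> (nths E A) = 0" by simp
qed

end

lemma lower_central_decreasing: "lower_central br (Suc i) \<subseteq> lower_central br i"
proof (induction i)
  case (Suc i)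
  then show ?case by (auto intro!: span_mono)
qed simp

lemma subspace_lower_central: "subspace (lower_central br i)"
  by (cases i) auto

text \<open>One basis adapted to the whole series, obtained by extending from the zero term upwards;
  \<open>k\<close> counts the levels already treated.\<close>

lemma lower_central_basis:
  fixes br :: "'a::euclidean_space \<Rightarrow> 'a \<Rightarrow> 'a"
  assumes m: "lower_central br m = {0}"
  shows "\<exists>B. independent B \<and> (\<forall>i\<le>m. lower_central br i \<subseteq> span (B \<inter> lower_central br i))"
proof -
  let ?L = "lower_central br"
  have "\<exists>B. independent B \<and> B \<subseteq> ?L (m - k) \<and> (\<forall>i\<le>m. m - k \<le> i \<longrightarrow> ?L i \<subseteq> span (B \<inter> ?L i))"
    if "k \<le> m" for k
    using that
  proof (induction k)
    case 0
    then show ?case using m by (intro exI[of _ "{}"]) (auto simp: real_vector.independent_empty)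
  next
    case (Suc k)
    then obtain B where B: "independent B" "B \<subseteq> ?L (m - k)"
      "\<And>i. i \<le> m \<Longrightarrow> m - k \<le> i \<Longrightarrow> ?L i \<subseteq> span (B \<inter> ?L i)" by auto
    have mk: "m - k = Suc (m - Suc k)" using Suc by auto
    have "B \<subseteq> ?L (m - Suc k)"
      using B(2) lower_central_decreasing[of br "m - Suc k"] by (metis mk subset_trans)
    then obtain C where C: "B \<subseteq> C" "C \<subseteq> ?L (m - Suc k)" "independent C" "?L (m - Suc k) \<subseteq> span C"
      using real_vector.maximal_independent_subset_extend[OF _ B(1)] by metis
    have "?L i \<subseteq> span (C \<inter> ?L i)" if i: "i \<le> m" "m - Suc k \<le> i" for i
    proof (cases "i = m - Suc k")
      case True
      then show ?thesis using C by (simp add: inf.absorb1)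
    next
      case False
      then have "?L i \<subseteq> span (B \<inter> ?L i)" using B(3) i mk by auto
      also have "\<dots> \<subseteq> span (C \<inter> ?L i)" using C(1) by (intro span_mono) auto
      finally show ?thesis .
    qed
    then show ?case using C by blast
  qed
  from this[of m] show ?thesis by auto
qed

text \<open>In an adapted basis let \<open>e i\<close> lie in term \<open>p\<close> of the series
  but not in the next. Then \<open>[e i, y]\<close> lies in the next term, which is spanned by basis
  vectors other than \<open>e i\<close>.\<close>

lemma nilpotent_frame:
  fixes br :: "'a::euclidean_space \<Rightarrow> 'a \<Rightarrow> 'a"
  assumes "lie_bracket br" "nilpotent br"
  shows "\<exists>e u. frame DIM('a) e u \<and>
    (\<forall>i<DIM('a). \<forall>j<DIM('a). u i (br (e i) (e j)) = 0 \<and> u j (br (e i) (e j)) = 0)"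
proof -
  let ?L = "lower_central br"
  obtain m where m: "?L m = {0}" using assms(2) by (auto simp: nilpotent_def step_nilpotent_def)
  obtain B where B: "independent B" "\<And>i. i \<le> m \<Longrightarrow> ?L i \<subseteq> span (B \<inter> ?L i)"
    using lower_central_basis[OF m] by auto
  have "span B = UNIV" using B(2)[of 0] by auto
  then have card: "card B = DIM('a)" "finite B"
    using B(1) by (metis dim_UNIV dim_eq_card_independent dim_span) (use B(1) finiteI_independent in auto)
  obtain e where e: "bij_betw e {..<DIM('a)} B"
    using ex_bij_betw_nat_finite[OF card(2)] card(1) by (auto simp: atLeast0LessThan)
  then have e': "inj_on e {..<DIM('a)}" "e ` {..<DIM('a)} = B" by (auto simp: bij_betw_def)
  obtain u where "frame DIM('a) e u"
    using frame_of_basis[OF e'(1)] e'(2) B(1) \<open>span B = UNIV\<close> by auto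
  then interpret frame "DIM('a)" e u .
  have main: "u i (br (e i) y) = 0" if i: "i < DIM('a)" for i y
  proof -
    have "e i \<in> B" using e'(2) i by auto
    then have "e i \<noteq> 0" using B(1) real_vector.dependent_zero[of B] by metis
    then have "e i \<notin> ?L m" unfolding m by simp
    moreover have "\<exists>p. e i \<in> ?L p \<and> e i \<notin> ?L (Suc p)"
    proof (rule ccontr)
      assume "\<not> ?thesis"
      then have step: "e i \<in> ?L p \<Longrightarrow> e i \<in> ?L (Suc p)" for p by blast
      have "e i \<in> ?L p" for p
      proof (induction p)
        case (Suc p)
        then show ?case by (rule step)
      qed simp
      then show False using \<open>e i \<notin> ?L m\<close> by blast
    qed
    then obtain p where p: "e i \<in> ?L p" "e i \<notin> ?L (Suc p)" by blast
    have "Suc p \<le> m"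
    proof (rule ccontr)
      assume "\<not> Suc p \<le> m"
      then have "?L p \<subseteq> ?L m" using lift_Suc_antimono_le[of ?L m p] lower_central_decreasing[of br] by (metis not_less_eq_eq)
      then show False using p(1) \<open>e i \<notin> ?L m\<close> by blast
    qed
    have "br (e i) y \<in> ?L (Suc p)" unfolding lower_central.simps using p(1) by (intro span_base) blast
    then have "br (e i) y \<in> span (B \<inter> ?L (Suc p))" using B(2)[OF \<open>Suc p \<le> m\<close>] by blast
    moreover have "B \<inter> ?L (Suc p) \<subseteq> {x. u i x = 0}"
    proof
      fix b assume b: "b \<in> B \<inter> ?L (Suc p)"
      then obtain j where j: "j < DIM('a)" "b = e j" using e'(2) by auto
      then have "j \<noteq> i" using b p(2) by blast
      then show "b \<in> {x. u i x = 0}" using u_e[OF i j(1)] j(2) by simp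
    qed
    moreover have "subspace {x. u i x = 0}" using linear_u[OF i]
      by (auto simp: subspace_def linear_0 linear_add linear_scale)
    ultimately show ?thesis using span_minimal by blast
  qed
  have "u j (br (e i) (e j)) = 0" if "i < DIM('a)" "j < DIM('a)" for i j
    using main[OF that(2), of "e i"] lie_bracket_swap[OF assms(1), of "e i" "e j"]
    by (simp add: linear_neg[OF linear_u[OF that(2)]])
  then show ?thesis using main \<open>frame DIM('a) e u\<close> by blast
qed

text \<open>Both Betti numbers are 35 minus the ranks of the differential on 2-forms and on 3-forms.
  The last two equations keep the dimensions themselves available, since \<open>betti\<close> is a
  truncated difference.\<close>

lemma nilpotent_betti:
  fixes br :: "'a::euclidean_space \<Rightarrow> 'a \<Rightarrow> 'a"
  assumes "DIM('a) = 7" "lie_bracket br" "nilpotent br"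
  shows "betti br 3 = betti br 4"
    "betti br 3 = dim (closed_forms br 4) - dim (ce_d br ` alt_forms 3)"
    "dim (closed_forms br 4) + dim (ce_d br ` alt_forms 2) = 35"
    "dim (closed_forms br 3) + dim (ce_d br ` alt_forms 3) = 35"
proof -
  obtain e u where f: "frame DIM('a) e u"
    and tri: "\<And>i j. i < DIM('a) \<Longrightarrow> j < DIM('a) \<Longrightarrow> u i (br (e i) (e j)) = 0 \<and> u j (br (e i) (e j)) = 0"
    using nilpotent_frame[OF assms(2,3)] by blast
  interpret frame "DIM('a)" e u by (rule f)
  have br: "bilinear br" "\<And>x. br x x = 0" using assms(2) by (auto simp: lie_bracket_def)
  have top: "ce_d br \<gamma> = 0" if "\<gamma> \<in> alt_forms 6" for \<gamma>
    by (rule top_exact_zero[OF br _ tri that]) (simp_all add: assms(1))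
  \<comment> \<open>Degrees 2 and 4 are dual to each other because 2 + 4 + 1 = 7.\<close>
  have r: "dim (ce_d br ` alt_forms 2) = dim (ce_d br ` alt_forms 4)"
    using rank_duality_le[OF br, of 2 4] rank_duality_le[OF br, of 4 2] top assms(1) by auto
  have ch: "(7::nat) choose 3 = 35" "(7::nat) choose 4 = 35" by (simp_all add: choose_two numeral_eq_Suc)
  have ex: "exact_forms br 3 = ce_d br ` alt_forms 2" "exact_forms br 4 = ce_d br ` alt_forms 3"
    by (simp_all add: exact_forms_def numeral_eq_Suc)
  show c4: "dim (closed_forms br 4) + dim (ce_d br ` alt_forms 2) = 35"
    using closed_plus_rank[of br 4] r ch assms(1) by simp
  show c3: "dim (closed_forms br 3) + dim (ce_d br ` alt_forms 3) = 35"
    using closed_plus_rank[of br 3] ch assms(1) by simp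
  show "betti br 3 = betti br 4" using c3 c4 ex by (simp add: betti_def)
  then show "betti br 3 = dim (closed_forms br 4) - dim (ce_d br ` alt_forms 3)"
    using ex by (simp add: betti_def)
qed

section \<open>Automorphisms and derivations\<close>

definition derivations :: "('a::real_vector \<Rightarrow> 'a \<Rightarrow> 'a) \<Rightarrow> ('a \<Rightarrow> 'a) set" where
  "derivations br = {D. linear D \<and> (\<forall>x y. D (br x y) = br (D x) y + br x (D y))}"

section \<open>The exponential of an endomorphism as a one-parameter group\<close>

lemma linear_funpow: "linear D \<Longrightarrow> linear (D ^^ k)" for D :: "'a::real_vector \<Rightarrow> 'a"
  by (induction k) (auto intro: linear_compose linear_id simp del: id_apply)

lemma funpow_scaleR:
  fixes D :: "'a::real_vector \<Rightarrow> 'a"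
  assumes "linear D"
  shows "((t *\<^sub>R D) ^^ k) x = t ^ k *\<^sub>R (D ^^ k) x"
  by (induction k) (auto simp: linear_scale[OF assms])

lemma linear_funpow_bound:
  fixes D :: "'a::euclidean_space \<Rightarrow> 'a"
  assumes "linear D"
  obtains K where "K > 0" "\<And>k x. norm ((D ^^ k) x) \<le> K ^ k * norm x"
proof -
  obtain K where K: "K > 0" "\<And>x. norm (D x) \<le> K * norm x"
    using linear_bounded_pos[OF assms] by auto
  have "norm ((D ^^ k) x) \<le> K ^ k * norm x" for k x
  proof (induction k)
    case (Suc k)
    have "norm ((D ^^ Suc k) x) \<le> K * norm ((D ^^ k) x)" using K(2) by simp
    also have "\<dots> \<le> K * (K ^ k * norm x)" using Suc K(1) by (intro mult_left_mono) auto
    finally show ?case by (simp add: mult.assoc)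
  qed simp
  with K(1) that show ?thesis by auto
qed

lemma summable_exp_coeff:
  fixes D :: "'a::euclidean_space \<Rightarrow> 'a"
  assumes "linear D"
  shows "summable (\<lambda>k. ((D ^^ k) x \<bullet> b) / fact k * t ^ k)"
proof -
  obtain K where K: "K > 0" "\<And>k x. norm ((D ^^ k) x) \<le> K ^ k * norm x"
    using linear_funpow_bound[OF assms] by metis
  have "summable (\<lambda>k. norm x * norm b * (inverse (fact k) * (K * \<bar>t\<bar>) ^ k))"
    by (intro summable_mult summable_exp)
  then show ?thesis
  proof (rule summable_comparison_test'[where N=0])
    fix k :: nat
    have "\<bar>(D ^^ k) x \<bullet> b\<bar> \<le> (K ^ k * norm x) * norm b"
      using Cauchy_Schwarz_ineq2[of "(D ^^ k) x" b] K(2)[of k x]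
      by (meson mult_right_mono norm_ge_zero order_trans)
    then have "\<bar>(D ^^ k) x \<bullet> b\<bar> / fact k * \<bar>t\<bar> ^ k \<le> (K ^ k * norm x) * norm b / fact k * \<bar>t\<bar> ^ k"
      by (intro mult_right_mono divide_right_mono) auto
    then show "norm (((D ^^ k) x \<bullet> b) / fact k * t ^ k) \<le> norm x * norm b * (inverse (fact k) * (K * \<bar>t\<bar>) ^ k)"
      by (simp add: abs_mult power_abs power_mult_distrib field_simps)
  qed
qed

lemma exp_end_inner:
  fixes D :: "'a::euclidean_space \<Rightarrow> 'a"
  assumes "linear D" "b \<in> Basis"
  shows "exp_end (t *\<^sub>R D) x \<bullet> b = (\<Sum>k. ((D ^^ k) x \<bullet> b) / fact k * t ^ k)"
proof -
  let ?f = "\<lambda>k. ((t *\<^sub>R D) ^^ k) x /\<^sub>R fact k"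
  have s: "summable (\<lambda>k. ?f k \<bullet> b)" for b
    using summable_exp_coeff[OF assms(1), of x b t]
    by (simp add: funpow_scaleR[OF assms(1)] field_simps)
  have "?f = (\<lambda>k. \<Sum>b\<in>Basis. (?f k \<bullet> b) *\<^sub>R b)" by (simp only: euclidean_representation)
  moreover have "summable (\<lambda>k. \<Sum>b\<in>Basis. (?f k \<bullet> b) *\<^sub>R b)"
    by (intro summable_sum summable_scaleR_left s)
  ultimately have "summable ?f" by simp
  then have "suminf ?f \<bullet> b = (\<Sum>k. ?f k \<bullet> b)"
    by (rule bounded_linear.suminf[OF bounded_linear_inner_left])
  then show ?thesis
    by (simp add: exp_end_def funpow_scaleR[OF assms(1)] field_simps)
qed

lemma exp_end_has_vector_derivative:
  fixes D :: "'a::euclidean_space \<Rightarrow> 'a"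
  assumes "linear D"
  shows "((\<lambda>t. exp_end (t *\<^sub>R D) x) has_vector_derivative exp_end (t *\<^sub>R D) (D x)) (at t)"
proof -
  have "((\<lambda>t. exp_end (t *\<^sub>R D) x \<bullet> b) has_real_derivative exp_end (t *\<^sub>R D) (D x) \<bullet> b) (at t)"
    if b: "b \<in> Basis" for b
  proof -
    let ?c = "\<lambda>k. ((D ^^ k) x \<bullet> b) / fact k"
    have "((\<lambda>t. \<Sum>k. ?c k * t ^ k) has_real_derivative (\<Sum>k. diffs ?c k * t ^ k)) (at t)"
      by (rule termdiffs_strong_converges_everywhere) (rule summable_exp_coeff[OF assms])
    moreover have "diffs ?c k = ((D ^^ k) (D x) \<bullet> b) / fact k" for k
      by (simp add: diffs_def funpow_swap1 field_simps del: of_nat_Suc)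
    ultimately show ?thesis by (simp add: exp_end_inner[OF assms b])
  qed
  then show ?thesis
    unfolding has_vector_derivative_def
    by (subst has_derivative_componentwise_within)
      (auto simp: has_field_derivative_def mult.commute[of _ "exp_end (t *\<^sub>R D) (D x) \<bullet> _"])
qed

lemma exp_end_0 [simp]:
  fixes D :: "'a::euclidean_space \<Rightarrow> 'a"
  assumes "linear D"
  shows "exp_end (0 *\<^sub>R D) x = x"
proof (rule euclidean_eqI)
  fix b :: 'a assume b: "b \<in> Basis"
  have "exp_end (0 *\<^sub>R D) x \<bullet> b = (\<Sum>k. ((D ^^ k) x \<bullet> b) / fact k * 0 ^ k)"
    by (rule exp_end_inner[OF assms b])
  also have "\<dots> = x \<bullet> b" by (subst suminf_finite[of "{0}"]) auto
  finally show "exp_end (0 *\<^sub>R D) x \<bullet> b = x \<bullet> b" .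
qed

lemma linear_exp_end:
  fixes D :: "'a::euclidean_space \<Rightarrow> 'a"
  assumes "linear D"
  shows "linear (exp_end (t *\<^sub>R D))"
proof (rule linearI)
  note lin = linear_funpow[OF assms]
  show "exp_end (t *\<^sub>R D) (x + y) = exp_end (t *\<^sub>R D) x + exp_end (t *\<^sub>R D) y" for x y
  proof (rule euclidean_eqI)
    fix b :: 'a assume b: "b \<in> Basis"
    have "exp_end (t *\<^sub>R D) (x + y) \<bullet> b =
        (\<Sum>k. ((D ^^ k) x \<bullet> b) / fact k * t ^ k + ((D ^^ k) y \<bullet> b) / fact k * t ^ k)"
      unfolding exp_end_inner[OF assms b]
      by (intro suminf_cong) (simp add: linear_add[OF lin] inner_add_left add_divide_distrib distrib_right)
    also have "\<dots> = exp_end (t *\<^sub>R D) x \<bullet> b + exp_end (t *\<^sub>R D) y \<bullet> b"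
      unfolding exp_end_inner[OF assms b] by (rule suminf_add[symmetric]; rule summable_exp_coeff[OF assms])
    finally show "exp_end (t *\<^sub>R D) (x + y) \<bullet> b = (exp_end (t *\<^sub>R D) x + exp_end (t *\<^sub>R D) y) \<bullet> b"
      by (simp add: inner_add_left)
  qed
  show "exp_end (t *\<^sub>R D) (c *\<^sub>R x) = c *\<^sub>R exp_end (t *\<^sub>R D) x" for c x
  proof (rule euclidean_eqI)
    fix b :: 'a assume b: "b \<in> Basis"
    have "exp_end (t *\<^sub>R D) (c *\<^sub>R x) \<bullet> b = (\<Sum>k. c * (((D ^^ k) x \<bullet> b) / fact k * t ^ k))"
      unfolding exp_end_inner[OF assms b] by (intro suminf_cong) (simp add: linear_scale[OF lin])
    also have "\<dots> = c * (exp_end (t *\<^sub>R D) x \<bullet> b)"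
      unfolding exp_end_inner[OF assms b] by (rule suminf_mult[OF summable_exp_coeff[OF assms]])
    finally show "exp_end (t *\<^sub>R D) (c *\<^sub>R x) \<bullet> b = (c *\<^sub>R exp_end (t *\<^sub>R D) x) \<bullet> b"
      by simp
  qed
qed

lemma exp_end_commute:
  fixes D :: "'a::euclidean_space \<Rightarrow> 'a"
  assumes "linear D"
  shows "exp_end (t *\<^sub>R D) (D x) = D (exp_end (t *\<^sub>R D) x)"
proof -
  let ?f = "\<lambda>x t. exp_end (t *\<^sub>R D) x"
  have D2: "D (exp_end (t *\<^sub>R D) x) \<bullet> b = (\<Sum>k. ((D ^^ k) (D x) \<bullet> b) / fact k * t ^ k)" if "b \<in> Basis" for b
  proof -
    \<comment> \<open>The adjoint moves \<open>D\<close> to the test vector, so that the coordinate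
      series of the exponential can be used term by term.\<close>
    have *: "D y \<bullet> b = y \<bullet> adjoint D b" for y by (simp add: adjoint_works[OF assms])
    have "D (exp_end (t *\<^sub>R D) x) \<bullet> b = (\<Sum>c\<in>Basis. (exp_end (t *\<^sub>R D) x \<bullet> c) * (adjoint D b \<bullet> c))"
      unfolding * by (rule euclidean_inner)
    also have "\<dots> = (\<Sum>c\<in>Basis. (\<Sum>k. ((D ^^ k) x \<bullet> c) / fact k * t ^ k * (adjoint D b \<bullet> c)))"
    proof (intro sum.cong refl)
      fix c :: 'a assume c: "c \<in> Basis"
      show "exp_end (t *\<^sub>R D) x \<bullet> c * (adjoint D b \<bullet> c) =
          (\<Sum>k. ((D ^^ k) x \<bullet> c) / fact k * t ^ k * (adjoint D b \<bullet> c))"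
        unfolding exp_end_inner[OF assms c] by (rule suminf_mult2[OF summable_exp_coeff[OF assms]])
    qed
    also have "\<dots> = (\<Sum>k. \<Sum>c\<in>Basis. ((D ^^ k) x \<bullet> c) / fact k * t ^ k * (adjoint D b \<bullet> c))"
      by (rule suminf_sum[symmetric]) (intro summable_mult2 summable_exp_coeff assms)
    also have "\<dots> = (\<Sum>k. ((D ^^ k) x \<bullet> adjoint D b) / fact k * t ^ k)"
      unfolding euclidean_inner[of "(D ^^ _) x" "adjoint D b"]
      by (intro suminf_cong) (simp add: sum_distrib_right sum_distrib_left sum_divide_distrib mult_ac)
    finally show ?thesis by (simp add: *[symmetric] funpow_swap1)
  qed
  show ?thesis by (rule euclidean_eqI) (simp add: D2 exp_end_inner[OF assms])
qed

text \<open>The product rule for a moving argument: the exponential is linear in its argument, so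
  the curve is expanded in the standard basis with real coefficient functions.\<close>

lemma exp_end_moving:
  fixes D :: "'a::euclidean_space \<Rightarrow> 'a"
  assumes "linear D" "(y has_vector_derivative y') (at t)"
  shows "((\<lambda>t. exp_end (t *\<^sub>R D) (y t)) has_vector_derivative
    exp_end (t *\<^sub>R D) y' + exp_end (t *\<^sub>R D) (D (y t))) (at t)"
proof -
  have ex: "exp_end (s *\<^sub>R D) z = (\<Sum>b\<in>Basis. (z \<bullet> b) *\<^sub>R exp_end (s *\<^sub>R D) b)" for s z
  proof -
    have "exp_end (s *\<^sub>R D) z = exp_end (s *\<^sub>R D) (\<Sum>b\<in>Basis. (z \<bullet> b) *\<^sub>R b)"
      by (simp only: euclidean_representation)
    then show ?thesis
      by (simp only: linear_sum[OF linear_exp_end[OF assms(1)]] linear_scale[OF linear_exp_end[OF assms(1)]])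
  qed
  have ex2: "exp_end (s *\<^sub>R D) (D z) = (\<Sum>b\<in>Basis. (z \<bullet> b) *\<^sub>R exp_end (s *\<^sub>R D) (D b))" for s z
  proof -
    have "exp_end (s *\<^sub>R D) (D z) = exp_end (s *\<^sub>R D) (D (\<Sum>b\<in>Basis. (z \<bullet> b) *\<^sub>R b))"
      by (simp only: euclidean_representation)
    then show ?thesis
      by (simp only: linear_sum[OF linear_exp_end[OF assms(1)]] linear_scale[OF linear_exp_end[OF assms(1)]]
        linear_sum[OF assms(1)] linear_scale[OF assms(1)])
  qed
  have "((\<lambda>t. y t \<bullet> b) has_real_derivative y' \<bullet> b) (at t)" for b
    using bounded_linear.has_vector_derivative[OF bounded_linear_inner_left assms(2), of b]
    by (simp add: has_real_derivative_iff_has_vector_derivative)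
  then have "((\<lambda>t. \<Sum>b\<in>Basis. (y t \<bullet> b) *\<^sub>R exp_end (t *\<^sub>R D) b) has_vector_derivative
      (\<Sum>b\<in>Basis. (y t \<bullet> b) *\<^sub>R exp_end (t *\<^sub>R D) (D b) + (y' \<bullet> b) *\<^sub>R exp_end (t *\<^sub>R D) b)) (at t)"
    by (intro has_vector_derivative_sum has_vector_derivative_scaleR exp_end_has_vector_derivative assms(1)) auto
  then show ?thesis
    unfolding ex2[of t "y t"] ex[of _ "y _"] ex[of _ y'] by (simp add: sum.distrib add.commute)
qed

lemma constant_of_derivative_zero:
  fixes f :: "real \<Rightarrow> 'a::real_normed_vector"
  assumes "\<And>t. (f has_vector_derivative 0) (at t)"
  shows "f t = f 0"
  using has_vector_derivative_zero_constant[of UNIV f] assms by (metis UNIV_I convex_UNIV)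

lemma linear_uminus_fun: "linear D \<Longrightarrow> linear (- D)" for D :: "'a::real_vector \<Rightarrow> 'a"
  unfolding fun_Compl_def by (rule linear_compose_neg)

lemma exp_end_inverse:
  fixes D :: "'a::euclidean_space \<Rightarrow> 'a"
  assumes "linear D"
  shows "exp_end (t *\<^sub>R D) (exp_end (t *\<^sub>R (- D)) x) = x"
proof -
  note D' = linear_uminus_fun[OF assms]
  have "((\<lambda>t. exp_end (t *\<^sub>R D) (exp_end (t *\<^sub>R (- D)) x)) has_vector_derivative 0) (at t)" for t
  proof -
    have "exp_end (t *\<^sub>R D) (exp_end (t *\<^sub>R - D) ((- D) x)) +
        exp_end (t *\<^sub>R D) (D (exp_end (t *\<^sub>R - D) x)) = 0"
      unfolding exp_end_commute[OF D'] by (simp add: linear_neg[OF linear_exp_end[OF assms]] del: scaleR_minus_right)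
    then show ?thesis
      using exp_end_moving[OF assms exp_end_has_vector_derivative[OF D', of x t]] by metis
  qed
  from constant_of_derivative_zero[OF this, of t] show ?thesis
    unfolding exp_end_0[OF assms] exp_end_0[OF D'] .
qed

text \<open>For a derivation \<open>D\<close> the curve
  \<open>exp (- t D) [exp (t D) x, exp (t D) y]\<close> has derivative zero, so it keeps its value
  \<open>[x, y]\<close> at 0.\<close>

lemma exp_end_in_lie_aut:
  fixes br :: "'a::euclidean_space \<Rightarrow> 'a \<Rightarrow> 'a"
  assumes br: "bilinear br" and D: "D \<in> derivations br"
  shows "exp_end (t *\<^sub>R D) \<in> lie_aut br"
proof -
  have lin: "linear D" and der: "\<And>x y. D (br x y) = br (D x) y + br x (D y)"
    using D by (auto simp: derivations_def)
  note D' = linear_uminus_fun[OF lin]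
  have inv2: "exp_end (t *\<^sub>R (- D)) (exp_end (t *\<^sub>R D) x) = x" for t x
    using exp_end_inverse[OF D', of t x] by (simp only: minus_minus)
  have "bij (exp_end (t *\<^sub>R D))"
    by (rule bij_betw_byWitness[where f'="exp_end (t *\<^sub>R (- D))"])
      (auto simp: inv2 exp_end_inverse[OF lin] simp del: scaleR_minus_right)
  moreover have "exp_end (t *\<^sub>R D) (br x y) = br (exp_end (t *\<^sub>R D) x) (exp_end (t *\<^sub>R D) y)" for x y
  proof -
    let ?y = "\<lambda>t. br (exp_end (t *\<^sub>R D) x) (exp_end (t *\<^sub>R D) y)"
    have "((\<lambda>t. exp_end (t *\<^sub>R (- D)) (?y t)) has_vector_derivative 0) (at t)" for t
    proof -
      have "(?y has_vector_derivative br (exp_end (t *\<^sub>R D) x) (exp_end (t *\<^sub>R D) (D y))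
          + br (exp_end (t *\<^sub>R D) (D x)) (exp_end (t *\<^sub>R D) y)) (at t)"
        by (rule bounded_bilinear.has_vector_derivative
            [OF bilinear_conv_bounded_bilinear[THEN iffD1, OF br]])
          (rule exp_end_has_vector_derivative[OF lin])+
      moreover have "br (exp_end (t *\<^sub>R D) x) (exp_end (t *\<^sub>R D) (D y))
          + br (exp_end (t *\<^sub>R D) (D x)) (exp_end (t *\<^sub>R D) y) = D (?y t)"
        unfolding exp_end_commute[OF lin] der by simp
      ultimately have "(?y has_vector_derivative D (?y t)) (at t)" by simp
      from exp_end_moving[OF D' this]
      show ?thesis
        by (simp add: linear_neg[OF linear_exp_end[OF D']] del: scaleR_minus_right)
    qed
    from constant_of_derivative_zero[OF this, of t]
    have "exp_end (t *\<^sub>R (- D)) (?y t) = br x y"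
      unfolding exp_end_0[OF lin] exp_end_0[OF D'] .
    then show ?thesis using exp_end_inverse[OF lin, of t "?y t"] by simp
  qed
  ultimately show ?thesis using linear_exp_end[OF lin] by (simp add: lie_aut_def)
qed

lemma derivation_of_exp_end:
  fixes br :: "'a::euclidean_space \<Rightarrow> 'a \<Rightarrow> 'a"
  assumes br: "bilinear br" and lin: "linear D" and aut: "\<And>t. exp_end (t *\<^sub>R D) \<in> lie_aut br"
  shows "D \<in> derivations br"
proof -
  have "D (br x y) = br x (D y) + br (D x) y" for x y
  proof -
    have "((\<lambda>t. exp_end (t *\<^sub>R D) (br x y)) has_vector_derivative exp_end (0 *\<^sub>R D) (D (br x y))) (at 0)"
      by (rule exp_end_has_vector_derivative[OF lin])
    moreover have "((\<lambda>t. br (exp_end (t *\<^sub>R D) x) (exp_end (t *\<^sub>R D) y)) has_vector_derivative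
        br (exp_end (0 *\<^sub>R D) x) (exp_end (0 *\<^sub>R D) (D y)) + br (exp_end (0 *\<^sub>R D) (D x)) (exp_end (0 *\<^sub>R D) y)) (at 0)"
      by (rule bounded_bilinear.has_vector_derivative
          [OF bilinear_conv_bounded_bilinear[THEN iffD1, OF br]])
        (rule exp_end_has_vector_derivative[OF lin])+
    moreover have "(\<lambda>t. exp_end (t *\<^sub>R D) (br x y)) = (\<lambda>t. br (exp_end (t *\<^sub>R D) x) (exp_end (t *\<^sub>R D) y))"
      using aut by (auto simp: lie_aut_def)
    ultimately show ?thesis
      unfolding exp_end_0[OF lin] by (metis vector_derivative_unique_at)
  qed
  then show ?thesis using lin by (simp add: derivations_def add.commute)
qed

lemma form_exp_end_derivative:
  fixes D :: "'a::euclidean_space \<Rightarrow> 'a"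
  assumes lin: "linear D" and "\<alpha> \<in> alt_forms k"
  shows "((\<lambda>t. \<alpha> (map (exp_end (t *\<^sub>R D)) xs)) has_real_derivative lact D \<alpha> xs) (at 0)"
  using assms(2)
proof (induction xs arbitrary: \<alpha> k)
  case Nil
  then show ?case by simp
next
  case (Cons x xs)
  let ?E = "\<lambda>t. exp_end (t *\<^sub>R D)"
  have ex: "\<beta> z = (\<Sum>b\<in>Basis. (z \<bullet> b) * \<beta> b)" if "linear \<beta>" for \<beta> :: "'a \<Rightarrow> real" and z
  proof -
    have "\<beta> z = \<beta> (\<Sum>b\<in>Basis. (z \<bullet> b) *\<^sub>R b)" by (simp only: euclidean_representation)
    then show ?thesis by (simp add: linear_sum[OF that] linear_scale[OF that])
  qed
  have "((\<lambda>t. ?E t x \<bullet> b) has_real_derivative D x \<bullet> b) (at 0)" for b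
    using bounded_linear.has_vector_derivative[OF bounded_linear_inner_left
        exp_end_has_vector_derivative[OF lin, of x 0], of b]
    unfolding exp_end_0[OF lin] by (simp add: has_real_derivative_iff_has_vector_derivative)
  then have "((\<lambda>t. \<Sum>b\<in>Basis. (?E t x \<bullet> b) * interior b \<alpha> (map (?E t) xs)) has_real_derivative
     (\<Sum>b\<in>Basis. (D x \<bullet> b) * interior b \<alpha> (map (?E 0) xs) + lact D (interior b \<alpha>) xs * (?E 0 x \<bullet> b))) (at 0)"
    by (intro DERIV_sum DERIV_mult Cons.IH[OF interior_alt[OF Cons.prems]])
  moreover have "(\<Sum>b\<in>Basis. (?E t x \<bullet> b) * interior b \<alpha> (map (?E t) xs)) = \<alpha> (map (?E t) (x # xs))" for t
    using ex[OF alt_linear_head[OF Cons.prems, of "map (?E t) xs"], of "?E t x"] by (simp add: interior_def)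
  moreover have "(\<Sum>b\<in>Basis. (D x \<bullet> b) * interior b \<alpha> (map (?E 0) xs) + lact D (interior b \<alpha>) xs * (?E 0 x \<bullet> b))
      = lact D \<alpha> (x # xs)"
  proof -
    have "linear (\<lambda>b. lact D (interior b \<alpha>) xs)"
      using linear_compose[OF linear_interior[OF Cons.prems] linear_compose[OF linear_lact linear_apply]]
      by (simp add: o_def)
    from ex[OF this, of x] ex[OF alt_linear_head[OF Cons.prems, of xs], of "D x"]
    show ?thesis
      unfolding exp_end_0[OF lin] by (simp add: interior_def[of _ \<alpha>] sum.distrib mult.commute exp_end_0[OF lin])
  qed
  ultimately show ?case by (simp only:)
qed

lemma group_dim_lie_aut:
  fixes br :: "'a::euclidean_space \<Rightarrow> 'a \<Rightarrow> 'a"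
  assumes "bilinear br"
  shows "group_dim (lie_aut br) = dim (derivations br)"
proof -
  have "{D. linear D \<and> (\<forall>t. exp_end (t *\<^sub>R D) \<in> lie_aut br)} = derivations br"
    using exp_end_in_lie_aut[OF assms] derivation_of_exp_end[OF assms]
    by (auto simp: derivations_def)
  then show ?thesis by (simp add: group_dim_def)
qed

text \<open>Differentiating the invariance of \<open>\<psi>\<close> at 0 bounds the stabilizer from
  above, which is the direction that yields lower bounds for orbits.\<close>

lemma lie_algebra_of_stabilizer:
  fixes br :: "'a::euclidean_space \<Rightarrow> 'a \<Rightarrow> 'a"
  assumes br: "bilinear br" and psi: "\<psi> \<in> alt_forms k"
  shows "{D. linear D \<and> (\<forall>t. exp_end (t *\<^sub>R D) \<in> aut_stabilizer br \<psi>)} \<subseteq> {D \<in> derivations br. lact D \<psi> = 0}"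
proof safe
  fix D assume lin: "linear D" and st: "\<forall>t. exp_end (t *\<^sub>R D) \<in> aut_stabilizer br \<psi>"
  show "D \<in> derivations br"
    using derivation_of_exp_end[OF br lin] st by (auto simp: aut_stabilizer_def)
  show "lact D \<psi> = 0"
  proof
    fix xs
    have "\<psi> (map (exp_end (t *\<^sub>R D)) xs) = \<psi> xs" for t
    proof -
      have "inj (exp_end (t *\<^sub>R D))" using st by (auto simp: aut_stabilizer_def lie_aut_def bij_def)
      then have "map (inv (exp_end (t *\<^sub>R D))) (map (exp_end (t *\<^sub>R D)) xs) = xs" by simp
      moreover have "act (exp_end (t *\<^sub>R D)) \<psi> (map (exp_end (t *\<^sub>R D)) xs) = \<psi> (map (exp_end (t *\<^sub>R D)) xs)"
        using st by (auto simp: aut_stabilizer_def)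
      ultimately show ?thesis unfolding act_def by simp
    qed
    then have "((\<lambda>t. \<psi> xs) has_real_derivative lact D \<psi> xs) (at 0)"
      using form_exp_end_derivative[OF lin psi, of xs] by simp
    then show "lact D \<psi> xs = 0 xs" using DERIV_unique[OF DERIV_const[of "\<psi> xs"]] by (metis zero_fun_app)
  qed
qed

section \<open>The $G_2$-structure of a frame\<close>

fun contract_index :: "nat \<Rightarrow> nat list \<Rightarrow> int \<times> nat list" where
  "contract_index j [] = (0, [])"
| "contract_index j (i # is) = (if i = j then (1, is)
     else (- fst (contract_index j is), i # snd (contract_index j is)))"

text \<open>The value of a monomial on basis vectors by repeated contraction; the sign 0 of
  \<open>contract_index\<close> marks an index that does not occur.\<close>

fun mon_coeff :: "nat list \<Rightarrow> nat list \<Rightarrow> int" where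
  "mon_coeff is [] = (if is = [] then 1 else 0)"
| "mon_coeff is (j # js) = (if fst (contract_index j is) = 0 then 0
     else fst (contract_index j is) * mon_coeff (snd (contract_index j is)) js)"

definition form_coeff :: "(int \<times> nat list) list \<Rightarrow> nat list \<Rightarrow> int" where
  "form_coeff L js = (\<Sum>(c, is)\<leftarrow>L. c * mon_coeff is js)"

text \<open>The test for 0 spares the evaluation of \<open>g\<close>, itself a sum over shuffles in
  \<open>phi_metric_check\<close>, wherever it cannot contribute.\<close>

definition wedge_coeff :: "(nat list \<Rightarrow> int) \<Rightarrow> (nat list \<Rightarrow> int) \<Rightarrow> nat list \<Rightarrow> int" where
  "wedge_coeff f g js = (\<Sum>(s, l, r)\<leftarrow>splits js. let a = f l in if a = 0 then 0 else s * a * g r)"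

text \<open>The model 3-form with indices shifted to start at 0.\<close>

definition phi_terms :: "(int \<times> nat list) list" where
  "phi_terms = [(1, [0,1,6]), (1, [2,3,6]), (1, [4,5,6]), (1, [0,2,4]), (-1, [1,2,5]), (-1, [0,3,5]), (-1, [1,3,4])]"

text \<open>The Hodge dual: the complements of the triples in \<open>phi_terms\<close>, in the same
  order. The signs are those confirmed by \<open>phi_hodge_check\<close>.\<close>

definition psi_terms :: "(int \<times> nat list) list" where
  "psi_terms = [(1, [2,3,4,5]), (1, [0,1,4,5]), (1, [0,1,2,3]), (-1, [1,3,5,6]), (1, [0,3,4,6]), (1, [1,2,4,6]), (1, [0,2,5,6])]"

lemma phi_hodge_check:
  "list_all (\<lambda>(s, l, r). length l = 3 \<longrightarrow> s * form_coeff psi_terms r = form_coeff phi_terms l) (splits [0,1,2,3,4,5,6])"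
  by code_simp

definition phi_interior_coeff :: "nat \<Rightarrow> nat list \<Rightarrow> int" where
  "phi_interior_coeff p l = (if length l = 2 then form_coeff phi_terms (p # l) else 0)"
text \<open>The identity \<open>6 g vol = i_p phi \<and> i_q phi \<and> phi\<close> on basis
  vectors, with the frame orthonormal and positively oriented.\<close>

lemma phi_metric_check:
  "list_all (\<lambda>p. list_all (\<lambda>q. wedge_coeff (phi_interior_coeff p)
     (wedge_coeff (phi_interior_coeff q) (form_coeff phi_terms)) [0,1,2,3,4,5,6] = (if p = q then 6 else 0))
   [0,1,2,3,4,5,6]) [0,1,2,3,4,5,6]" by code_simp

lemma contract_index_distinct:
  "distinct is \<Longrightarrow> distinct (snd (contract_index j is)) \<and> set (snd (contract_index j is)) \<subseteq> set is"
  by (induction "is") auto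

lemma splits_map: "splits (map f xs) = map (\<lambda>(s, l, r). (s, map f l, map f r)) (splits xs)"
  by (induction xs) (auto simp: case_prod_unfold)

lemma splits_subset: "(s, l, r) \<in> set (splits xs) \<Longrightarrow> set l \<subseteq> set xs \<and> set r \<subseteq> set xs"
  by (induction xs arbitrary: s l r) (auto, blast+)

section \<open>The inner product of forms, reduced to lower degree by contractions\<close>

lemma form_inner_splits:
  "form_inner es k \<alpha> \<beta> = (\<Sum>(s, l, r)\<leftarrow>splits es. if length l = k then \<alpha> l * \<beta> l else 0)"
proof -
  have len: "length (nths es A) = card A" if "A \<subseteq> {..<length es}" for A
  proof -
    have "{i. i < length es \<and> i \<in> A} = A" using that by auto
    then show ?thesis by (simp add: length_nths)
  qed
  have "{I. I \<subseteq> {..<length es} \<and> card I = k} = {I \<in> Pow {..<length es}. card I = k}" by auto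
  then have "form_inner es k \<alpha> \<beta> =
      (\<Sum>A\<in>Pow {..<length es}. if card A = k then \<alpha> (nths es A) * \<beta> (nths es A) else 0)"
    unfolding form_inner_def by (simp only: sum.inter_filter[OF finite_Pow_iff[THEN iffD2, OF finite_lessThan]])
  also have "\<dots> = (\<Sum>A\<in>Pow {..<length es}. if length (nths es A) = k then \<alpha> (nths es A) * \<beta> (nths es A) else 0)"
    by (intro sum.cong) (auto simp: len)
  also have "\<dots> = (\<Sum>(s, l, r)\<leftarrow>splits es. if length l = k then \<alpha> l * \<beta> l else 0)"
    by (simp only: sum_splits)
  finally show ?thesis .
qed

lemma form_inner_0: "form_inner es 0 \<alpha> \<beta> = \<alpha> [] * \<beta> []"
proof -
  have "{I. I \<subseteq> {..<length es} \<and> card I = 0} = {{}}" by (auto dest: finite_subset)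
  then show ?thesis by (simp add: form_inner_def)
qed

lemma form_inner_Nil_Suc: "form_inner [] (Suc k) \<alpha> \<beta> = 0"
  by (simp add: form_inner_splits)

lemma form_inner_Cons:
  "form_inner (x # es) (Suc k) \<alpha> \<beta> = form_inner es k (interior x \<alpha>) (interior x \<beta>) + form_inner es (Suc k) \<alpha> \<beta>"
  by (simp add: form_inner_splits o_def case_prod_unfold interior_def cong: if_cong)

lemma form_inner_zero: "form_inner es k 0 \<beta> = 0"
  by (simp add: form_inner_def)

lemma form_inner_minus_minus: "form_inner es k (- \<alpha>) (- \<beta>) = form_inner es k \<alpha> \<beta>"
  by (simp add: form_inner_def)

text \<open>A set of \<open>Suc k\<close> positions is counted once for each of its elements. The
  identity expresses the inner product in degree \<open>Suc k\<close> as a trace of inner products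
  in degree \<open>k\<close>, which allows changes of the orthonormal basis to be treated by
  induction on the degree.\<close>

lemma form_inner_sum_interior:
  assumes "\<alpha> \<in> alt_forms m" "\<beta> \<in> alt_forms m"
  shows "(\<Sum>x\<leftarrow>es. form_inner es k (interior x \<alpha>) (interior x \<beta>)) = real (Suc k) * form_inner es (Suc k) \<alpha> \<beta>"
  using assms
proof (induction es arbitrary: \<alpha> \<beta> k m)
  case Nil
  then show ?case by (simp add: form_inner_Nil_Suc)
next
  case (Cons f es)
  show ?case
  proof (cases k)
    case 0
    then show ?thesis using Cons.IH[OF Cons.prems, of 0]
      by (simp add: form_inner_0 form_inner_Cons)
  next
    case (Suc k')
    have first: "form_inner (f # es) k (interior f \<alpha>) (interior f \<beta>) = form_inner es k (interior f \<alpha>) (interior f \<beta>)"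
      unfolding Suc form_inner_Cons interior_interior_same[OF Cons.prems(1)] form_inner_zero by simp
    have rest: "form_inner (f # es) k (interior x \<alpha>) (interior x \<beta>) =
        form_inner es k' (interior x (interior f \<alpha>)) (interior x (interior f \<beta>))
          + form_inner es k (interior x \<alpha>) (interior x \<beta>)" for x
      unfolding Suc form_inner_Cons interior_swap[OF Cons.prems(1), of f x]
        interior_swap[OF Cons.prems(2), of f x] form_inner_minus_minus ..
    have "(\<Sum>x\<leftarrow>f # es. form_inner (f # es) k (interior x \<alpha>) (interior x \<beta>)) =
      form_inner es k (interior f \<alpha>) (interior f \<beta>) +
      (\<Sum>x\<leftarrow>es. form_inner es k' (interior x (interior f \<alpha>)) (interior x (interior f \<beta>))
          + form_inner es k (interior x \<alpha>) (interior x \<beta>))"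
      unfolding list.map sum_list.Cons first by (simp only: rest)
    also have "\<dots> = form_inner es k (interior f \<alpha>) (interior f \<beta>) +
      real (Suc k') * form_inner es (Suc k') (interior f \<alpha>) (interior f \<beta>) + real (Suc k) * form_inner es (Suc k) \<alpha> \<beta>"
      using Cons.IH[OF Cons.prems, of k]
        Cons.IH[where k=k', OF interior_alt[OF Cons.prems(1), of f] interior_alt[OF Cons.prems(2), of f]]
      by (simp add: sum_list_addf)
    also have "\<dots> = real (Suc k) * form_inner (f # es) (Suc k) \<alpha> \<beta>"
      by (simp add: form_inner_Cons Suc algebra_simps)
    finally show ?thesis .
  qed
qed

context frame
begin

lemma interior_mon:
  assumes "distinct is" "set is \<subseteq> {..<n}" "j < n"
  shows "interior (e j) (mon is) = of_int (fst (contract_index j is)) *\<^sub>R mon (snd (contract_index j is))"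
  using assms
proof (induction "is")
  case Nil
  then show ?case by simp
next
  case (Cons i "is")
  have i: "i < n" "set is \<subseteq> {..<n}" using Cons.prems by auto
  have alt: "one_form (u i) \<in> alt_forms 1" by (intro one_form_alt linear_u i)
  show ?case
  proof (cases "i = j")
    case True
    have "interior (e j) (mon is) = 0"
      by (rule interior_mon_notin[OF i(2) Cons.prems(3)]) (use Cons.prems True in auto)
    then have "interior (e j) (mon (i # is)) = mon is"
      unfolding mon.simps interior_wedge[OF alt] interior_one_form
      using u_e[OF i(1) Cons.prems(3)] True
      by (simp only: wedge_0_right scale_zero_right add_0_right wedge_scale_left wedge_unit_left scale_one if_True refl)
    then show ?thesis using True by simp
  next
    case False
    have IH: "interior (e j) (mon is) = of_int (fst (contract_index j is)) *\<^sub>R mon (snd (contract_index j is))"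
      by (rule Cons.IH) (use Cons.prems in auto)
    show ?thesis
      unfolding mon.simps interior_wedge[OF alt] interior_one_form IH wedge_scale_right
      using u_e[OF i(1) Cons.prems(3)] False
      by (intro ext) simp
  qed
qed

lemma mon_map:
  assumes "distinct is" "set is \<subseteq> {..<n}" "set js \<subseteq> {..<n}"
  shows "mon is (map e js) = of_int (mon_coeff is js)"
  using assms
proof (induction js arbitrary: "is")
  case Nil
  have "mon is [] = 0" if "is \<noteq> []" using alt_forms_length[OF mon_alt[OF Nil(2)], of "[]"] that by simp
  then show ?case by (cases "is = []") (simp_all add: unit_form_def)
next
  case (Cons j js)
  have "mon is (map e (j # js)) = interior (e j) (mon is) (map e js)" by (simp add: interior_def)
  also have "\<dots> = of_int (fst (contract_index j is)) * mon (snd (contract_index j is)) (map e js)"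
    using Cons.prems by (subst interior_mon) auto
  also have "\<dots> = of_int (mon_coeff is (j # js))"
    using Cons.IH[of "snd (contract_index j is)"] Cons.prems contract_index_distinct[OF Cons.prems(1), of j]
    by auto
  finally show ?case .
qed

definition form_of :: "(int \<times> nat list) list \<Rightarrow> 'a form" where
  "form_of L = foldr (\<lambda>(c, is) \<alpha>. of_int c *\<^sub>R mon is + \<alpha>) L 0"

lemma form_of_Nil: "form_of [] = 0"
  and form_of_Cons: "form_of ((c, is) # L) = of_int c *\<^sub>R mon is + form_of L"
  by (simp_all add: form_of_def)

lemma form_of_alt: "\<forall>(c, is)\<in>set L. set is \<subseteq> {..<n} \<and> length is = k \<Longrightarrow> form_of L \<in> alt_forms k"
proof (induction L)
  case (Cons a L)
  obtain c "is" where a: "a = (c, is)" by (cases a)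
  show ?case unfolding a form_of_Cons
    using Cons a mon_alt[of "is"] by (intro alt_forms_add alt_forms_scale) auto
qed (simp only: form_of_Nil alt_forms_0)

lemma form_of_map:
  "\<forall>(c, is)\<in>set L. set is \<subseteq> {..<n} \<and> distinct is \<Longrightarrow> set js \<subseteq> {..<n} \<Longrightarrow>
   form_of L (map e js) = of_int (form_coeff L js)"
proof (induction L)
  case (Cons a L)
  obtain c "is" where a: "a = (c, is)" by (cases a)
  show ?case unfolding a form_of_Cons
    using Cons a by (simp add: mon_map form_coeff_def)
qed (simp add: form_of_Nil form_coeff_def)

lemma wedge_map:
  assumes "\<And>l. set l \<subseteq> set js \<Longrightarrow> \<alpha> (map e l) = of_int (f l)"
    "\<And>l. set l \<subseteq> set js \<Longrightarrow> \<beta> (map e l) = of_int (g l)"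
  shows "wedge \<alpha> \<beta> (map e js) = of_int (wedge_coeff f g js)"
proof -
  have "wedge \<alpha> \<beta> (map e js) = (\<Sum>(s, l, r)\<leftarrow>splits js. of_int s * \<alpha> (map e l) * \<beta> (map e r))"
    by (simp add: wedge_splits splits_map o_def case_prod_unfold)
  also have "\<dots> = (\<Sum>(s, l, r)\<leftarrow>splits js. of_int (let a = f l in if a = 0 then 0 else s * a * g r))"
    by (intro arg_cong[where f=sum_list] map_cong)
      (auto simp: Let_def dest!: splits_subset simp: assms)
  also have "\<dots> = of_int (wedge_coeff f g js)"
    unfolding wedge_coeff_def sum_list_of_int[symmetric] by (simp add: o_def case_prod_unfold)
  finally show ?thesis .
qed

lemma wedge3_mon:
  assumes "i < n" "j < n" "k < n"
  shows "wedge3 (\<lambda>i. one_form (u (i - 1))) (Suc i) (Suc j) (Suc k) = mon [i, j, k]"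
  using wedge_unit_right[OF one_form_alt[OF linear_u[OF assms(3)]]] by (simp add: wedge3_def)

lemma e_spans: "span (e ` {..<n}) = UNIV"
proof -
  have "(\<Sum>i<n. u i x *\<^sub>R e i) \<in> span (e ` {..<n})" for x
    by (intro span_sum span_scale span_base) auto
  then have "x \<in> span (e ` {..<n})" for x
    by (rule back_subst[where P="\<lambda>y. y \<in> span (e ` {..<n})"]) (rule expand[symmetric])
  then show ?thesis by auto
qed

lemma e_independent: "inj_on e {..<n}" "independent (e ` {..<n})"
  using dual_family_independent[of "{..<n}" u e] linear_u u_e by auto

lemma dim_eq_n: "dim (UNIV :: 'a set) = n"
  using dim_eq_card[OF e_spans[THEN trans[OF _ span_UNIV[symmetric]]] e_independent(2)] e_independent(1)
  by (simp add: card_image)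

definition metric :: "'a \<Rightarrow> 'a \<Rightarrow> real" where
  "metric x y = (\<Sum>i<n. u i x * u i y)"

lemma bilinear_metric: "bilinear metric"
  unfolding bilinear_def metric_def
  by (auto intro!: linearI simp: linear_add[OF linear_u] linear_scale[OF linear_u]
     algebra_simps sum.distrib sum_distrib_left)

lemma metric_e: "i < n \<Longrightarrow> metric (e i) x = u i x" "i < n \<Longrightarrow> metric x (e i) = u i x"
proof -
  have "(\<Sum>j<n. u j (e i) * u j x) = (\<Sum>j<n. if j = i then u i x else 0)" if "i < n"
    using that by (intro sum.cong) (auto simp: u_e)
  then show "i < n \<Longrightarrow> metric (e i) x = u i x" by (simp add: metric_def)
  then show "i < n \<Longrightarrow> metric x (e i) = u i x" by (simp add: metric_def mult.commute)
qed

lemma scalar_product_metric: "scalar_product metric"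
  unfolding scalar_product_def
proof (intro conjI allI impI bilinear_metric)
  show "metric x y = metric y x" for x y by (simp add: metric_def mult.commute)
  show "0 < metric x x" if "x \<noteq> 0" for x
  proof (rule ccontr)
    assume "\<not> 0 < metric x x"
    moreover have "0 \<le> metric x x" unfolding metric_def by (rule sum_nonneg) simp
    ultimately have 0: "(\<Sum>i<n. u i x * u i x) = 0" unfolding metric_def by linarith
    have "u i x = u i 0" if "i < n" for i
      using sum_nonneg_eq_0_iff[THEN iffD1, OF _ _ 0] that linear_0[OF linear_u[OF that]] by force
    then show False using coords_eqI that by blast
  qed
qed

lemma bilinear_expand:
  assumes "bilinear B"
  shows "B x y = (\<Sum>i<n. \<Sum>j<n. u i x * (u j y * (B (e i) (e j) :: real)))"
proof -
  have l: "linear (\<lambda>x. B x y)" "linear (B x)" for x y using assms by (auto simp: bilinear_def)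
  have "B x y = (\<Sum>i<n. u i x *\<^sub>R B (e i) y)" by (rule linear_expand[OF l(1)])
  also have "\<dots> = (\<Sum>i<n. u i x *\<^sub>R (\<Sum>j<n. u j y *\<^sub>R B (e i) (e j)))"
    by (intro sum.cong refl arg_cong2[where f="(*\<^sub>R)"] linear_expand[OF l(2)])
  finally show ?thesis by (simp add: sum_distrib_left)
qed

end

lemma sum_fun_apply: "(\<Sum>i\<in>A. f i) x = (\<Sum>i\<in>A. f i x)" for f :: "'i \<Rightarrow> 'b \<Rightarrow> 'c::real_vector"
  by (rule linear_sum[OF linear_apply])

lemma sum7: "(\<Sum>i<7. f i) = f 0 + f 1 + f 2 + f 3 + f 4 + f 5 + f (6::nat)"
  by (simp add: eval_nat_numeral algebra_simps)

lemmas form_coeff_eval = form_coeff_def psi_terms_def phi_terms_def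

locale frame7 = frame 7 e u for e :: "nat \<Rightarrow> 'a::euclidean_space" and u :: "nat \<Rightarrow> 'a \<Rightarrow> real"
begin

lemma DIM7: "DIM('a) = 7"
  using dim_eq_n by (simp only: dim_UNIV)

definition phi :: "'a form" where "phi = form_of phi_terms"
definition psi :: "'a form" where "psi = form_of psi_terms"
definition vol :: "'a form" where "vol = mon [0..<7]"

lemma upt7: "[0..<7] = [0,1,2,3,4,5,6::nat]"
  by (simp add: upt_rec)

lemma phi_alt: "phi \<in> alt_forms 3"
  unfolding phi_def by (rule form_of_alt) (auto simp: phi_terms_def)
lemma psi_alt: "psi \<in> alt_forms 4"
  unfolding psi_def by (rule form_of_alt) (auto simp: psi_terms_def)
lemma vol_alt: "vol \<in> alt_forms 7"
  unfolding vol_def using mon_alt[of "[0..<7]"] by (simp add: atLeast0LessThan)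

lemma phi_map: "set js \<subseteq> {..<7} \<Longrightarrow> phi (map e js) = of_int (form_coeff phi_terms js)"
  unfolding phi_def by (rule form_of_map) (auto simp: phi_terms_def)
lemma psi_map: "set js \<subseteq> {..<7} \<Longrightarrow> psi (map e js) = of_int (form_coeff psi_terms js)"
  unfolding psi_def by (rule form_of_map) (auto simp: psi_terms_def)

lemma vol_E: "vol E = 1"
  unfolding vol_def E_def by (subst mon_eval) (auto simp: sorted_wrt_upt)

lemma forms7_eqI:
  assumes "\<alpha> \<in> alt_forms 7" "\<beta> \<in> alt_forms 7" "\<alpha> E = \<beta> E"
  shows "\<alpha> = \<beta>"
proof (rule forms_eq_nths[OF assms(1,2)])
  fix A :: "nat set" assume "A \<subseteq> {..<7}" "card A = 7"
  then have "A = {..<7}" by (metis card_lessThan card_subset_eq finite_lessThan)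
  then have "nths E A = E" by (simp add: nths_all)
  then show "\<alpha> (nths E A) = \<beta> (nths E A)" using assms(3) by simp
qed

lemma wedge_phi_basis:
  assumes "p < 7" "q < 7"
  shows "wedge (interior (e p) phi) (wedge (interior (e q) phi) phi) E = (if p = q then 6 else 0)"
proof -
  have ip: "interior (e p) phi (map e l) = of_int (phi_interior_coeff p l)" if "set l \<subseteq> {..<7}" "p < 7" for p l
  proof (cases "length l = 2")
    case True
    then show ?thesis using phi_map[of "p # l"] that by (simp add: interior_def phi_interior_coeff_def)
  next
    case False
    then have "phi (e p # map e l) = 0" using alt_forms_length[OF phi_alt] by simp
    then show ?thesis using False by (simp add: interior_def phi_interior_coeff_def)
  qed
  have "wedge (interior (e p) phi) (wedge (interior (e q) phi) phi) (map e [0,1,2,3,4,5,6]) =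
    of_int (wedge_coeff (phi_interior_coeff p) (wedge_coeff (phi_interior_coeff q) (form_coeff phi_terms)) [0,1,2,3,4,5,6])"
  proof (rule wedge_map)
    fix l :: "nat list" assume l: "set l \<subseteq> set [0,1,2,3,4,5,6]"
    then have l': "set l \<subseteq> {..<7}" by force
    show "interior (e p) phi (map e l) = of_int (phi_interior_coeff p l)" by (rule ip[OF l' assms(1)])
    show "wedge (interior (e q) phi) phi (map e l) = of_int (wedge_coeff (phi_interior_coeff q) (form_coeff phi_terms) l)"
      using l' assms(2) by (intro wedge_map ip phi_map) auto
  qed
  moreover have "p \<in> set [0,1,2,3,4,5,6]" "q \<in> set [0,1,2,3,4,5,6]" using assms by auto
  then have "wedge_coeff (phi_interior_coeff p) (wedge_coeff (phi_interior_coeff q) (form_coeff phi_terms)) [0,1,2,3,4,5,6]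
      = (if p = q then 6 else 0)"
    using phi_metric_check unfolding list_all_iff by blast
  ultimately show ?thesis by (simp add: E_def upt7)
qed

lemma wedge_phi: "wedge (interior x phi) (wedge (interior y phi) phi) = (6 * metric x y) *\<^sub>R vol"
proof (rule forms7_eqI)
  have a: "interior x phi \<in> alt_forms 2" for x using interior_alt[OF phi_alt] by simp
  have b: "wedge (interior y phi) phi \<in> alt_forms 5" using wedge_alt[OF a phi_alt] by simp
  show "wedge (interior x phi) (wedge (interior y phi) phi) \<in> alt_forms 7"
    using wedge_alt[OF a b] by simp
  show "(6 * metric x y) *\<^sub>R vol \<in> alt_forms 7" by (rule alt_forms_scale[OF vol_alt])
  let ?B = "\<lambda>x y. wedge (interior x phi) (wedge (interior y phi) phi) E"
  have "bilinear ?B"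
    unfolding bilinear_def
  proof (intro conjI allI)
    show "linear (\<lambda>y. ?B x y)" for x
      using linear_compose[OF linear_interior[OF phi_alt] linear_compose[OF linear_wedge_left[of phi]
        linear_compose[OF linear_wedge_right[of "interior x phi"] linear_apply[of E]]]] by (simp add: o_def)
    show "linear (\<lambda>x. ?B x y)" for y
      using linear_compose[OF linear_interior[OF phi_alt] linear_compose[OF linear_wedge_left linear_apply[of E]]]
      by (simp add: o_def)
  qed
  from bilinear_expand[OF this, of x y]
  have "?B x y = (\<Sum>i<7. \<Sum>j<7. if j = i then 6 * (u i x * u i y) else 0)"
    by (simp only:) (intro sum.cong refl, auto simp: wedge_phi_basis)
  also have "\<dots> = 6 * metric x y" by (simp add: metric_def sum_distrib_left)
  finally show "?B x y = ((6 * metric x y) *\<^sub>R vol) E" by (simp add: vol_E)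
qed

lemma wedge_psi:
  assumes "\<alpha> \<in> alt_forms 3"
  shows "wedge \<alpha> psi = form_inner E 3 \<alpha> phi *\<^sub>R vol"
proof (rule forms7_eqI)
  show "wedge \<alpha> psi \<in> alt_forms 7" using wedge_alt[OF assms psi_alt] by simp
  show "form_inner E 3 \<alpha> phi *\<^sub>R vol \<in> alt_forms 7" by (rule alt_forms_scale[OF vol_alt])
  define L where "L = [0,1,2,3,4,5,6::nat]"
  have E: "E = map e L" by (simp add: E_def upt7 L_def)
  have L: "set L \<subseteq> {..<7}" by (simp add: L_def)
  have "of_int s * \<alpha> (map e l) * psi (map e r) = (if length (map e l) = 3 then \<alpha> (map e l) * phi (map e l) else 0)"
    if slr: "(s, l, r) \<in> set (splits L)" for s l r
  proof (cases "length l = 3")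
    case True
    have sub: "set l \<subseteq> {..<7}" "set r \<subseteq> {..<7}" using splits_subset[OF slr] L by blast+
    have "s * form_coeff psi_terms r = form_coeff phi_terms l"
      using phi_hodge_check slr True unfolding list_all_iff L_def[symmetric] by blast
    then have "of_int s * psi (map e r) = phi (map e l)"
      unfolding psi_map[OF sub(2)] phi_map[OF sub(1)] by (simp only: of_int_mult[symmetric])
    then show ?thesis using True by (simp add: mult_ac)
  next
    case False
    then show ?thesis using alt_forms_length[OF assms, of "map e l"] by simp
  qed
  then have "wedge \<alpha> psi E = form_inner E 3 \<alpha> phi"
    unfolding wedge_splits form_inner_splits E splits_map
    by (intro arg_cong[where f=sum_list]) auto
  then show "wedge \<alpha> psi E = (form_inner E 3 \<alpha> phi *\<^sub>R vol) E" by (simp add: vol_E)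
qed

lemma orthonormal_frame_E: "orthonormal_frame metric E"
  unfolding orthonormal_frame_def using DIM7 by (auto simp: E_def metric_e u_e)

text \<open>\<open>G2_structure\<close> numbers the coframe from 1, frames are numbered from
  0.\<close>

definition coframe_form :: "nat \<Rightarrow> 'a form" where
  "coframe_form i = one_form (u (i - 1))"

lemma phi_wedge3:
  "phi = wedge3 coframe_form 1 2 7 + wedge3 coframe_form 3 4 7 + wedge3 coframe_form 5 6 7
    + wedge3 coframe_form 1 3 5 - wedge3 coframe_form 2 3 6 - wedge3 coframe_form 1 4 6 - wedge3 coframe_form 2 4 5"
proof -
  have w: "wedge3 coframe_form i j k = mon [i - 1, j - 1, k - 1]"
    if "0 < i" "i \<le> 7" "0 < j" "j \<le> 7" "0 < k" "k \<le> 7" for i j k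
  proof -
    have cf: "coframe_form = (\<lambda>i. one_form (u (i - 1)))" by (auto simp: coframe_form_def)
    have "i = Suc (i - 1)" "j = Suc (j - 1)" "k = Suc (k - 1)" "i - 1 < 7" "j - 1 < 7" "k - 1 < 7"
      using that by auto
    then show ?thesis unfolding cf using wedge3_mon[of "i - 1" "j - 1" "k - 1"] by metis
  qed
  show ?thesis by (simp add: w phi_def phi_terms_def form_of_Nil form_of_Cons)
qed

lemma coframe_coframe_form: "coframe coframe_form"
proof -
  have img: "coframe_form ` {1..7} = (\<lambda>i. one_form (u i)) ` {..<7}"
  proof -
    have "{1..7} = Suc ` {..<7}" by (rule image_Suc_lessThan[symmetric])
    then show ?thesis by (simp only: image_image) (simp add: coframe_form_def)
  qed
  have ind: "inj_on (\<lambda>i. one_form (u i)) {..<7}" "independent ((\<lambda>i. one_form (u i)) ` {..<7})"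
    using dual_family_independent[of "{..<7}" "\<lambda>i \<alpha>. \<alpha> [e i]" "\<lambda>i. one_form (u i)"]
    by (auto simp: linear_apply u_e)
  have "inj_on coframe_form {1..7}"
  proof (rule inj_onI)
    fix i j :: nat assume ij: "i \<in> {1..7}" "j \<in> {1..7}" "coframe_form i = coframe_form j"
    have "i - 1 = j - 1"
    proof (rule inj_onD[OF ind(1)])
      show "one_form (u (i - 1)) = one_form (u (j - 1))" using ij(3) unfolding coframe_form_def .
    qed (use ij in auto)
    then show "i = j" using ij by auto
  qed
  moreover have "span ((\<lambda>i. one_form (u i)) ` {..<7}) = alt_forms 1"
  proof
    show "span ((\<lambda>i. one_form (u i)) ` {..<7}) \<subseteq> alt_forms 1"
      using one_form_alt[OF linear_u] by (intro real_vector.span_minimal subspace_alt_forms) auto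
    show "alt_forms 1 \<subseteq> span ((\<lambda>i. one_form (u i)) ` {..<7})"
    proof
      fix \<alpha> :: "'a form" assume a: "\<alpha> \<in> alt_forms 1"
      have "\<alpha> xs = (\<Sum>i<7. \<alpha> [e i] *\<^sub>R one_form (u i)) xs" for xs
      proof (cases "length xs = 1")
        case True
        then obtain x where x: "xs = [x]" by (auto simp: length_Suc_conv)
        show ?thesis unfolding x using linear_expand[OF alt_linear_head[OF a, of "[]"], of x]
          by (simp add: sum_fun_apply mult.commute)
      next
        case False
        then have "one_form (u i) xs = 0" for i by (auto simp: one_form_def split: list.splits)
        then show ?thesis using alt_forms_length[OF a False] by (simp add: sum_fun_apply)
      qed
      then have "\<alpha> = (\<Sum>i<7. \<alpha> [e i] *\<^sub>R one_form (u i))" by blast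
      moreover have "(\<Sum>i<7. \<alpha> [e i] *\<^sub>R one_form (u i)) \<in> span ((\<lambda>i. one_form (u i)) ` {..<7})"
        by (intro real_vector.span_sum real_vector.span_scale real_vector.span_base) auto
      ultimately show "\<alpha> \<in> span ((\<lambda>i. one_form (u i)) ` {..<7})" by metis
    qed
  qed
  ultimately show ?thesis unfolding coframe_def img using ind(2) by auto
qed

text \<open>Every basis may serve as an adapted one, so a closed 4-form in \<open>Vcc\<close> is
  found by choosing a basis for which \<open>psi\<close> is closed.\<close>

lemma determines_G2_psi: "determines_G2 psi"
  unfolding determines_G2_def
proof (intro exI conjI)
  show "G2_structure phi"
    unfolding G2_structure_def using coframe_coframe_form phi_wedge3 by blast
  show "G2_metric phi metric vol"
    unfolding G2_metric_def volume_form_def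
    using scalar_product_metric vol_alt DIM7 orthonormal_frame_E vol_E wedge_phi by auto
  show "is_hodge_star metric vol 3 phi psi"
    unfolding is_hodge_star_def using psi_alt DIM7 orthonormal_frame_E wedge_psi by auto
qed

end

lemma all_less_7: "(\<forall>i<7. P i) \<longleftrightarrow> P 0 \<and> P 1 \<and> P 2 \<and> P 3 \<and> P 4 \<and> P 5 \<and> P (6::nat)"
  by (auto simp: All_less_Suc2 numeral_eq_Suc)

context frame7
begin

text \<open>The annihilator of \<open>psi\<close> in gl(7) lies in so(7). Evaluating on the 35
  increasing quadruples gives 35 linear equations for the 49 matrix entries \<open>m i j\<close>,
  and these already imply skewness.\<close>

lemma lact_psi_skew:
  assumes lin: "linear D" and 0: "lact D psi = 0"
  shows "metric (D x) y = - metric x (D y)"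
proof -
  define m where "m i j = u i (D (e j))" for i j
  define c where "c js = real_of_int (form_coeff psi_terms js)" for js
  have De: "D (e j) = (\<Sum>i<7. m i j *\<^sub>R e i)" for j unfolding m_def by (rule expand)
  have pc: "psi [e i, e j, e k, e l] = c [i, j, k, l]" if "i < 7" "j < 7" "k < 7" "l < 7" for i j k l
    using psi_map[of "[i, j, k, l]"] that by (simp add: c_def)
  have eq: "(\<Sum>i<7. m i a * c [i, b, d, f]) + (\<Sum>i<7. m i b * c [a, i, d, f])
      + (\<Sum>i<7. m i d * c [a, b, i, f]) + (\<Sum>i<7. m i f * c [a, b, d, i]) = 0"
    if i: "a < 7" "b < 7" "d < 7" "f < 7" for a b d f
  proof -
    note l0 = alt_linear_head[OF psi_alt]
    note l1 = alt_linear_head[OF interior_alt[OF psi_alt], unfolded interior_apply]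
    note l2 = alt_linear_head[OF interior_alt[OF interior_alt[OF psi_alt]], unfolded interior_apply]
    note l3 = alt_linear_head[OF interior_alt[OF interior_alt[OF interior_alt[OF psi_alt]]], unfolded interior_apply]
    have "0 = lact D psi [e a, e b, e d, e f]" using 0 by simp
    also have "\<dots> = psi [D (e a), e b, e d, e f] + psi [e a, D (e b), e d, e f]
        + psi [e a, e b, D (e d), e f] + psi [e a, e b, e d, D (e f)]" by (simp add: interior_def)
    also have "psi [D (e a), e b, e d, e f] = (\<Sum>i<7. m i a * c [i, b, d, f])"
      unfolding De linear_sum[OF l0] linear_scale[OF l0] using i by (auto simp: pc intro!: sum.cong)
    also have "psi [e a, D (e b), e d, e f] = (\<Sum>i<7. m i b * c [a, i, d, f])"
      unfolding De linear_sum[OF l1] linear_scale[OF l1] using i by (auto simp: pc intro!: sum.cong)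
    also have "psi [e a, e b, D (e d), e f] = (\<Sum>i<7. m i d * c [a, b, i, f])"
      unfolding De linear_sum[OF l2] linear_scale[OF l2] using i by (auto simp: pc intro!: sum.cong)
    also have "psi [e a, e b, e d, D (e f)] = (\<Sum>i<7. m i f * c [a, b, d, i])"
      unfolding De linear_sum[OF l3] linear_scale[OF l3] using i by (auto simp: pc intro!: sum.cong)
    finally show ?thesis by simp
  qed
  \<comment> \<open>The names record the quadruple on which the equation is read off.\<close>
  have E0123: "m 0 0 + m 1 1 + m 2 2 + m 3 3 = 0" using eq[of 0 1 2 3] by (simp add: sum7 c_def form_coeff_eval)
  have E0124: "m 3 4 + (-1) * m 5 2 + (-1) * m 6 0 = 0" using eq[of 0 1 2 4] by (simp add: sum7 c_def form_coeff_eval)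
  have E0125: "m 3 5 + m 4 2 + m 6 1 = 0" using eq[of 0 1 2 5] by (simp add: sum7 c_def form_coeff_eval)
  have E0126: "m 3 6 + m 4 0 + (-1) * m 5 1 = 0" using eq[of 0 1 2 6] by (simp add: sum7 c_def form_coeff_eval)
  have E0134: "(-1) * m 2 4 + (-1) * m 5 3 + m 6 1 = 0" using eq[of 0 1 3 4] by (simp add: sum7 c_def form_coeff_eval)
  have E0135: "(-1) * m 2 5 + m 4 3 + m 6 0 = 0" using eq[of 0 1 3 5] by (simp add: sum7 c_def form_coeff_eval)
  have E0136: "(-1) * m 2 6 + (-1) * m 4 1 + (-1) * m 5 0 = 0" using eq[of 0 1 3 6] by (simp add: sum7 c_def form_coeff_eval)
  have E0145: "m 0 0 + m 1 1 + m 4 4 + m 5 5 = 0" using eq[of 0 1 4 5] by (simp add: sum7 c_def form_coeff_eval)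
  have E0146: "(-1) * m 2 0 + m 3 1 + m 5 6 = 0" using eq[of 0 1 4 6] by (simp add: sum7 c_def form_coeff_eval)
  have E0156: "m 2 1 + m 3 0 + (-1) * m 4 6 = 0" using eq[of 0 1 5 6] by (simp add: sum7 c_def form_coeff_eval)
  have E0234: "m 1 4 + (-1) * m 5 0 + m 6 2 = 0" using eq[of 0 2 3 4] by (simp add: sum7 c_def form_coeff_eval)
  have E0235: "m 1 5 + m 4 0 + (-1) * m 6 3 = 0" using eq[of 0 2 3 5] by (simp add: sum7 c_def form_coeff_eval)
  have E0236: "m 1 6 + (-1) * m 4 2 + m 5 3 = 0" using eq[of 0 2 3 6] by (simp add: sum7 c_def form_coeff_eval)
  have E0245: "m 1 2 + (-1) * m 3 0 + (-1) * m 6 4 = 0" using eq[of 0 2 4 5] by (simp add: sum7 c_def form_coeff_eval)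
  have E0246: "m 1 0 + m 3 2 + m 5 4 = 0" using eq[of 0 2 4 6] by (simp add: sum7 c_def form_coeff_eval)
  have E0256: "m 0 0 + m 2 2 + m 5 5 + m 6 6 = 0" using eq[of 0 2 5 6] by (simp add: sum7 c_def form_coeff_eval)
  have E0345: "m 1 3 + m 2 0 + m 6 5 = 0" using eq[of 0 3 4 5] by (simp add: sum7 c_def form_coeff_eval)
  have E0346: "m 0 0 + m 3 3 + m 4 4 + m 6 6 = 0" using eq[of 0 3 4 6] by (simp add: sum7 c_def form_coeff_eval)
  have E0356: "(-1) * m 1 0 + m 2 3 + m 4 5 = 0" using eq[of 0 3 5 6] by (simp add: sum7 c_def form_coeff_eval)
  have E0456: "m 1 6 + m 2 4 + (-1) * m 3 5 = 0" using eq[of 0 4 5 6] by (simp add: sum7 c_def form_coeff_eval)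
  have E1234: "(-1) * m 0 4 + (-1) * m 5 1 + (-1) * m 6 3 = 0" using eq[of 1 2 3 4] by (simp add: sum7 c_def form_coeff_eval)
  have E1235: "(-1) * m 0 5 + m 4 1 + (-1) * m 6 2 = 0" using eq[of 1 2 3 5] by (simp add: sum7 c_def form_coeff_eval)
  have E1236: "(-1) * m 0 6 + m 4 3 + m 5 2 = 0" using eq[of 1 2 3 6] by (simp add: sum7 c_def form_coeff_eval)
  have E1245: "(-1) * m 0 2 + (-1) * m 3 1 + m 6 5 = 0" using eq[of 1 2 4 5] by (simp add: sum7 c_def form_coeff_eval)
  have E1246: "m 1 1 + m 2 2 + m 4 4 + m 6 6 = 0" using eq[of 1 2 4 6] by (simp add: sum7 c_def form_coeff_eval)
  have E1256: "m 0 1 + (-1) * m 3 2 + m 4 5 = 0" using eq[of 1 2 5 6] by (simp add: sum7 c_def form_coeff_eval)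
  have E1345: "(-1) * m 0 3 + m 2 1 + m 6 4 = 0" using eq[of 1 3 4 5] by (simp add: sum7 c_def form_coeff_eval)
  have E1346: "m 0 1 + m 2 3 + (-1) * m 5 4 = 0" using eq[of 1 3 4 6] by (simp add: sum7 c_def form_coeff_eval)
  have E1356: "(-1) * m 1 1 + (-1) * m 3 3 + (-1) * m 5 5 + (-1) * m 6 6 = 0" using eq[of 1 3 5 6] by (simp add: sum7 c_def form_coeff_eval)
  have E1456: "(-1) * m 0 6 + (-1) * m 2 5 + (-1) * m 3 4 = 0" using eq[of 1 4 5 6] by (simp add: sum7 c_def form_coeff_eval)
  have E2345: "m 2 2 + m 3 3 + m 4 4 + m 5 5 = 0" using eq[of 2 3 4 5] by (simp add: sum7 c_def form_coeff_eval)
  have E2346: "m 0 2 + (-1) * m 1 3 + m 5 6 = 0" using eq[of 2 3 4 6] by (simp add: sum7 c_def form_coeff_eval)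
  have E2356: "(-1) * m 0 3 + (-1) * m 1 2 + (-1) * m 4 6 = 0" using eq[of 2 3 5 6] by (simp add: sum7 c_def form_coeff_eval)
  have E2456: "(-1) * m 0 4 + m 1 5 + m 3 6 = 0" using eq[of 2 4 5 6] by (simp add: sum7 c_def form_coeff_eval)
  have E3456: "m 0 5 + m 1 4 + (-1) * m 2 6 = 0" using eq[of 3 4 5 6] by (simp add: sum7 c_def form_coeff_eval)
  \<comment> \<open>The seven quadruples occurring in \<open>psi\<close> each give a vanishing sum
    of four diagonal entries; this system is invertible, so the diagonal is zero.\<close>
  have S00: "m 0 0 = - m 0 0" using E0123 E0145 E0256 E0346 E1246 E1356 E2345 by linarith
  \<comment> \<open>Off the diagonal the equations come in groups of four. A group involves the
    three pairs that a common index completes to a term of \<open>phi\<close>, here 01, 23 and 45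
    with index 6. Suitable sums show that the symmetric parts of any two of the three pairs cancel
    up to sign, so all three are zero.\<close>
  have S01: "m 0 1 = - m 1 0" using E0246 E0356 E1256 E1346 by linarith
  have S02: "m 0 2 = - m 2 0" using E0146 E0345 E1245 E2346 by linarith
  have S03: "m 0 3 = - m 3 0" using E0156 E0245 E1345 E2356 by linarith
  have S04: "m 0 4 = - m 4 0" using E0126 E0235 E1234 E2456 by linarith
  have S05: "m 0 5 = - m 5 0" using E0136 E0234 E1235 E3456 by linarith
  have S06: "m 0 6 = - m 6 0" using E0124 E0135 E1236 E1456 by linarith
  have S11: "m 1 1 = - m 1 1" using E0123 E0145 E0256 E0346 E1246 E1356 E2345 by linarith
  have S12: "m 1 2 = - m 2 1" using E0156 E0245 E1345 E2356 by linarith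
  have S13: "m 1 3 = - m 3 1" using E0146 E0345 E1245 E2346 by linarith
  have S14: "m 1 4 = - m 4 1" using E0136 E0234 E1235 E3456 by linarith
  have S15: "m 1 5 = - m 5 1" using E0126 E0235 E1234 E2456 by linarith
  have S16: "m 1 6 = - m 6 1" using E0125 E0134 E0236 E0456 by linarith
  have S22: "m 2 2 = - m 2 2" using E0123 E0145 E0256 E0346 E1246 E1356 E2345 by linarith
  have S23: "m 2 3 = - m 3 2" using E0246 E0356 E1256 E1346 by linarith
  have S24: "m 2 4 = - m 4 2" using E0125 E0134 E0236 E0456 by linarith
  have S25: "m 2 5 = - m 5 2" using E0124 E0135 E1236 E1456 by linarith
  have S26: "m 2 6 = - m 6 2" using E0136 E0234 E1235 E3456 by linarith
  have S33: "m 3 3 = - m 3 3" using E0123 E0145 E0256 E0346 E1246 E1356 E2345 by linarith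
  have S34: "m 3 4 = - m 4 3" using E0124 E0135 E1236 E1456 by linarith
  have S35: "m 3 5 = - m 5 3" using E0125 E0134 E0236 E0456 by linarith
  have S36: "m 3 6 = - m 6 3" using E0126 E0235 E1234 E2456 by linarith
  have S44: "m 4 4 = - m 4 4" using E0123 E0145 E0256 E0346 E1246 E1356 E2345 by linarith
  have S45: "m 4 5 = - m 5 4" using E0246 E0356 E1256 E1346 by linarith
  have S46: "m 4 6 = - m 6 4" using E0156 E0245 E1345 E2356 by linarith
  have S55: "m 5 5 = - m 5 5" using E0123 E0145 E0256 E0346 E1246 E1356 E2345 by linarith
  have S56: "m 5 6 = - m 6 5" using E0146 E0345 E1245 E2346 by linarith
  have S66: "m 6 6 = - m 6 6" using E0123 E0145 E0256 E0346 E1246 E1356 E2345 by linarith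
  define sk where "sk i j \<longleftrightarrow> m i j = - m j i" for i j
  have sk_sym: "sk j i" if "sk i j" for i j using that by (simp add: sk_def)
  have T00: "sk 0 0" unfolding sk_def by (rule S00)
  have T01: "sk 0 1" unfolding sk_def by (rule S01)
  have T02: "sk 0 2" unfolding sk_def by (rule S02)
  have T03: "sk 0 3" unfolding sk_def by (rule S03)
  have T04: "sk 0 4" unfolding sk_def by (rule S04)
  have T05: "sk 0 5" unfolding sk_def by (rule S05)
  have T06: "sk 0 6" unfolding sk_def by (rule S06)
  have T11: "sk 1 1" unfolding sk_def by (rule S11)
  have T12: "sk 1 2" unfolding sk_def by (rule S12)
  have T13: "sk 1 3" unfolding sk_def by (rule S13)
  have T14: "sk 1 4" unfolding sk_def by (rule S14)
  have T15: "sk 1 5" unfolding sk_def by (rule S15)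
  have T16: "sk 1 6" unfolding sk_def by (rule S16)
  have T22: "sk 2 2" unfolding sk_def by (rule S22)
  have T23: "sk 2 3" unfolding sk_def by (rule S23)
  have T24: "sk 2 4" unfolding sk_def by (rule S24)
  have T25: "sk 2 5" unfolding sk_def by (rule S25)
  have T26: "sk 2 6" unfolding sk_def by (rule S26)
  have T33: "sk 3 3" unfolding sk_def by (rule S33)
  have T34: "sk 3 4" unfolding sk_def by (rule S34)
  have T35: "sk 3 5" unfolding sk_def by (rule S35)
  have T36: "sk 3 6" unfolding sk_def by (rule S36)
  have T44: "sk 4 4" unfolding sk_def by (rule S44)
  have T45: "sk 4 5" unfolding sk_def by (rule S45)
  have T46: "sk 4 6" unfolding sk_def by (rule S46)
  have T55: "sk 5 5" unfolding sk_def by (rule S55)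
  have T56: "sk 5 6" unfolding sk_def by (rule S56)
  have T66: "sk 6 6" unfolding sk_def by (rule S66)
  have skew: "m i j = - m j i" if "i < 7" "j < 7" for i j
  proof -
    have "\<forall>i<7. \<forall>j<7. sk i j"
      unfolding all_less_7 by (simp only: T00 T01 sk_sym[OF T01] T02 sk_sym[OF T02] T03 sk_sym[OF T03] T04 sk_sym[OF T04] T05 sk_sym[OF T05] T06 sk_sym[OF T06] T11 T12 sk_sym[OF T12] T13 sk_sym[OF T13] T14 sk_sym[OF T14] T15 sk_sym[OF T15] T16 sk_sym[OF T16] T22 T23 sk_sym[OF T23] T24 sk_sym[OF T24] T25 sk_sym[OF T25] T26 sk_sym[OF T26] T33 T34 sk_sym[OF T34] T35 sk_sym[OF T35] T36 sk_sym[OF T36] T44 T45 sk_sym[OF T45] T46 sk_sym[OF T46] T55 T56 sk_sym[OF T56] T66 simp_thms)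
    then have "sk i j" using that by blast
    then show ?thesis by (simp add: sk_def)
  qed
  have Dx: "u i (D x) = (\<Sum>j<7. u j x * m i j)" if "i < 7" for i x
    unfolding m_def using linear_expand[OF linear_compose[OF lin linear_u[OF that]], of x] by (simp add: o_def)
  have "metric (D x) y = (\<Sum>i<7. \<Sum>j<7. u j x * m i j * u i y)"
    unfolding metric_def by (intro sum.cong refl) (simp add: Dx sum_distrib_right)
  also have "\<dots> = (\<Sum>i<7. \<Sum>j<7. - (u j x * m j i * u i y))"
  proof (intro sum.cong refl)
    fix i j :: nat assume "i \<in> {..<7}" "j \<in> {..<7}"
    then have "m i j = - m j i" by (intro skew) auto
    then show "u j x * m i j * u i y = - (u j x * m j i * u i y)" by simp
  qed
  also have "\<dots> = - (\<Sum>j<7. \<Sum>i<7. u j x * m j i * u i y)"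
    by (subst sum.swap) (simp add: sum_negf)
  also have "(\<Sum>j<7. \<Sum>i<7. u j x * m j i * u i y) = metric x (D y)"
    unfolding metric_def by (intro sum.cong refl) (simp add: Dx sum_distrib_left mult_ac)
  finally show ?thesis .
qed

end

section \<open>Uniqueness of metric and Hodge star, and the frame of a given 4-form\<close>

lemma orthonormal_list_frame:
  fixes g :: "'a::euclidean_space \<Rightarrow> 'a \<Rightarrow> real"
  assumes "scalar_product g" "orthonormal_frame g es"
  shows "frame DIM('a) (\<lambda>i. es ! i) (\<lambda>i. g (es ! i))"
proof -
  let ?n = "DIM('a)"
  have g: "linear (g x)" for x using assms(1) by (simp add: scalar_product_def bilinear_def)
  have gij: "g (es ! i) (es ! j) = (if i = j then 1 else 0)" if "i < ?n" "j < ?n" for i j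
    using assms(2) that by (simp add: orthonormal_frame_def)
  have inj: "inj_on (\<lambda>i. es ! i) {..<?n}" and ind: "independent ((\<lambda>i. es ! i) ` {..<?n})"
    using dual_family_independent[of "{..<?n}" "\<lambda>i. g (es ! i)" "\<lambda>i. es ! i"] g gij by auto
  have "span ((\<lambda>i. es ! i) ` {..<?n}) = UNIV"
    using card_ge_dim_independent[of "(\<lambda>i. es ! i) ` {..<?n}" UNIV] ind card_image[OF inj] by auto
  then obtain u where "frame ?n (\<lambda>i. es ! i) u" using frame_of_basis[OF inj ind] by auto
  then interpret frame ?n "\<lambda>i. es ! i" u .
  have ui: "u i x = g (es ! i) x" if "i < ?n" for i x
  proof -
    have "g (es ! i) x = (\<Sum>j<?n. u j x *\<^sub>R g (es ! i) (es ! j))" by (rule linear_expand[OF g])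
    also have "\<dots> = (\<Sum>j<?n. if j = i then u i x else 0)" using gij that by (intro sum.cong) auto
    finally show ?thesis using that by simp
  qed
  show ?thesis
  proof (rule frame.intro)
    show "linear (g (es ! i))" for i by (rule g)
    show "g (es ! i) (es ! j) = (if i = j then 1 else 0)" if "i < ?n" "j < ?n" for i j using gij that .
    show "x = (\<Sum>i<?n. g (es ! i) x *\<^sub>R es ! i)" for x
    proof -
      have "x = (\<Sum>i<?n. u i x *\<^sub>R es ! i)" by (rule expand)
      also have "\<dots> = (\<Sum>i<?n. g (es ! i) x *\<^sub>R es ! i)" by (intro sum.cong) (auto simp: ui)
      finally show ?thesis .
    qed
  qed
qed

context frame7
begin

text \<open>The trace of a bilinear form over an orthonormal basis depends only on the metric;
  dividing the metric by \<open>c\<close> multiplies the trace by \<open>c\<close>.\<close>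

lemma trace_rescaled:
  assumes g: "scalar_product g" "orthonormal_frame g es" and c: "c \<noteq> 0" "\<And>x y. metric x y = c * g x y"
    and B: "bilinear B"
  shows "(\<Sum>x\<leftarrow>es. B x x) = c * (\<Sum>i<7. B (e i) (e i) :: real)"
proof -
  interpret o: frame "DIM('a)" "\<lambda>i. es ! i" "\<lambda>i. g (es ! i)" by (rule orthonormal_list_frame[OF g])
  have gij: "g (es ! i) (es ! j) = (if i = j then 1 else 0)" if "i < 7" "j < 7" for i j
    using g(2) that DIM7 by (simp add: orthonormal_frame_def)
  have ge: "g (es ! i) (e a) = u a (es ! i) / c" if "a < 7" for a i
    using c(2)[of "es ! i" "e a"] metric_e(2)[OF that, of "es ! i"] c(1) by (simp add: field_simps)
  have tr: "(\<Sum>a<7. g (es ! i) (e a) * g (es ! j) (e a)) = (if i = j then 1 / c else 0)" if "i < 7" "j < 7" for i j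
  proof -
    have "(\<Sum>a<7. g (es ! i) (e a) * g (es ! j) (e a)) = metric (es ! i) (es ! j) / c / c"
      by (simp add: ge metric_def sum_divide_distrib)
    also have "\<dots> = g (es ! i) (es ! j) / c" using c by simp
    finally show ?thesis using gij[OF that] by simp
  qed
  have "(\<Sum>a<7. B (e a) (e a)) = (\<Sum>a<7. \<Sum>i<7. \<Sum>j<7. g (es ! i) (e a) * (g (es ! j) (e a) * B (es ! i) (es ! j)))"
    unfolding o.bilinear_expand[OF B, of "e _" "e _"] DIM7 ..
  also have "\<dots> = (\<Sum>i<7. \<Sum>a<7. \<Sum>j<7. g (es ! i) (e a) * (g (es ! j) (e a) * B (es ! i) (es ! j)))"
    by (rule sum.swap)
  also have "\<dots> = (\<Sum>i<7. \<Sum>j<7. \<Sum>a<7. g (es ! i) (e a) * (g (es ! j) (e a) * B (es ! i) (es ! j)))"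
    by (intro sum.cong refl sum.swap)
  also have "\<dots> = (\<Sum>i<7. \<Sum>j<7. (\<Sum>a<7. g (es ! i) (e a) * g (es ! j) (e a)) * B (es ! i) (es ! j))"
    by (simp only: sum_distrib_right mult.assoc)
  also have "\<dots> = (\<Sum>i<7. \<Sum>j<7. if j = i then B (es ! i) (es ! i) / c else 0)"
    by (intro sum.cong refl) (auto simp: tr)
  also have "\<dots> = (\<Sum>i<7. B (es ! i) (es ! i)) / c" by (simp add: sum_divide_distrib)
  also have "(\<Sum>i<7. B (es ! i) (es ! i)) = (\<Sum>x\<leftarrow>es. B x x)"
    using g(2) DIM7 by (simp add: orthonormal_frame_def sum_list_sum_nth atLeast0LessThan)
  finally show ?thesis using c(1) by simp
qed

text \<open>Each degree contributes one trace, and hence one factor \<open>c\<close>.\<close>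

lemma form_inner_rescaled:
  assumes g: "scalar_product g" "orthonormal_frame g es" and c: "c \<noteq> 0" "\<And>x y. metric x y = c * g x y"
    and ab: "\<alpha> \<in> alt_forms m" "\<beta> \<in> alt_forms m"
  shows "form_inner es k \<alpha> \<beta> = c ^ k * form_inner E k \<alpha> \<beta>"
  using ab
proof (induction k arbitrary: \<alpha> \<beta> m)
  case 0
  then show ?case by (simp add: form_inner_0)
next
  case (Suc k)
  let ?B = "\<lambda>x y. form_inner E k (interior x \<alpha>) (interior y \<beta>)"
  have "bilinear ?B"
    unfolding bilinear_def form_inner_def interior_def
    by (intro conjI allI linearI)
      (simp_all add: linear_add[OF alt_linear_head[OF Suc.prems(1)]] linear_add[OF alt_linear_head[OF Suc.prems(2)]]
        linear_scale[OF alt_linear_head[OF Suc.prems(1)]] linear_scale[OF alt_linear_head[OF Suc.prems(2)]]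
        algebra_simps sum.distrib sum_distrib_left)
  note tr = trace_rescaled[OF g c this]
  have "real (Suc k) * form_inner es (Suc k) \<alpha> \<beta> = (\<Sum>x\<leftarrow>es. form_inner es k (interior x \<alpha>) (interior x \<beta>))"
    by (rule form_inner_sum_interior[OF Suc.prems, symmetric])
  also have "\<dots> = (\<Sum>x\<leftarrow>es. c ^ k * ?B x x)"
    using Suc.IH[OF interior_alt[OF Suc.prems(1)] interior_alt[OF Suc.prems(2)]] by simp
  also have "\<dots> = c ^ k * (\<Sum>x\<leftarrow>es. ?B x x)" by (simp add: sum_list_const_mult)
  also have "\<dots> = c ^ Suc k * (\<Sum>i<7. ?B (e i) (e i))" unfolding tr by simp
  also have "(\<Sum>i<7. ?B (e i) (e i)) = (\<Sum>x\<leftarrow>E. ?B x x)"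
    by (simp add: E_def sum_list_sum_nth atLeast0LessThan)
  also have "\<dots> = real (Suc k) * form_inner E (Suc k) \<alpha> \<beta>"
    by (rule form_inner_sum_interior[OF Suc.prems])
  finally show ?case by (metis mult.left_commute mult_cancel_left of_nat_eq_0_iff nat.simps(3))
qed

text \<open>Comparing the defining identities gives \<open>metric = c g\<close> and
  \<open>vol' = c vol\<close>. The inner product of 3-forms contributes \<open>c ^ 3\<close> and the
  volume form one more factor. A non-zero multiple of \<open>psi\<close> is annihilated by the same
  endomorphisms as \<open>psi\<close>.\<close>

lemma hodge_star_phi_unique:
  assumes m: "G2_metric phi g vol'" and h: "is_hodge_star g vol' 3 phi \<psi>"
  shows "\<exists>c. c \<noteq> 0 \<and> \<psi> = c *\<^sub>R psi"
proof -
  have sp: "scalar_product g" using m by (simp add: G2_metric_def)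
  have eq: "(6 * g x y) *\<^sub>R vol' = (6 * metric x y) *\<^sub>R vol" for x y
    using m unfolding G2_metric_def wedge_phi by blast
  define c where "c = 1 / g (e 0) (e 0)"
  have "e 0 \<noteq> 0" using u_e[of 0 0] linear_0[OF linear_u[of 0]] by auto
  then have g0: "0 < g (e 0) (e 0)" using sp by (simp add: scalar_product_def)
  then have c: "c \<noteq> 0" by (simp add: c_def)
  have vol': "vol' xs = c * vol xs" for xs
    using fun_cong[OF eq[of "e 0" "e 0"], of xs] metric_e(1)[of 0 "e 0"] u_e[of 0 0] g0
    by (simp add: c_def field_simps)
  have mg: "metric x y = c * g x y" for x y
    using fun_cong[OF eq[of x y], of E] vol_E by (simp add: vol' mult.commute)
  obtain es where es: "orthonormal_frame g es"
    "\<And>\<alpha>. \<alpha> \<in> alt_forms 3 \<Longrightarrow> wedge \<alpha> \<psi> = form_inner es 3 \<alpha> phi *\<^sub>R vol'"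
    and psi4: "\<psi> \<in> alt_forms 4"
    using h DIM7 by (auto simp: is_hodge_star_def)
  have "wedge \<alpha> (\<psi> - c ^ 4 *\<^sub>R psi) E = 0" if a: "\<alpha> \<in> alt_forms 3" for \<alpha>
  proof -
    have "wedge \<alpha> \<psi> E = c ^ 3 * form_inner E 3 \<alpha> phi * c"
      unfolding es(2)[OF a] form_inner_rescaled[OF sp es(1) c mg a phi_alt] by (simp add: vol' vol_E)
    moreover have "wedge \<alpha> psi E = form_inner E 3 \<alpha> phi"
      unfolding wedge_psi[OF a] by (simp add: vol_E)
    ultimately show ?thesis
      unfolding wedge_diff_right wedge_scale_right by (simp add: power4_eq_xxxx power3_eq_cube)
  qed
  then have "\<psi> - c ^ 4 *\<^sub>R psi = 0"
    by (intro wedge_nondegenerate_right[where k=3 and l=4] alt_forms_diff alt_forms_scale psi4 psi_alt) auto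
  then show ?thesis using c by (intro exI[of _ "c ^ 4"]) auto
qed

end

text \<open>The dual basis is obtained by pulling back an orthonormal basis along the coordinate map
  \<open>G\<close>, which is injective because a coframe separates points.\<close>

lemma frame_of_coframe:
  fixes \<eta> :: "nat \<Rightarrow> ('a::euclidean_space) form"
  assumes dim: "DIM('a) = 7" and co: "coframe \<eta>"
  shows "\<exists>e u. frame7 e u \<and> (\<forall>i<7. one_form (u i) = \<eta> (Suc i))"
proof -
  define w where "w i x = \<eta> (Suc i) [x]" for i x
  have alt: "\<eta> (Suc i) \<in> alt_forms 1" if "i < 7" for i
    using co that real_vector.span_base[of "\<eta> (Suc i)" "\<eta> ` {1..7}"] by (auto simp: coframe_def)
  have lin: "linear (w i)" if "i < 7" for i
    unfolding w_def using alt_linear_head[OF alt[OF that], of "[]"] by simp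
  have of: "one_form (w i) = \<eta> (Suc i)" if "i < 7" for i
  proof
    show "one_form (w i) xs = \<eta> (Suc i) xs" for xs
      using alt_forms_length[OF alt[OF that], of xs]
      by (cases xs rule: list.exhaust[case_names Nil Cons]; cases "tl xs") (auto simp: w_def)
  qed
  have sep: "x = 0" if 0: "\<And>i. i < 7 \<Longrightarrow> w i x = 0" for x
  proof -
    have "subspace {\<alpha> :: 'a form. \<alpha> [x] = 0}" by (auto simp: real_vector.subspace_def)
    moreover have "\<eta> ` {1..7} \<subseteq> {\<alpha>. \<alpha> [x] = 0}"
    proof
      fix \<alpha> assume "\<alpha> \<in> \<eta> ` {1..7}"
      then obtain i where i: "\<alpha> = \<eta> i" "1 \<le> i" "i \<le> 7" by auto
      then have "i = Suc (i - 1)" "i - 1 < 7" by auto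
      with 0[of "i - 1"] i show "\<alpha> \<in> {\<alpha>. \<alpha> [x] = 0}" by (simp add: w_def)
    qed
    ultimately have "span (\<eta> ` {1..7}) \<subseteq> {\<alpha>. \<alpha> [x] = 0}" by (rule real_vector.span_minimal[rotated])
    \<comment> \<open>The inner product with \<open>x\<close> is a 1-form, hence in the span of the
      coframe; its vanishing at \<open>x\<close> means \<open>x = 0\<close>.\<close>
    moreover have "one_form (\<lambda>y. y \<bullet> x) \<in> alt_forms 1"
      by (intro one_form_alt linearI) (auto simp: inner_add_left)
    ultimately have "one_form (\<lambda>y. y \<bullet> x) [x] = 0" using co by (auto simp: coframe_def)
    then show ?thesis by simp
  qed
  obtain b :: "nat \<Rightarrow> 'a" where b: "bij_betw b {..<7} (Basis :: 'a set)"
    using ex_bij_betw_nat_finite[of "Basis :: 'a set"] dim by (auto simp: atLeast0LessThan)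
  have bb: "b i \<bullet> b j = (if i = j then 1 else 0)" if "i < 7" "j < 7" for i j
  proof -
    have "b i \<in> Basis" "b j \<in> Basis" "b i = b j \<longleftrightarrow> i = j"
      using b that by (auto simp: bij_betw_def inj_on_def)
    then show ?thesis by (simp add: inner_Basis)
  qed
  define G where "G x = (\<Sum>i<7. w i x *\<^sub>R b i)" for x
  have Gb: "G x \<bullet> b j = w j x" if "j < 7" for x j
  proof -
    have "G x \<bullet> b j = (\<Sum>i<7. if i = j then w j x else 0)"
      unfolding G_def inner_sum_left using bb that by (intro sum.cong) auto
    then show ?thesis using that by simp
  qed
  have linG: "linear G" unfolding G_def
    by (intro linearI)
      (auto simp: linear_add[OF lin] linear_scale[OF lin] scaleR_add_left sum.distrib scaleR_sum_right)
  have "inj G"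
    unfolding linear_injective_0[OF linG]
    using sep Gb by (metis inner_zero_left)
  then have "surj G" using linear_injective_imp_surjective[OF linG] by simp
  define e where "e j = inv G (b j)" for j
  have Ge: "G (e j) = b j" for j unfolding e_def using \<open>surj G\<close> by (simp add: surj_f_inv_f)
  have we: "w i (e j) = (if i = j then 1 else 0)" if "i < 7" "j < 7" for i j
    using Gb[OF that(1), of "e j"] bb[OF that(2,1)] Ge[of j] by auto
  have "frame 7 e w"
  proof (rule frame.intro)
    show "linear (w i)" if "i < 7" for i using lin[OF that] .
    show "w i (e j) = (if i = j then 1 else 0)" if "i < 7" "j < 7" for i j using we that .
    show "x = (\<Sum>i<7. w i x *\<^sub>R e i)" for x
    proof -
      have "w k (x - (\<Sum>i<7. w i x *\<^sub>R e i)) = 0" if k: "k < 7" for k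
      proof -
        have "w k (\<Sum>i<7. w i x *\<^sub>R e i) = (\<Sum>i<7. if i = k then w k x else 0)"
          unfolding linear_sum[OF lin[OF k]] linear_scale[OF lin[OF k]]
          using we k by (intro sum.cong) auto
        then show ?thesis using k by (simp add: linear_diff[OF lin[OF k]])
      qed
      then show ?thesis using sep[of "x - (\<Sum>i<7. w i x *\<^sub>R e i)"] by simp
    qed
  qed
  then have "frame7 e w" by (simp add: frame7_def)
  then show ?thesis using of by blast
qed

lemma determines_G2_frame:
  fixes \<psi> :: "('a::euclidean_space) form"
  assumes "DIM('a) = 7" "determines_G2 \<psi>"
  shows "\<exists>e u c. frame7 e u \<and> c \<noteq> 0 \<and> \<psi> = c *\<^sub>R frame7.psi u"
proof -
  obtain \<phi> g v where p: "G2_structure \<phi>" "G2_metric \<phi> g v" "is_hodge_star g v 3 \<phi> \<psi>"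
    using assms(2) by (auto simp: determines_G2_def)
  obtain \<eta> where eta: "coframe \<eta>" and phi: "\<phi> = wedge3 \<eta> 1 2 7 + wedge3 \<eta> 3 4 7 + wedge3 \<eta> 5 6 7 + wedge3 \<eta> 1 3 5
            - wedge3 \<eta> 2 3 6 - wedge3 \<eta> 1 4 6 - wedge3 \<eta> 2 4 5"
    using p(1) by (auto simp: G2_structure_def)
  obtain e u where f: "frame7 e u" and of: "\<And>i. i < 7 \<Longrightarrow> one_form (u i) = \<eta> (Suc i)"
    using frame_of_coframe[OF assms(1) eta] by blast
  interpret frame7 e u by (rule f)
  have cf: "coframe_form i = \<eta> i" if "0 < i" "i \<le> 7" for i
    using of[of "i - 1"] that by (simp add: coframe_form_def)
  have "\<phi> = phi"
    unfolding phi phi_wedge3 by (simp add: wedge3_def cf)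
  then show ?thesis using hodge_star_phi_unique p f by blast
qed

section \<open>Dimensions of orbits\<close>

lemma subspace_derivations:
  assumes "bilinear br"
  shows "subspace (derivations br)"
  unfolding real_vector.subspace_def
proof (intro conjI ballI allI)
  note l = bilinear_ladd[OF assms] bilinear_radd[OF assms] bilinear_lmul[OF assms] bilinear_rmul[OF assms]
    bilinear_lzero[OF assms] bilinear_rzero[OF assms]
  show "0 \<in> derivations br"
    by (auto simp: derivations_def l zero_fun_def linear_zero)
  show "D + D' \<in> derivations br" if "D \<in> derivations br" "D' \<in> derivations br" for D D'
    using that by (auto simp: derivations_def l plus_fun_def linear_compose_add)
  show "c *\<^sub>R D \<in> derivations br" if "D \<in> derivations br" for c D
    using that by (auto simp: derivations_def l scaleR_fun_def linear_compose_scale_right scaleR_add_right)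
qed

definition skew_derivations :: "('a::real_vector \<Rightarrow> 'a \<Rightarrow> real) \<Rightarrow> ('a \<Rightarrow> 'a \<Rightarrow> 'a) \<Rightarrow> ('a \<Rightarrow> 'a) set" where
  "skew_derivations g br = {D \<in> derivations br. \<forall>x y. g (D x) y = - g x (D y)}"

lemma subspace_skew_derivations:
  assumes "bilinear g" "bilinear br"
  shows "subspace (skew_derivations g br)"
  unfolding real_vector.subspace_def skew_derivations_def
  using subspace_derivations[OF assms(2)]
  by (auto simp: real_vector.subspace_def bilinear_ladd[OF assms(1)] bilinear_radd[OF assms(1)]
      bilinear_lmul[OF assms(1)] bilinear_rmul[OF assms(1)] bilinear_lzero[OF assms(1)] bilinear_rzero[OF assms(1)])

context
  fixes br :: "'a::euclidean_space \<Rightarrow> 'a \<Rightarrow> 'a" and e :: "nat \<Rightarrow> 'a" and u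
  assumes f: "frame7 e u" and bil: "bilinear br"
begin

interpretation frame7 e u by (rule f)

lemma fin_dim_derivations: "fin_dim (derivations br)"
  by (rule fin_dim_subset[OF fin_dim_endos]) (auto simp: derivations_def)

lemma group_dim_stabilizer_le:
  assumes psi: "\<psi> \<in> alt_forms k" and S: "{D \<in> derivations br. lact D \<psi> = 0} \<subseteq> K" "K \<subseteq> derivations br"
  shows "group_dim (aut_stabilizer br \<psi>) \<le> dim K"
  unfolding group_dim_def
  by (rule dim_mono_fin[OF fin_dim_subset[OF fin_dim_derivations S(2)]])
    (rule subset_trans[OF lie_algebra_of_stabilizer[OF bil psi] S(1)])

lemma orbit_dim_bounds:
  assumes "\<psi> \<in> alt_forms k"
  shows "0 \<le> orbit_dim br \<psi>" "orbit_dim br \<psi> \<le> int (dim (derivations br))"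
  using group_dim_stabilizer_le[OF assms _ subset_refl]
  unfolding orbit_dim_def group_dim_lie_aut[OF bil] by auto

lemma orbit_dim_ge_diff:
  assumes "\<psi> \<in> alt_forms k" "bilinear g"
    and skew: "\<And>D x y. linear D \<Longrightarrow> lact D \<psi> = 0 \<Longrightarrow> g (D x) y = - g x (D y)"
  shows "int (dim (derivations br)) - int (dim (skew_derivations g br)) \<le> orbit_dim br \<psi>"
proof -
  have "group_dim (aut_stabilizer br \<psi>) \<le> dim (skew_derivations g br)"
    by (rule group_dim_stabilizer_le[OF assms(1)])
      (use skew in \<open>auto simp: skew_derivations_def derivations_def\<close>)
  then show ?thesis unfolding orbit_dim_def group_dim_lie_aut[OF bil] by simp
qed

text \<open>A space of derivations that contains no non-zero skew one injects into the tangent space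
  of the orbit; this avoids determining all derivations.\<close>

lemma orbit_dim_ge_transversal:
  assumes "\<psi> \<in> alt_forms k" "bilinear g"
    and skew: "\<And>D x y. linear D \<Longrightarrow> lact D \<psi> = 0 \<Longrightarrow> g (D x) y = - g x (D y)"
    and T: "subspace T" "T \<subseteq> derivations br" "T \<inter> skew_derivations g br \<subseteq> {0}"
  shows "int (dim T) \<le> orbit_dim br \<psi>"
proof -
  have "dim T + dim (skew_derivations g br) \<le> dim (derivations br)"
    by (rule dim_add_le_fin[OF fin_dim_derivations T(2) _ T(1) subspace_skew_derivations[OF assms(2) bil] T(3)])
      (auto simp: skew_derivations_def)
  then show ?thesis using orbit_dim_ge_diff[OF assms(1,2) skew] by linarith
qed

text \<open>Makes \<open>Max\<close> in \<open>moduli_dim\<close> meaningful.\<close>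

lemma finite_orbit_dims: "finite (orbit_dim br ` Vcc br)"
proof (rule finite_subset)
  show "orbit_dim br ` Vcc br \<subseteq> {0..int (dim (derivations br))}"
    using orbit_dim_bounds by (auto simp: Vcc_def)
qed simp

lemma moduli_dim_le: "\<psi> \<in> Vcc br \<Longrightarrow> moduli_dim br \<le> int (dim (closed_forms br 4)) - orbit_dim br \<psi>"
  unfolding moduli_dim_def using Max_ge[OF finite_orbit_dims, of "orbit_dim br \<psi>"] by auto

lemma moduli_dim_ge:
  assumes "Vcc br \<noteq> {}" 
  shows "moduli_dim br \<ge> int (dim (closed_forms br 4)) - int (dim (derivations br))"
proof -
  have "Max (orbit_dim br ` Vcc br) \<le> int (dim (derivations br))"
    using assms finite_orbit_dims orbit_dim_bounds(2) by (subst Max_le_iff) (auto simp: Vcc_def)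
  then show ?thesis unfolding moduli_dim_def by linarith
qed

end

text \<open>An orthonormal basis of \<open>Z\<close> is completed by one of its orthogonal
  complement. The metric does not change, although the dual monomials do.\<close>

lemma adapted_frame:
  fixes Z :: "'a::euclidean_space set"
  assumes e': "frame n (e :: nat \<Rightarrow> 'a) u" and Z: "subspace Z"
  shows "\<exists>e' u'. frame n e' u' \<and> Z = span (e' ` {n - dim Z..<n}) \<and> frame.metric n u' = frame.metric n u"
proof -
  interpret f: frame n e u by (rule e')
  have n: "DIM('a) = n" using f.dim_eq_n by (simp only: dim_UNIV)
  obtain b :: "nat \<Rightarrow> 'a" where b: "bij_betw b {..<n} Basis"
    using ex_bij_betw_nat_finite[of "Basis :: 'a set"] n by (auto simp: atLeast0LessThan)
  have bb: "b i \<bullet> b j = (if i = j then 1 else 0)" if "i < n" "j < n" for i j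
  proof -
    have "b i \<in> Basis" "b j \<in> Basis" "b i = b j \<longleftrightarrow> i = j"
      using b that by (auto simp: bij_betw_def inj_on_def)
    then show ?thesis by (simp add: inner_Basis)
  qed
  \<comment> \<open>\<open>G\<close> is an isometry onto the standard inner product, for which
    orthonormal bases of subspaces exist.\<close>
  define G where "G x = (\<Sum>i<n. u i x *\<^sub>R b i)" for x
  have linG: "linear G" unfolding G_def
    by (intro linearI)
      (auto simp: linear_add[OF f.linear_u] linear_scale[OF f.linear_u] scaleR_add_left sum.distrib scaleR_sum_right)
  have Gb: "G x \<bullet> b j = u j x" if "j < n" for x j
  proof -
    have "G x \<bullet> b j = (\<Sum>i<n. if i = j then u j x else 0)"
      unfolding G_def inner_sum_left using bb that by (intro sum.cong) auto
    then show ?thesis using that by simp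
  qed
  have GG: "G x \<bullet> G y = f.metric x y" for x y
  proof -
    have "G x \<bullet> G y = (\<Sum>i<n. u i y * (G x \<bullet> b i))" unfolding G_def[of y] by (simp add: inner_sum_right)
    also have "\<dots> = f.metric x y" unfolding f.metric_def by (intro sum.cong) (auto simp: Gb)
    finally show ?thesis .
  qed
  have "inj G"
    unfolding linear_injective_0[OF linG]
  proof (intro allI impI)
    fix x assume "G x = 0"
    then have "u i x = u i 0" if "i < n" for i
      using Gb[OF that, of x] linear_0[OF f.linear_u[OF that]] by simp
    then show "x = 0" by (rule f.coords_eqI)
  qed
  then have "surj G" using linear_injective_imp_surjective[OF linG] by simp
  have GI: "G (inv G x) = x" for x using \<open>surj G\<close> by (simp add: surj_f_inv_f)
  have IG: "inv G (G x) = x" for x using \<open>inj G\<close> by simp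
  have linI: "linear (inv G)"
  proof (rule linearI)
    show "inv G (x + y) = inv G x + inv G y" for x y
      using IG[of "inv G x + inv G y"] by (simp add: linear_add[OF linG] GI)
    show "inv G (c *\<^sub>R x) = c *\<^sub>R inv G x" for c x
      using IG[of "c *\<^sub>R inv G x"] by (simp add: linear_scale[OF linG] GI)
  qed
  let ?S = "G ` Z"
  have subS: "subspace ?S" by (rule linear_subspace_image[OF linG Z])
  have dimS: "dim ?S = dim Z" using dim_image_eq[OF linG, of Z] \<open>inj G\<close> by (simp add: inj_on_subset)
  obtain B1 where B1: "B1 \<subseteq> ?S" "pairwise orthogonal B1" "\<And>x. x \<in> B1 \<Longrightarrow> norm x = 1"
    "independent B1" "card B1 = dim ?S" "span B1 = ?S"
    by (rule orthonormal_basis_subspace[OF subS]) blast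
  let ?C = "{y \<in> UNIV. \<forall>x\<in>?S. orthogonal x y}"
  have subC: "subspace ?C" by (auto simp: subspace_def orthogonal_def inner_add_right)
  have dimC: "dim ?C + dim ?S = n"
    using dim_subspace_orthogonal_to_vectors[OF subS subspace_UNIV subset_UNIV] n by simp
  obtain B2 where B2: "B2 \<subseteq> ?C" "pairwise orthogonal B2" "\<And>x. x \<in> B2 \<Longrightarrow> norm x = 1"
    "independent B2" "card B2 = dim ?C" "span B2 = ?C"
    by (rule orthonormal_basis_subspace[OF subC]) blast
  have fin: "finite B1" "finite B2"
    by (rule finiteI_independent[OF B1(4)], rule finiteI_independent[OF B2(4)])
  let ?m = "n - dim Z"
  have d: "dim ?C = ?m" "dim Z \<le> n" using dimC dimS by linarith+
  have cards: "card {..<?m} = card B2" "card {?m..<n} = card B1"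
    unfolding B2(5) d(1) B1(5) dimS using d(2) by simp_all
  obtain h1 where h1: "bij_betw h1 {?m..<n} B1"
    using finite_same_card_bij[OF finite_atLeastLessThan fin(1) cards(2)] by blast
  obtain h2 where h2: "bij_betw h2 {..<?m} B2"
    using finite_same_card_bij[OF finite_lessThan fin(2) cards(1)] by blast
  define h where "h i = (if i < ?m then h2 i else h1 i)" for i
  have orth12: "x \<bullet> y = 0" if "x \<in> B1" "y \<in> B2" for x y
    using subsetD[OF B1(1) that(1)] subsetD[OF B2(1) that(2)] unfolding orthogonal_def by blast
  have orth21: "x \<bullet> y = 0" if "x \<in> B2" "y \<in> B1" for x y
    using orth12[OF that(2,1)] by (simp add: inner_commute)
  have hh: "h i \<bullet> h j = (if i = j then 1 else 0)" if ij: "i < n" "j < n" for i j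
  proof -
    have in2: "h i \<in> B2" if "i < ?m" for i using h2 that by (auto simp: h_def bij_betw_def)
    have in1: "h i \<in> B1" if "\<not> i < ?m" "i < n" for i using h1 that by (auto simp: h_def bij_betw_def)
    have ne2: "h i \<noteq> h j" if "i < ?m" "j < ?m" "i \<noteq> j" for i j
      using h2 that by (auto simp: h_def bij_betw_def inj_on_def)
    have ne1: "h i \<noteq> h j" if "\<not> i < ?m" "\<not> j < ?m" "i < n" "j < n" "i \<noteq> j" for i j
      using h1 that by (auto simp: h_def bij_betw_def inj_on_def)
    show ?thesis
    proof (cases "i = j")
      case True
      have "norm (h i) = 1" using B1(3) B2(3) in1 in2 ij by (cases "i < ?m") auto
      then show ?thesis using True by (simp add: norm_eq_1)
    next
      case False
      have "h i \<bullet> h j = 0"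
        using B1(2) B2(2) in1 in2 ne1 ne2 ij False orth12 orth21
        by (cases "i < ?m"; cases "j < ?m") (auto simp: pairwise_def orthogonal_def)
      then show ?thesis using False by simp
    qed
  qed
  define es where "es = map (\<lambda>i. inv G (h i)) [0..<n]"
  have mm: "f.metric (inv G x) (inv G y) = x \<bullet> y" for x y using GG[of "inv G x" "inv G y"] by (simp add: GI)
  have of: "orthonormal_frame f.metric es"
    unfolding orthonormal_frame_def es_def using n hh by (simp add: mm)
  have fr: "frame n (\<lambda>i. es ! i) (\<lambda>i. f.metric (es ! i))"
    using orthonormal_list_frame[OF f.scalar_product_metric of] n by simp
  interpret g: frame n "\<lambda>i. es ! i" "\<lambda>i. f.metric (es ! i)" by (rule fr)
  have "f.metric x y = g.metric x y" for x y
  proof -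
    have "f.metric x y = (\<Sum>i<n. \<Sum>j<n. if j = i then f.metric (es ! i) x * f.metric (es ! i) y else 0)"
      unfolding g.bilinear_expand[OF f.bilinear_metric, of x y]
      by (intro sum.cong refl) (auto simp: g.u_e)
    then show ?thesis by (simp add: g.metric_def)
  qed
  then have "g.metric = f.metric" by (intro ext) simp
  moreover have "Z = span ((\<lambda>i. es ! i) ` {?m..<n})"
  proof -
    have "(\<lambda>i. es ! i) ` {?m..<n} = inv G ` h1 ` {?m..<n}"
      by (auto simp: es_def h_def image_image)
    also have "\<dots> = inv G ` B1" using h1 by (simp add: bij_betw_def)
    finally have "span ((\<lambda>i. es ! i) ` {?m..<n}) = inv G ` span B1"
      using linear_span_image[OF linI, of B1] by simp
    also have "\<dots> = Z" unfolding B1(6) using \<open>inj G\<close> by (simp add: image_image)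
    finally show ?thesis by simp
  qed
  ultimately show ?thesis using fr by blast
qed

text \<open>The new frame no longer brings \<open>\<psi>\<close> to normal form; what survives the
  rotation is that endomorphisms annihilating \<open>\<psi>\<close> are skew for the metric.\<close>

lemma Vcc_adapted_frame:
  fixes br :: "'a::euclidean_space \<Rightarrow> 'a \<Rightarrow> 'a"
  assumes "DIM('a) = 7" "\<psi> \<in> Vcc br" "subspace Z"
  shows "\<exists>e u. frame7 e u \<and> Z = span (e ` {7 - dim Z..<7}) \<and>
    (\<forall>D x y. linear D \<longrightarrow> lact D \<psi> = 0 \<longrightarrow> frame.metric 7 u (D x) y = - frame.metric 7 u x (D y))"
proof -
  obtain e u c where f: "frame7 e u" and c: "c \<noteq> 0" and psi: "\<psi> = c *\<^sub>R frame7.psi u"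
    using determines_G2_frame[OF assms(1), of \<psi>] assms(2) unfolding Vcc_def by blast
  interpret frame7 e u by (rule f)
  obtain e' u' where f': "frame 7 e' u'" and Z: "Z = span (e' ` {7 - dim Z..<7})"
    and m: "frame.metric 7 u' = metric"
    using adapted_frame[OF frame_axioms assms(3)] by blast
  have "metric (D x) y = - metric x (D y)" if "linear D" "lact D \<psi> = 0" for D x y
  proof (rule lact_psi_skew[OF that(1)])
    have "c *\<^sub>R lact D psi = 0" using that(2) unfolding psi lact_scale .
    then show "lact D psi = 0" using c by (simp only: scaleR_eq_0_iff) blast
  qed
  then show ?thesis using f' Z m by (metis frame7_def)
qed

section \<open>Two-step nilpotent Lie algebras\<close>

lemma lact_zero_map:
  assumes "\<alpha> \<in> alt_forms k" "\<And>x. D x = 0"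
  shows "lact D \<alpha> = 0"
proof
  show "lact D \<alpha> xs = 0 xs" for xs
    using assms(1)
  proof (induction xs arbitrary: \<alpha> k)
    case Nil
    then show ?case by simp
  next
    case (Cons x xs)
    have "\<alpha> (0 # xs) = 0" by (rule linear_0[OF alt_linear_head[OF Cons.prems]])
    then show ?case using Cons.IH[OF interior_alt[OF Cons.prems], of x] assms(2) by simp
  qed
qed

lemma (in frame7) linear_coeff: "i < 7 \<Longrightarrow> linear (\<lambda>D :: 'a \<Rightarrow> 'a. u i (D x))"
  using linear_compose[OF linear_apply linear_u] by (simp add: o_def)

lemma subspace_zero_set: "linear f \<Longrightarrow> subspace {x. f x = 0}"
  by (auto simp: real_vector.subspace_def linear_0 linear_add linear_scale)

text \<open>A basis whose vectors from index \<open>p\<close> on span the derived algebra, which is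
  central; \<open>p\<close> is the codimension of the derived algebra. For the metric of the frame,
  the vectors before index \<open>p\<close> span its orthogonal complement.\<close>

locale two_step_frame = frame7 e u for e :: "nat \<Rightarrow> 'a::euclidean_space" and u +
  fixes br :: "'a \<Rightarrow> 'a \<Rightarrow> 'a" and p :: nat
  assumes lie: "lie_bracket br" and p: "0 < p" "p < 7"
    and br_coord: "i < p \<Longrightarrow> u i (br x y) = 0"
    and central: "p \<le> j \<Longrightarrow> j < 7 \<Longrightarrow> br (e j) x = 0"
    and generated: "p \<le> j \<Longrightarrow> j < 7 \<Longrightarrow> e j \<in> span {br x y |x y. True}"
begin

lemma bil: "bilinear br"
  using lie by (simp add: lie_bracket_def)

lemma br_self: "br x x = 0"
  using lie by (simp add: lie_bracket_def)

lemmas br_swap = lie_bracket_swap[OF lie]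

lemma br_lin: "linear (br x)" "linear (\<lambda>x. br x y)"
  using bil by (auto simp: bilinear_def)

lemma central_right: "p \<le> j \<Longrightarrow> j < 7 \<Longrightarrow> br x (e j) = 0"
  using central[of j x] br_swap[of x "e j"] by simp

lemma br_central:
  assumes "\<And>i. i < p \<Longrightarrow> u i z = 0"
  shows "br z x = 0" "br x z = 0"
proof -
  have "br z x = (\<Sum>i<7. u i z *\<^sub>R br (e i) x)" by (rule linear_expand[OF br_lin(2)])
  also have "\<dots> = 0" using assms central by (intro sum.neutral) (metis lessThan_iff not_le_imp_less scale_zero_left scale_zero_right)
  finally show "br z x = 0" .
  then show "br x z = 0" using br_swap[of x z] by simp
qed

text \<open>One representative for every set of three basis vectors of which at least two lie in the
  derived algebra.\<close>

definition rank_triples :: "(nat \<times> nat \<times> nat) list" where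
  "rank_triples = [(l, m, a). l \<leftarrow> [p..<7], m \<leftarrow> [Suc l..<7], a \<leftarrow> [0..<7], a < p \<or> m < a]"

text \<open>Suppose \<open>\<alpha>\<close> vanishes whenever two arguments lie in the derived
  algebra. Then contracting its differential with such a vector gives 0 by Cartan's formula, and the
  differential is determined by its values on quadruples below \<open>p\<close>, which account for
  the summand \<open>p choose 4\<close>.\<close>

lemma rank3_le: "dim (ce_d br ` alt_forms 3) \<le> (p choose 4) + length rank_triples"
proof -
  let ?S = "{A. A \<subseteq> {..<p} \<and> card A = 4}"
  let ?f = "case_sum (\<lambda>A \<alpha>. ce_d br \<alpha> (nths E A)) (\<lambda>(l, m, a) \<alpha>. \<alpha> [e l, e m, e a])"
  have fin: "finite ?S" by (rule finite_subset[of _ "Pow {..<p}"]) auto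
  have "dim (ce_d br ` alt_forms 3) \<le> card (?S <+> set rank_triples)"
  proof (rule rank_le_functionals[where f="?f"])
    show "finite (?S <+> set rank_triples)" using fin by simp
    show "linear (?f i)" for i
      using linear_compose[OF linear_ce_d linear_apply]
      by (cases i) (auto simp: o_def linear_apply split: prod.split)
    fix \<alpha> :: "'a form" assume a: "\<alpha> \<in> alt_forms 3" and 0: "\<And>i. i \<in> ?S <+> set rank_triples \<Longrightarrow> ?f i \<alpha> = 0"
    have hA: "ce_d br \<alpha> (nths E A) = 0" if "A \<subseteq> {..<p}" "card A = 4" for A
    proof -
      have "A \<in> ?S" using that by simp
      from 0[OF InlI[OF this]] show ?thesis by simp
    qed
    have hT: "\<alpha> [e l, e m, e a] = 0" if "p \<le> l" "l < m" "m < 7" "a < 7" "a < p \<or> m < a" for l m a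
    proof -
      have "(l, m, a) \<in> set rank_triples" using that by (auto simp: rank_triples_def)
      from 0[OF InrI[OF this]] show ?thesis by simp
    qed
    have sw1: "\<alpha> [x, y, z] = - \<alpha> [y, x, z]" for x y z by (rule alt_swap[OF a])
    have sw2: "\<alpha> [x, y, z] = - \<alpha> [x, z, y]" for x y z
      using alt_swap[OF interior_alt[OF a], of x y z "[]"] by (simp add: interior_def)
    have nd: "\<alpha> [x, x, y] = 0" "\<alpha> [x, y, x] = 0" "\<alpha> [y, x, x] = 0" for x y
      by (rule alt_forms_not_distinct[OF a], simp)+
    have base: "\<alpha> [e l, e m, e a] = 0" if "p \<le> l" "l < m" "m < 7" "a < 7" for l m a
    proof -
      consider "a < p \<or> m < a" | "a = m" | "a = l" | "l < a" "a < m" | "p \<le> a" "a < l" using that by linarith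
      then show ?thesis
      proof cases
        case 1
        then show ?thesis using hT that by blast
      next
        case 4
        then show ?thesis using hT[of l a m] that sw2[of "e l" "e m" "e a"] by simp
      next
        case 5
        then show ?thesis using hT[of a l m] that sw2[of "e l" "e m" "e a"] sw1[of "e l" "e a" "e m"] by simp
      qed (use nd in auto)
    qed
    have base2: "\<alpha> [e l, e m, e a] = 0" if "p \<le> l" "p \<le> m" "l < 7" "m < 7" "a < 7" for l m a
      using base[of l m a] base[of m l a] sw1[of "e l" "e m" "e a"] nd that
      by (cases l m rule: linorder_cases) auto
    have zz: "\<alpha> (e j # z # xs) = 0" if j: "p \<le> j" "j < 7" and z: "\<And>i. i < p \<Longrightarrow> u i z = 0" for j z xs
    proof (cases "length xs = 1")
      case True
      then obtain x where xs: "xs = [x]" by (auto simp: length_Suc_conv)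
      have "\<alpha> [e j, e l, x] = 0" if l: "p \<le> l" "l < 7" for l
      proof -
        have lin: "linear (\<lambda>x. \<alpha> [e j, e l, x])"
          using alt_linear_head[OF interior_alt[OF interior_alt[OF a]], of "e l" "e j" "[]"] by (simp add: interior_def)
        have "\<alpha> [e j, e l, x] = (\<Sum>a<7. u a x *\<^sub>R \<alpha> [e j, e l, e a])" by (rule linear_expand[OF lin])
        then show ?thesis using base2[OF j(1) l(1) j(2) l(2)] by simp
      qed
      then have "u l z * \<alpha> [e j, e l, x] = 0" if "l < 7" for l
        using z[of l] that by (cases "l < p") auto
      moreover have "linear (\<lambda>z. \<alpha> [e j, z, x])"
        using alt_linear_head[OF interior_alt[OF a], of "e j" "[x]"] by (simp add: interior_def)
      from linear_expand[OF this, of z] have "\<alpha> [e j, z, x] = (\<Sum>l<7. u l z *\<^sub>R \<alpha> [e j, e l, x])" .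
      ultimately show ?thesis unfolding xs by (simp add: sum.neutral)
    next
      case False
      then show ?thesis using alt_forms_length[OF a] by simp
    qed
    \<comment> \<open>The Lie derivative along a central vector is zero, and the differential of the
      contraction only evaluates \<open>\<alpha>\<close> on \<open>e j\<close> and a
      bracket.\<close>
    have iz: "interior (e j) (ce_d br \<alpha>) = 0" if j: "p \<le> j" "j < 7" for j
    proof -
      have "lact (br (e j)) \<alpha> = 0" by (rule lact_zero_map[OF a]) (rule central[OF j])
      moreover have "ce_d br (interior (e j) \<alpha>) = 0"
      proof
        show "ce_d br (interior (e j) \<alpha>) xs = 0 xs" for xs
          unfolding ce_d_def interior_def using zz[OF j br_coord] by (simp add: case_prod_unfold)
      qed
      ultimately show ?thesis unfolding interior_ce_d[OF a] by simp
    qed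
    have d4: "ce_d br \<alpha> \<in> alt_forms 4" using ce_d_alt[OF bil br_self a] by simp
    show "ce_d br \<alpha> = 0"
    proof (rule form_zero_nths[OF d4])
      fix A :: "nat set" assume A: "A \<subseteq> {..<7}" "card A = 4"
      show "ce_d br \<alpha> (nths E A) = 0"
      proof (cases "A \<subseteq> {..<p}")
        case True
        then show ?thesis using hA A by blast
      next
        case False
        then obtain j where j: "j \<in> A" "p \<le> j" "j < 7" using A(1) by fastforce
        then have "e j \<in> set (nths E A)" by (auto simp: nths_E set_nths_upt)
        then obtain as bs where ab: "nths E A = as @ e j # bs" by (auto dest: split_list)
        have "ce_d br \<alpha> (e j # as @ bs) = 0" using fun_cong[OF iz[OF j(2,3)]] by (simp add: interior_def)
        then show ?thesis using alt_move[OF d4, of "e j" as bs] ab by simp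
      qed
    qed
  qed
  also have "\<dots> \<le> (p choose 4) + length rank_triples"
    using n_subsets[of "{..<p}" 4] card_length[of rank_triples] fin by (simp add: card_Plus)
  finally show ?thesis .
qed

section \<open>Derivations from the grading and from maps into the derived algebra\<close>

definition grading_eqs :: "(nat \<times> nat) list" where
  "grading_eqs = [(i, j). i \<leftarrow> [0..<7], j \<leftarrow> [0..<7], \<not> (j < p \<and> p \<le> i) \<and> (i, j) \<noteq> (0, 0)]"

definition grading_weight :: "nat \<times> nat \<Rightarrow> real" where
  "grading_weight = (\<lambda>(i, j). if i \<noteq> j then 0 else if j < p then 1 else 2)"

text \<open>The maps \<open>c G + h\<close>: \<open>G\<close> is 1 on the complement and 2 on the
  derived algebra, \<open>h\<close> is an arbitrary map from the complement into the derived
  algebra, and \<open>c\<close> is the matrix entry at (0,0). The equations leave the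
  \<open>p (7 - p)\<close> entries of \<open>h\<close> and this one entry free.\<close>

definition graded_derivations :: "('a \<Rightarrow> 'a) set" where
  "graded_derivations = {D \<in> {D. linear D}. \<forall>q\<in>set grading_eqs.
     u (fst q) (D (e (snd q))) - grading_weight q * u 0 (D (e 0)) = 0}"

lemma linear_grading_eq: 
  assumes "q \<in> set grading_eqs"
  shows "linear (\<lambda>D. u (fst q) (D (e (snd q))) - grading_weight q * u 0 (D (e 0)))"
  using assms linear_compose_scale_right[OF linear_coeff, unfolded real_scaleR_def]
  by (intro linear_compose_sub linear_coeff) (auto simp: grading_eqs_def)

lemma subspace_graded_derivations: "subspace graded_derivations"
proof -
  have "subspace {D. u (fst q) (D (e (snd q))) - grading_weight q * u 0 (D (e 0)) = 0}"
    if "q \<in> set grading_eqs" for q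
    by (rule subspace_zero_set[OF linear_grading_eq[OF that]])
  then have "subspace ({D. linear D} \<inter> (\<Inter>q\<in>set grading_eqs. {D. u (fst q) (D (e (snd q))) - grading_weight q * u 0 (D (e 0)) = 0}))"
    by (intro real_vector.subspace_inter subspace_endos real_vector.subspace_Int)
  moreover have "{D. linear D} \<inter> (\<Inter>q\<in>set grading_eqs. {D. u (fst q) (D (e (snd q))) - grading_weight q * u 0 (D (e 0)) = 0}) = graded_derivations"
    by (auto simp: graded_derivations_def)
  ultimately show ?thesis by simp
qed

lemma dim_graded_derivations: "49 \<le> dim graded_derivations + length grading_eqs"
proof -
  have "dim {D :: 'a \<Rightarrow> 'a. linear D} \<le> dim graded_derivations + card (set grading_eqs)"
    unfolding graded_derivations_def
    by (rule dim_common_kernel_ge[OF finite_set subspace_endos fin_dim_endos linear_grading_eq])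
  then show ?thesis using card_length[of grading_eqs] by (simp add: dim_endos)
qed

lemma graded_derivationsD:
  assumes "D \<in> graded_derivations"
  defines "c \<equiv> u 0 (D (e 0))"
  shows "linear D" "i < p \<Longrightarrow> u i (D x) = c * u i x" "p \<le> j \<Longrightarrow> j < 7 \<Longrightarrow> D (e j) = (2 * c) *\<^sub>R e j"
proof -
  show lin: "linear D" using assms by (simp add: graded_derivations_def)
  have eq: "u i (D (e j)) = grading_weight (i, j) * c" if "i < 7" "j < 7" "\<not> (j < p \<and> p \<le> i)" for i j
  proof (cases "(i, j) = (0, 0)")
    case True
    then show ?thesis using p by (simp add: grading_weight_def c_def)
  next
    case False
    then have "(i, j) \<in> set grading_eqs" using that by (auto simp: grading_eqs_def)
    then show ?thesis using assms unfolding graded_derivations_def by fastforce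
  qed
  show "u i (D x) = c * u i x" if i: "i < p"
  proof -
    have i7: "i < 7" using i p by simp
    have "(\<lambda>x. u i (D x)) = (\<lambda>x. c * u i x)"
    proof (rule linear_eqI)
      show "linear (\<lambda>x. u i (D x))" using linear_compose[OF lin linear_u[OF i7]] by (simp add: o_def)
      show "linear (\<lambda>x. c * u i x)" using linear_compose_scale_right[OF linear_u[OF i7], of c] by simp
      show "u i (D (e j)) = c * u i (e j)" if "j < 7" for j
        using eq[of i j] i i7 that u_e[of i j] by (auto simp: grading_weight_def)
    qed
    then show ?thesis by (rule fun_cong)
  qed
  show "D (e j) = (2 * c) *\<^sub>R e j" if j: "p \<le> j" "j < 7"
  proof (rule coords_eqI)
    fix i :: nat assume i: "i < 7"
    show "u i (D (e j)) = u i ((2 * c) *\<^sub>R e j)"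
      using eq[of i j] i j u_e[of i j] by (auto simp: grading_weight_def linear_scale[OF linear_u[OF i]])
  qed
qed

lemma graded_derivations_center:
  assumes "D \<in> graded_derivations" "\<And>i. i < p \<Longrightarrow> u i z = 0"
  shows "D z = (2 * u 0 (D (e 0))) *\<^sub>R z"
proof -
  note D = graded_derivationsD[OF assms(1)]
  let ?c = "2 * u 0 (D (e 0))"
  have "D z = (\<Sum>j<7. u j z *\<^sub>R D (e j))" by (rule linear_expand[OF D(1)])
  also have "\<dots> = (\<Sum>j<7. ?c *\<^sub>R (u j z *\<^sub>R e j))"
  proof (intro sum.cong refl)
    fix j :: nat assume "j \<in> {..<7}"
    then show "u j z *\<^sub>R D (e j) = ?c *\<^sub>R (u j z *\<^sub>R e j)"
      using D(3)[of j] assms(2)[of j] by (cases "j < p") auto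
  qed
  also have "\<dots> = ?c *\<^sub>R (\<Sum>j<7. u j z *\<^sub>R e j)" by (simp only: scaleR_sum_right)
  also have "(\<Sum>j<7. u j z *\<^sub>R e j) = z" by (rule expand[symmetric])
  finally show ?thesis .
qed

lemma graded_derivations_subset: "graded_derivations \<subseteq> derivations br"
proof
  fix D assume d: "D \<in> graded_derivations"
  note D = graded_derivationsD[OF d]
  let ?c = "u 0 (D (e 0))"
  have "D (br x y) = br (D x) y + br x (D y)" for x y
  proof -
    have z: "br (D x - ?c *\<^sub>R x) y = 0" "br y (D x - ?c *\<^sub>R x) = 0" for x y
    proof -
      have "u i (D x - ?c *\<^sub>R x) = 0" if "i < p" for i
        using D(2)[OF that, of x] that p linear_u[of i] by (simp add: linear_diff linear_scale)
      then show "br (D x - ?c *\<^sub>R x) y = 0" "br y (D x - ?c *\<^sub>R x) = 0"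
        by - (rule br_central(1), assumption, rule br_central(2), assumption)
    qed
    have "br (D x) y = ?c *\<^sub>R br x y" "br x (D y) = ?c *\<^sub>R br x y"
      using z(1)[of x y] z(2)[of x y] by (simp_all add: bilinear_lsub[OF bil] bilinear_rsub[OF bil] bilinear_lmul[OF bil] bilinear_rmul[OF bil])
    moreover have "D (br x y) = (2 * ?c) *\<^sub>R br x y" by (rule graded_derivations_center[OF d br_coord])
    ultimately show ?thesis by (simp add: scaleR_add_left[symmetric])
  qed
  then show "D \<in> derivations br" using D(1) by (simp add: derivations_def)
qed

text \<open>The diagonal entry at \<open>e 6\<close> forces \<open>c = 0\<close>. Then
  \<open>D\<close> squares to zero, and skewness turns this into \<open>|D x| = 0\<close>.\<close>

lemma graded_derivations_not_skew: "graded_derivations \<inter> skew_derivations metric br \<subseteq> {0}"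
proof
  fix D assume "D \<in> graded_derivations \<inter> skew_derivations metric br"
  then have d: "D \<in> graded_derivations" and sk: "metric (D x) y = - metric x (D y)" for x y
    by (auto simp: skew_derivations_def)
  note D = graded_derivationsD[OF d]
  let ?c = "u 0 (D (e 0))"
  have "metric (D (e 6)) (e 6) = - metric (e 6) (D (e 6))" by (rule sk)
  then have c: "?c = 0"
    using D(3)[of 6] p metric_e(1)[of 6 "e 6"] u_e[of 6 6]
    by (simp add: bilinear_lmul[OF bilinear_metric] bilinear_rmul[OF bilinear_metric])
  have "D x = 0" for x
  proof -
    have "D (D x) = 0" using graded_derivations_center[OF d, of "D x"] D(2) c by simp
    then have "metric (D x) (D x) = 0" using sk[of x "D x"] by (simp add: bilinear_rzero[OF bilinear_metric])
    then show ?thesis using scalar_product_metric unfolding scalar_product_def by (metis less_irrefl)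
  qed
  then show "D \<in> {0}" by (simp add: zero_fun_def fun_eq_iff)
qed

definition triangular_eqs :: "(nat \<times> nat) list" where
  "triangular_eqs = [(i, j). i \<leftarrow> [0..<p], j \<leftarrow> [p..<7]]"

definition leibniz_eqs :: "(nat \<times> nat \<times> nat) list" where
  "leibniz_eqs = [(i, j, l). i \<leftarrow> [0..<p], j \<leftarrow> [Suc i..<p], l \<leftarrow> [p..<7]]"

text \<open>The imposed equations say that \<open>D\<close> preserves the derived algebra, which is
  \<open>p (7 - p)\<close> conditions, and that the Leibniz rule holds for pairs of complement
  vectors in the central coordinates, which is \<open>7 - p\<close> conditions per pair. All other
  instances of the Leibniz rule follow from these.\<close>

lemma dim_derivations_ge: "49 \<le> dim (derivations br) + length triangular_eqs + length leibniz_eqs"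
proof -
  let ?I = "set triangular_eqs <+> set leibniz_eqs"
  let ?f = "case_sum (\<lambda>(i, j) D. u i (D (e j)))
     (\<lambda>(i, j, l) D. u l (D (br (e i) (e j)) - br (D (e i)) (e j) - br (e i) (D (e j))))"
  let ?K = "{D \<in> {D. linear D}. \<forall>q\<in>?I. ?f q D = 0}"
  have lin: "linear (?f q)" if "q \<in> ?I" for q
  proof (cases q)
    case (Inl a)
    then show ?thesis using that p linear_coeff by (auto simp: triangular_eqs_def)
  next
    case (Inr b)
    obtain i j l where b: "b = (i, j, l)" by (cases b) auto
    then have "l < 7" using Inr that by (auto simp: leibniz_eqs_def)
    then show ?thesis unfolding Inr b
      by (auto intro!: linearI simp: linear_diff[OF linear_u] linear_add[OF linear_u] linear_scale[OF linear_u]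
        bilinear_ladd[OF bil] bilinear_radd[OF bil] bilinear_lmul[OF bil] bilinear_rmul[OF bil] algebra_simps)
  qed
  have "?K \<subseteq> derivations br"
  proof
    fix D assume "D \<in> ?K"
    then have D: "linear D" and q: "\<And>q. q \<in> ?I \<Longrightarrow> ?f q D = 0" by auto
    have tri: "u i (D (e j)) = 0" if "i < p" "p \<le> j" "j < 7" for i j
    proof -
      have "(i, j) \<in> set triangular_eqs" using that by (force simp: triangular_eqs_def)
      from q[OF InlI[OF this]] show ?thesis by simp
    qed
    have triz: "u i (D z) = 0" if i: "i < p" and z: "\<And>i. i < p \<Longrightarrow> u i z = 0" for i z
    proof -
      have "u i (D z) = (\<Sum>j<7. u j z *\<^sub>R u i (D (e j)))"
        using linear_expand[OF linear_compose[OF D linear_u], of i z] i p by (simp add: o_def)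
      also have "\<dots> = 0"
      proof (rule sum.neutral, rule ballI)
        fix j :: nat assume "j \<in> {..<7}"
        then show "u j z *\<^sub>R u i (D (e j)) = 0" using z[of j] tri[OF i, of j] by (cases "j < p") auto
      qed
      finally show ?thesis .
    qed
    let ?L = "\<lambda>x y. D (br x y) - br (D x) y - br x (D y)"
    have low: "u l (?L x y) = 0" if "l < p" for l x y
      using triz[OF that br_coord, of x y] br_coord[OF that] that p linear_u[of l] by (simp add: linear_diff)
    have Lsw: "?L x y = - ?L y x" for x y
      using br_swap[of x y] br_swap[of "D x" y] br_swap[of x "D y"] by (simp add: linear_neg[OF D])
    have Lij: "?L (e i) (e j) = 0" if ij: "i < j" "j < p" for i j
    proof (rule coords_eqI)
      fix l :: nat assume l: "l < 7"
      have "u l (?L (e i) (e j)) = 0"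
      proof (cases "l < p")
        case True
        then show ?thesis by (rule low)
      next
        case False
        then have "(i, j, l) \<in> set leibniz_eqs" using ij l by (force simp: leibniz_eqs_def)
        from q[OF InrI[OF this]] show ?thesis by simp
      qed
      then show "u l (?L (e i) (e j)) = u l 0" using linear_0[OF linear_u[OF l]] by simp
    qed
    have Lz: "?L (e i) y = 0" if "p \<le> i" "i < 7" for i y
    proof -
      have "br (D (e i)) y = 0" by (rule br_central(1)[OF tri[OF _ that]])
      then show ?thesis using central[OF that] linear_0[OF D] by simp
    qed
    have Lb: "?L (e i) (e j) = 0" if ij: "i < 7" "j < 7" for i j
    proof (cases "p \<le> i \<or> p \<le> j")
      case True
      then show ?thesis using Lz[of i "e j"] Lz[of j "e i"] Lsw[of "e i" "e j"] ij by auto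
    next
      case False
      then consider "i < j" "j < p" | "j < i" "i < p" | "i = j" by linarith
      then show ?thesis
      proof cases
        case 2
        then show ?thesis using Lij[of j i] Lsw[of "e i" "e j"] by simp
      next
        case 3
        then show ?thesis using Lsw[of "e i" "e i"] by (metis eq_neg_iff_add_eq_0 real_vector.scale_eq_0_iff scaleR_2 zero_neq_numeral)
      qed (rule Lij)
    qed
    have linL: "linear (?L x)" "linear (\<lambda>x. ?L x y)" for x y
      by (auto intro!: linearI simp: linear_add[OF D] linear_scale[OF D] bilinear_ladd[OF bil] bilinear_radd[OF bil]
         bilinear_lmul[OF bil] bilinear_rmul[OF bil] algebra_simps)
    have "?L x y = 0" for x y
    proof -
      have "?L (e i) y = 0" if "i < 7" for i
      proof -
        have "?L (e i) y = (\<Sum>j<7. u j y *\<^sub>R ?L (e i) (e j))" by (rule linear_expand[OF linL(1)])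
        also have "\<dots> = 0" using Lb[OF that] by (intro sum.neutral ballI) (simp only: lessThan_iff scale_zero_right)
        finally show ?thesis .
      qed
      then have "(\<Sum>i<7. u i x *\<^sub>R ?L (e i) y) = 0"
        by (intro sum.neutral ballI) (simp only: lessThan_iff scale_zero_right)
      moreover have "?L x y = (\<Sum>i<7. u i x *\<^sub>R ?L (e i) y)" by (rule linear_expand[OF linL(2)])
      ultimately show ?thesis by (simp only:)
    qed
    then show "D \<in> derivations br" using D by (simp add: derivations_def algebra_simps)
  qed
  then have "dim ?K \<le> dim (derivations br)" by (rule dim_mono_fin[OF fin_dim_derivations[OF frame7_axioms bil]])
  moreover have "dim {D :: 'a \<Rightarrow> 'a. linear D} \<le> dim ?K + card ?I"
    by (rule dim_common_kernel_ge[OF _ subspace_endos fin_dim_endos lin]) auto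
  moreover have "card ?I \<le> length triangular_eqs + length leibniz_eqs"
    using card_length[of triangular_eqs] card_length[of leibniz_eqs] by (simp add: card_Plus)
  ultimately show ?thesis by (simp add: dim_endos)
qed

lemma derivation_center:
  assumes D: "D \<in> derivations br" and z: "p \<le> j" "j < 7" and i: "i < p"
  shows "u i (D (e j)) = 0"
proof -
  have lin: "linear D" using D by (simp add: derivations_def)
  have i7: "i < 7" using i p by simp
  have "subspace {z. u i (D z) = 0}"
    using linear_u[OF i7] lin by (auto simp: subspace_def linear_0 linear_add linear_scale)
  moreover have "{br x y |x y. True} \<subseteq> {z. u i (D z) = 0}"
    using D br_coord[OF i] linear_u[OF i7] by (auto simp: derivations_def linear_add)
  ultimately have "span {br x y |x y. True} \<subseteq> {z. u i (D z) = 0}" by (rule span_minimal[rotated])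
  then show ?thesis using generated[OF z] by auto
qed

end

section \<open>Skew derivations of two-step algebras\<close>

context two_step_frame
begin

lemma skew_derivationsD:
  assumes "D \<in> skew_derivations metric br"
  shows "linear D" "D \<in> derivations br" "D (br x y) = br (D x) y + br x (D y)"
    "metric (D x) y = - metric x (D y)"
    "i < 7 \<Longrightarrow> j < 7 \<Longrightarrow> u i (D (e j)) = - u j (D (e i))"
proof -
  show D: "D \<in> derivations br" and sk: "metric (D x) y = - metric x (D y)" for x y
    using assms by (auto simp: skew_derivations_def)
  then show "linear D" "D (br x y) = br (D x) y + br x (D y)" by (auto simp: derivations_def)
  show "u i (D (e j)) = - u j (D (e i))" if "i < 7" "j < 7"
    using sk[of "e j" "e i"] metric_e that by simp
qed

text \<open>A derivation preserves the derived algebra; a skew one also preserves its orthogonal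
  complement.\<close>

lemma skew_derivations_block:
  assumes D: "D \<in> skew_derivations metric br" and ij: "i < p" "p \<le> j" "j < 7"
  shows "u i (D (e j)) = 0" "u j (D (e i)) = 0"
proof -
  show "u i (D (e j)) = 0" by (rule derivation_center[OF skew_derivationsD(2)[OF D] ij(2,3,1)])
  then show "u j (D (e i)) = 0" using skew_derivationsD(5)[OF D, of i j] ij p by simp
qed

text \<open>Here \<open>[x, y] = \<omega>(x, y) e 6\<close> with \<open>\<omega>\<close>
  nondegenerate on the complement, so the algebra is the 7-dimensional Heisenberg algebra and
  \<open>D (e 6) = 0\<close>. The separating functionals are the ten entries of \<open>D\<close> on
  \<open>e 1\<close>, ..., \<open>e 5\<close> and the number
  \<open>\<omega>(e 0, D (e 0))\<close>.\<close>

lemma dim_skew_heisenberg: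
  assumes p6: "p = 6" and nc: "\<And>x i. (\<And>y. br x y = 0) \<Longrightarrow> i < 6 \<Longrightarrow> u i x = 0"
  shows "dim (skew_derivations metric br) \<le> 11"
proof -
  define L :: "(nat \<times> nat) list" where "L = [(i, j). i \<leftarrow> [1..<6], j \<leftarrow> [Suc i..<6]]"
  have setL: "(i, j) \<in> set L \<longleftrightarrow> 1 \<le> i \<and> i < j \<and> j < 6" for i j
    unfolding L_def by force
  let ?I = "insert None (Some ` set L)"
  let ?f = "\<lambda>q D. case q of None \<Rightarrow> u 6 (br (e 0) (D (e 0))) | Some (i, j) \<Rightarrow> u j (D (e i))"
  have "dim (skew_derivations metric br) \<le> card ?I"
  proof (rule dim_le_functionals(2)[where f="?f"])
    show "finite ?I" by (intro finite.insertI finite_imageI finite_set)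
    show "subspace (skew_derivations metric br)" by (rule subspace_skew_derivations[OF bilinear_metric bil])
    show "linear (?f q)" if q: "q \<in> ?I" for q
    proof (cases q)
      case None
      have "linear (\<lambda>D :: 'a \<Rightarrow> 'a. u 6 (br (e 0) (D (e 0))))"
        using linear_compose[OF linear_compose[OF linear_apply[of "e 0"] br_lin(1)] linear_u[of 6]] by (simp add: o_def)
      then show ?thesis using None by simp
    next
      case (Some a)
      then obtain i j where "q = Some (i, j)" "(i, j) \<in> set L" using q by auto
      then have "q = Some (i, j)" "j < 7" by (simp_all add: setL)
      then show ?thesis using linear_coeff[of j "e i"] by simp
    qed
    fix D assume D: "D \<in> skew_derivations metric br" and 0: "\<And>q. q \<in> ?I \<Longrightarrow> ?f q D = 0"
    note D' = skew_derivationsD[OF D]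
    have m: "u j (D (e i)) = 0" if "1 \<le> i" "i < j" "j < 6" for i j
    proof -
      have "(i, j) \<in> set L" using that by (simp add: setL)
      then have "Some (i, j) \<in> ?I" by blast
      from 0[OF this] show ?thesis by simp
    qed
    have m': "u j (D (e i)) = 0" if "1 \<le> i" "1 \<le> j" "i < 6" "j < 6" for i j
      using m[of i j] m[of j i] D'(5)[of i j] that by (cases i j rule: linorder_cases) auto
    have d6: "D (e 6) = 0"
    proof (rule coords_eqI)
      fix i :: nat assume i: "i < 7"
      show "u i (D (e 6)) = u i 0"
        using skew_derivations_block(1)[OF D, of i 6] D'(5)[of 6 6] i p6 linear_0[OF linear_u[OF i]]
        by (cases "i = 6") auto
    qed
    have m6: "u 6 (D (e i)) = 0" if "i < 7" for i
      using D'(5)[of 6 i] that d6 linear_0[OF linear_u[OF that]] by simp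
    define w where "w = D (e 0)"
    have w0: "u 0 w = 0" using D'(5)[of 0 0] by (simp add: w_def)
    have Dj: "D (e j) = (- u j w) *\<^sub>R e 0" if j: "1 \<le> j" "j < 6" for j
    proof (rule coords_eqI)
      fix i :: nat assume i: "i < 7"
      consider "i = 0" | "1 \<le> i" "i < 6" | "i = 6" using i by linarith
      then show "u i (D (e j)) = u i ((- u j w) *\<^sub>R e 0)"
      proof cases
        case 1
        then show ?thesis using D'(5)[of 0 j] j u_e[of 0 0] by (simp add: w_def linear_neg[OF linear_u] linear_scale[OF linear_u])
      next
        case 2
        then show ?thesis using m'[of j i] j u_e[of i 0] i by (simp add: linear_neg[OF linear_u] linear_scale[OF linear_u])
      next
        case 3
        then show ?thesis using m6[of j] j u_e[of i 0] i by (simp add: linear_neg[OF linear_u] linear_scale[OF linear_u])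
      qed
    qed
    have "None \<in> ?I" by blast
    from 0[OF this] have b6: "u 6 (br (e 0) w) = 0" by (simp add: w_def)
    have bw: "br (e 0) w = 0"
    proof (rule coords_eqI)
      fix i :: nat assume i: "i < 7"
      show "u i (br (e 0) w) = u i 0"
        using br_coord[of i "e 0" w] b6 i p6 linear_0[OF linear_u[OF i]] by (cases "i = 6") auto
    qed
    have DZ: "D (br x y) = 0" for x y
    proof -
      have "D (br x y) = (\<Sum>l<7. u l (br x y) *\<^sub>R D (e l))" by (rule linear_expand[OF D'(1)])
      also have "\<dots> = 0"
      proof (rule sum.neutral, rule ballI)
        fix l :: nat assume "l \<in> {..<7}"
        then show "u l (br x y) *\<^sub>R D (e l) = 0"
          using br_coord[of l x y] d6 p6 by (cases "l = 6") auto
      qed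
      finally show ?thesis .
    qed
    have bwj: "br w (e j) = 0" if j7: "j < 7" for j
    proof -
      consider "j = 0" | "1 \<le> j" "j < 6" | "j = 6" using j7 by linarith
      then show ?thesis
      proof cases
        case 1
        then show ?thesis using br_swap[of w "e 0"] bw by simp
      next
        case 2
        \<comment> \<open>\<open>D\<close> annihilates brackets, and \<open>D (e j)\<close> is a
          multiple of \<open>e 0\<close>; the Leibniz rule for \<open>[e 0, e j]\<close> thus leaves
          only \<open>[w, e j] = 0\<close>.\<close>
        have "0 = br w (e j) + br (e 0) (D (e j))"
          using DZ[of "e 0" "e j"] D'(3)[of "e 0" "e j"] by (simp add: w_def)
        also have "br (e 0) (D (e j)) = 0"
          unfolding Dj[OF 2] linear_scale[OF br_lin(1)] br_self by simp
        finally show ?thesis by simp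
      next
        case 3
        then show ?thesis using central_right[of 6 w] p6 by simp
      qed
    qed
    have "br w y = 0" for y
    proof -
      have "br w y = (\<Sum>j<7. u j y *\<^sub>R br w (e j))" by (rule linear_expand[OF br_lin(1)])
      then show ?thesis using bwj by simp
    qed
    then have wi: "u i w = 0" if "i < 7" for i
      using nc[of w i] m6[of 0] that by (cases "i = 6") (auto simp: w_def)
    have "D (e j) = 0" if j7: "j < 7" for j
    proof -
      consider "j = 0" | "1 \<le> j" "j < 6" | "j = 6" using j7 by linarith
      then show ?thesis
      proof cases
        case 1
        have "w = 0" using wi linear_0[OF linear_u] by (intro coords_eqI) simp
        then show ?thesis using 1 by (simp add: w_def)
      next
        case 2
        then show ?thesis using Dj[OF 2] wi[of j] by simp
      qed (use d6 in simp)
    qed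
    then have "D = (\<lambda>x. 0)" using D'(1) by (intro linear_eqI) (auto simp: linear_zero)
    then show "D = 0" by (simp only: zero_fun_def)
  qed
  also have "card ?I \<le> Suc (card (Some ` set L))" by (simp add: card_insert_if)
  also have "card (Some ` set L) \<le> length L" using card_image_le[of "set L" Some] card_length[of L] by simp
  also have "length L = 10" by (simp add: L_def upt_rec)
  finally show ?thesis by simp
qed

end

text \<open>The Lie algebra so(3) has no 2-dimensional subalgebra: in a plane orthogonal to
  \<open>a\<close>, closure under the product applied to \<open>x\<close> and
  \<open>a \<times> x\<close> yields a multiple of the normal \<open>a\<close>.\<close>

lemma cross3_closed_subspace:
  fixes S :: "(real ^ 3) set"
  assumes S: "subspace S" "2 \<le> dim S" and cl: "\<And>x y. x \<in> S \<Longrightarrow> y \<in> S \<Longrightarrow> cross3 x y \<in> S"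
  shows "S = UNIV"
proof (rule ccontr)
  assume "S \<noteq> UNIV"
  then have "dim S \<noteq> DIM(real ^ 3)" using S(1) dim_eq_full[of S] by (metis span_eq_iff)
  then have lt: "dim S < DIM(real ^ 3)" using dim_subset_UNIV[of S] by simp
  obtain a where a: "a \<noteq> 0" "span S \<subseteq> {x. a \<bullet> x = 0}" using lowdim_subset_hyperplane[OF lt] by auto
  have "S = {x. a \<bullet> x = 0}"
  proof (rule subspace_dim_equal[OF S(1) subspace_hyperplane])
    show "S \<subseteq> {x. a \<bullet> x = 0}" using a(2) span_superset by blast
    show "dim {x. a \<bullet> x = 0} \<le> dim S" using dim_hyperplane[OF a(1)] S(2) by simp
  qed
  note Seq = this
  have "S \<noteq> {0}" using S(2) by auto
  then obtain x where x: "x \<in> S" "x \<noteq> 0" using S(1) subspace_0 by blast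
  have "cross3 a x \<in> S" unfolding Seq by (simp add: dot_cross_self)
  then have "cross3 x (cross3 a x) \<in> S" using cl x by blast
  moreover have "cross3 x (cross3 a x) = (x \<bullet> x) *\<^sub>R a - (x \<bullet> a) *\<^sub>R x" by (rule Lagrange)
  moreover have "x \<bullet> a = 0" using x Seq by (simp add: inner_commute)
  ultimately have "a \<bullet> ((x \<bullet> x) *\<^sub>R a) = 0" using Seq by auto
  then show False using a(1) x(2) by simp
qed

section \<open>Codimension four: skew derivations inside so(4)\<close>

context two_step_frame
begin

text \<open>The self-dual (\<open>s = 1\<close>) and anti-self-dual (\<open>s = -1\<close>)
  component of \<open>D\<close> restricted to the span of \<open>e 0\<close>, ...,
  \<open>e 3\<close>, that is, its parts in the two so(3) factors of so(4).\<close>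

definition so4_part :: "real \<Rightarrow> ('a \<Rightarrow> 'a) \<Rightarrow> real ^ 3" where
  "so4_part s D = vector [u 1 (D (e 0)) + s * u 3 (D (e 2)),
     u 2 (D (e 0)) - s * u 3 (D (e 1)), u 3 (D (e 0)) + s * u 2 (D (e 1))]"

lemma so4_part_nth:
  "so4_part s D $ 1 = u 1 (D (e 0)) + s * u 3 (D (e 2))"
  "so4_part s D $ 2 = u 2 (D (e 0)) - s * u 3 (D (e 1))"
  "so4_part s D $ 3 = u 3 (D (e 0)) + s * u 2 (D (e 1))"
  by (simp_all add: so4_part_def)

lemma linear_so4_part: "linear (so4_part s)"
  by (rule linearI)
    (auto simp: vec_eq_iff forall_3 so4_part_nth linear_add[OF linear_u] linear_scale[OF linear_u] algebra_simps)

text \<open>The two parts determine \<open>D\<close> on the complement, and the derived algebra is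
  generated by brackets of the complement.\<close>

lemma skew_zero_of_so4:
  assumes p4: "p = 4" and D: "D \<in> skew_derivations metric br" and s: "s = 1 \<or> s = -1"
    and 0: "so4_part s D = 0" "so4_part (- s) D = 0"
  shows "D = 0"
proof -
  note D' = skew_derivationsD[OF D]
  have z: "u 1 (D (e 0)) = 0" "u 2 (D (e 0)) = 0" "u 3 (D (e 0)) = 0"
    "u 3 (D (e 2)) = 0" "u 3 (D (e 1)) = 0" "u 2 (D (e 1)) = 0"
    using 0 s by (auto simp: vec_eq_iff forall_3 so4_part_nth)
  have "u i (D (e j)) = 0" if "i < 4" "j < 4" for i j
  proof -
    have "i \<in> {0,1,2,3}" "j \<in> {0,1,2,3}" using that by auto
    then show ?thesis
      using z D'(5)[of 0 0] D'(5)[of 1 1] D'(5)[of 2 2] D'(5)[of 3 3] D'(5)[of 0 1] D'(5)[of 0 2] D'(5)[of 0 3]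
        D'(5)[of 1 2] D'(5)[of 1 3] D'(5)[of 2 3] by auto
  qed
  then have ui: "u i (D (e j)) = 0" if "i < 4" "j < 7" for i j
    using skew_derivations_block(1)[OF D, of i j] that p4 by (cases "j < 4") auto
  have De: "D (e j) = 0" if j: "j < 4" for j
  proof (rule coords_eqI)
    fix i :: nat assume i: "i < 7"
    show "u i (D (e j)) = u i 0"
      using ui[of i j] skew_derivations_block(2)[OF D, of j i] j i p4 linear_0[OF linear_u[OF i]]
      by (cases "i < 4") auto
  qed
  have uD: "u i (D x) = 0" if i: "i < p" for i x
  proof -
    have "u i (D x) = (\<Sum>j<7. u j x *\<^sub>R u i (D (e j)))"
      using linear_expand[OF linear_compose[OF D'(1) linear_u], of i x] i p by (simp add: o_def)
    then show ?thesis using ui i p4 by simp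
  qed
  have "{br x y |x y. True} \<subseteq> {z. D z = 0}"
    using br_central(1)[OF uD] br_central(2)[OF uD] D'(3) by auto
  then have "span {br x y |x y. True} \<subseteq> {z. D z = 0}"
    by (rule span_minimal) (rule subspace_zero_set[OF D'(1)])
  then have De2: "D (e j) = 0" if "4 \<le> j" "j < 7" for j using generated[of j] p4 that by auto
  have "D = (\<lambda>x. 0)"
  proof (rule linear_eqI[OF D'(1) linear_zero])
    show "D (e i) = 0" if "i < 7" for i using De De2 that by (cases "i < 4") auto
  qed
  then show ?thesis by (simp only: zero_fun_def)
qed

lemma commutator_skew:
  assumes D: "D \<in> skew_derivations metric br" and F: "F \<in> skew_derivations metric br"
  shows "(\<lambda>x. D (F x) - F (D x)) \<in> skew_derivations metric br"
proof -
  note D' = skew_derivationsD[OF D] and F' = skew_derivationsD[OF F]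
  have "linear (\<lambda>x. D (F x) - F (D x))"
    using linear_compose_sub[OF linear_compose[OF F'(1) D'(1)] linear_compose[OF D'(1) F'(1)]] by (simp add: o_def)
  moreover have "D (F (br x y)) - F (D (br x y)) = br (D (F x) - F (D x)) y + br x (D (F y) - F (D y))" for x y
    by (simp add: D'(3) F'(3) linear_add[OF D'(1)] linear_add[OF F'(1)] bilinear_lsub[OF bil] bilinear_rsub[OF bil])
  moreover have "metric (D (F x) - F (D x)) y = - metric x (D (F y) - F (D y))" for x y
    using D'(4)[of "F x" y] F'(4)[of x "D y"] F'(4)[of "D x" y] D'(4)[of x "F y"]
    by (simp add: bilinear_lsub[OF bilinear_metric] bilinear_rsub[OF bilinear_metric])
  ultimately show ?thesis by (simp add: skew_derivations_def derivations_def)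
qed

text \<open>The Lie bracket of a factor so(3) is the cross product, up to the sign
  \<open>s\<close>.\<close>

lemma so4_part_commutator:
  assumes p4: "p = 4" and s: "s = 1 \<or> s = -1"
    and D: "D \<in> skew_derivations metric br" "so4_part (- s) D = 0"
    and F: "F \<in> skew_derivations metric br" "so4_part (- s) F = 0"
  shows "so4_part s (\<lambda>x. D (F x) - F (D x)) = s *\<^sub>R cross3 (so4_part s D) (so4_part s F)"
    "so4_part (- s) (\<lambda>x. D (F x) - F (D x)) = 0"
proof -
  note D' = skew_derivationsD[OF D(1)] and F' = skew_derivationsD[OF F(1)]
  have comp: "u j (A (B (e i))) = u 0 (B (e i)) * u j (A (e 0)) + u 1 (B (e i)) * u j (A (e 1))
      + u 2 (B (e i)) * u j (A (e 2)) + u 3 (B (e i)) * u j (A (e 3))"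
    if A: "A \<in> skew_derivations metric br" and B: "B \<in> skew_derivations metric br" and ij: "i < 4" "j < 4" for A B i j
  proof -
    have "u j (A (B (e i))) = (\<Sum>k<7. u k (B (e i)) *\<^sub>R u j (A (e k)))"
      using linear_expand[OF linear_compose[OF skew_derivationsD(1)[OF A] linear_u], of j "B (e i)"] ij by (simp add: o_def)
    moreover have "u 4 (B (e i)) = 0" "u 5 (B (e i)) = 0" "u 6 (B (e i)) = 0"
      using skew_derivations_block(2)[OF B, of i] ij p4 by auto
    ultimately show ?thesis by (simp add: sum7)
  qed
  have rel: "u 3 (A (e 2)) = s * u 1 (A (e 0))" "u 3 (A (e 1)) = - s * u 2 (A (e 0))" "u 2 (A (e 1)) = s * u 3 (A (e 0))"
    "u 0 (A (e 0)) = 0" "u 1 (A (e 1)) = 0" "u 2 (A (e 2)) = 0" "u 3 (A (e 3)) = 0"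
    "u 0 (A (e 1)) = - u 1 (A (e 0))" "u 0 (A (e 2)) = - u 2 (A (e 0))" "u 0 (A (e 3)) = - u 3 (A (e 0))"
    "u 1 (A (e 2)) = - s * u 3 (A (e 0))" "u 1 (A (e 3)) = s * u 2 (A (e 0))" "u 2 (A (e 3)) = - s * u 1 (A (e 0))"
    if A: "A \<in> skew_derivations metric br" "so4_part (- s) A = 0" for A
  proof -
    note A' = skew_derivationsD(5)[OF A(1)]
    show r: "u 3 (A (e 2)) = s * u 1 (A (e 0))" "u 3 (A (e 1)) = - s * u 2 (A (e 0))" "u 2 (A (e 1)) = s * u 3 (A (e 0))"
      using A(2) s by (auto simp: vec_eq_iff forall_3 so4_part_nth)
    show "u 0 (A (e 0)) = 0" "u 1 (A (e 1)) = 0" "u 2 (A (e 2)) = 0" "u 3 (A (e 3)) = 0"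
      using A'[of 0 0] A'[of 1 1] A'[of 2 2] A'[of 3 3] by auto
    show "u 0 (A (e 1)) = - u 1 (A (e 0))" "u 0 (A (e 2)) = - u 2 (A (e 0))" "u 0 (A (e 3)) = - u 3 (A (e 0))"
      using A'[of 0 1] A'[of 0 2] A'[of 0 3] by auto
    show "u 1 (A (e 2)) = - s * u 3 (A (e 0))" "u 1 (A (e 3)) = s * u 2 (A (e 0))" "u 2 (A (e 3)) = - s * u 1 (A (e 0))"
      using A'[of 1 2] A'[of 1 3] A'[of 2 3] r by auto
  qed
  note rD = rel[OF D] and rF = rel[OF F]
  show "so4_part s (\<lambda>x. D (F x) - F (D x)) = s *\<^sub>R cross3 (so4_part s D) (so4_part s F)"
    using s by (auto simp: vec_eq_iff forall_3 so4_part_nth cross3_def linear_diff[OF linear_u] comp[OF D(1) F(1)] comp[OF F(1) D(1)]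
       rD rF algebra_simps simp del: One_nat_def)
  show "so4_part (- s) (\<lambda>x. D (F x) - F (D x)) = 0"
    using s by (auto simp: vec_eq_iff forall_3 so4_part_nth linear_diff[OF linear_u] comp[OF D(1) F(1)] comp[OF F(1) D(1)]
       rD rF algebra_simps simp del: One_nat_def)
qed

text \<open>Killing the three components of one part leaves dimension at least 5 - 3 = 2. The other
  part embeds what is left as a subspace closed under the cross product, which is then everything.
  Hence both factors so(3) act by derivations.\<close>

lemma so4_part_surj:
  assumes p4: "p = 4" and s: "s = 1 \<or> s = -1" and big: "5 \<le> dim (skew_derivations metric br)"
  shows "\<exists>D\<in>skew_derivations metric br. so4_part s D = v \<and> so4_part (- s) D = 0"
proof -
  let ?K = "skew_derivations metric br"
  let ?Ks = "{D \<in> ?K. \<forall>i\<in>UNIV. so4_part (- s) D $ i = 0}"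
  have Ks: "?Ks = {D \<in> ?K. so4_part (- s) D = 0}" by (auto simp: vec_eq_iff)
  have sub: "subspace ?K" by (rule subspace_skew_derivations[OF bilinear_metric bil])
  have fd: "fin_dim ?K"
    by (rule fin_dim_subset[OF fin_dim_derivations[OF frame7_axioms bil]]) (auto simp: skew_derivations_def)
  have "linear (\<lambda>D. so4_part (- s) D $ i)" for i
    using linear_compose[OF linear_so4_part bounded_linear.linear[OF bounded_linear_vec_nth]] by (simp add: o_def)
  then have "dim ?K \<le> dim ?Ks + card (UNIV :: 3 set)"
    by (intro dim_common_kernel_ge sub fd) auto
  then have dKs: "2 \<le> dim ?Ks" using big by simp
  have subKs: "subspace ?Ks" unfolding Ks using sub linear_so4_part[of "- s"]
    by (auto simp: real_vector.subspace_def linear_0 linear_add linear_scale)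
  have fdKs: "fin_dim ?Ks" by (rule fin_dim_subset[OF fd]) auto
  let ?S = "so4_part s ` ?Ks"
  have ker: "{D \<in> ?Ks. so4_part s D = 0} \<subseteq> span {}"
    using skew_zero_of_so4[OF p4 _ s] unfolding Ks by auto
  have "dim {D \<in> ?Ks. so4_part s D = 0} = 0" using real_vector.dim_le_card[OF ker] by simp
  then have "2 \<le> dim ?S" using rank_nullity_fin(1)[OF linear_so4_part subKs fdKs, of s] dKs by simp
  moreover have subS: "subspace ?S" by (rule subspace_linear_image[OF linear_so4_part subKs])
  moreover have "cross3 x y \<in> ?S" if xy: "x \<in> ?S" "y \<in> ?S" for x y
  proof -
    obtain D F where D: "D \<in> ?K" "so4_part (- s) D = 0" "x = so4_part s D"
      and F: "F \<in> ?K" "so4_part (- s) F = 0" "y = so4_part s F" using xy unfolding Ks by blast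
    let ?G = "\<lambda>x. D (F x) - F (D x)"
    have "?G \<in> ?Ks" unfolding Ks
      using commutator_skew[OF D(1) F(1)] so4_part_commutator(2)[OF p4 s D(1,2) F(1,2)] by blast
    then have "s *\<^sub>R so4_part s ?G \<in> ?S" using subS by (intro subspace_scale) auto
    moreover have "s *\<^sub>R so4_part s ?G = cross3 x y"
      unfolding so4_part_commutator(1)[OF p4 s D(1,2) F(1,2)] D(3) F(3) using s by auto
    ultimately show ?thesis by simp
  qed
  ultimately have "?S = UNIV" by (intro cross3_closed_subspace)
  then have "v \<in> ?S" by simp
  then show ?thesis unfolding Ks by auto
qed

end

lemma ce_d_list3: "ce_d br \<alpha> [a, b, c] = - \<alpha> [br a b, c] + \<alpha> [br a c, b] - \<alpha> [br b c, a]"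
proof -
  have "{(i, j). i < j \<and> j < length [a, b, c]} = {(0,1),(0,2),(1,2)}"
    by (rule set_eqI, clarify, simp only: mem_Collect_eq prod.case insert_iff empty_iff prod.inject list.size, presburger)
  then show ?thesis unfolding ce_d_def by (simp only:) (simp add: nths_Cons)
qed

lemma ce_d_list4: "ce_d br \<alpha> [a, b, c, d] =
    - \<alpha> [br a b, c, d] + \<alpha> [br a c, b, d] - \<alpha> [br a d, b, c]
    - \<alpha> [br b c, a, d] + \<alpha> [br b d, a, c] - \<alpha> [br c d, a, b]"
proof -
  have "{(i, j). i < j \<and> j < length [a, b, c, d]} = {(0,1),(0,2),(0,3),(1,2),(1,3),(2,3)}"
    by (rule set_eqI, clarify, simp only: mem_Collect_eq prod.case insert_iff empty_iff prod.inject list.size, presburger)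
  then show ?thesis unfolding ce_d_def by (simp only:) (simp add: nths_Cons)
qed

lemma ce_d_list5: "ce_d br \<alpha> [a, b, c, d, f] =
    - \<alpha> [br a b, c, d, f] + \<alpha> [br a c, b, d, f] - \<alpha> [br a d, b, c, f] + \<alpha> [br a f, b, c, d]
    - \<alpha> [br b c, a, d, f] + \<alpha> [br b d, a, c, f] - \<alpha> [br b f, a, c, d]
    - \<alpha> [br c d, a, b, f] + \<alpha> [br c f, a, b, d] - \<alpha> [br d f, a, b, c]"
proof -
  have "{(i, j). i < j \<and> j < length [a, b, c, d, f]} = {(0,1),(0,2),(0,3),(0,4),(1,2),(1,3),(1,4),(2,3),(2,4),(3,4)}"
    by (rule set_eqI, clarify, simp only: mem_Collect_eq prod.case insert_iff empty_iff prod.inject list.size, presburger)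
  then show ?thesis unfolding ce_d_def by (simp only:) (simp add: nths_Cons)
qed

lemma nths_in_splits: "A \<subseteq> {..<length xs} \<Longrightarrow> \<exists>s r. (s, nths xs A, r) \<in> set (splits xs)"
proof (induction xs arbitrary: A)
  case (Cons x xs)
  have "{j. Suc j \<in> A} \<subseteq> {..<length xs}" using Cons.prems by auto
  from Cons.IH[OF this] obtain s r where "(s, nths xs {j. Suc j \<in> A}, r) \<in> set (splits xs)" by blast
  then show ?case by (cases "0 \<in> A") (force simp: nths_Cons)+
qed simp

text \<open>An explicit enumeration of the basis arguments, so that the vanishing of a form becomes
  a finite conjunction for the simplifier.\<close>

definition increasing_lists :: "nat \<Rightarrow> nat list list" where
  "increasing_lists k = [l. (s, l, r) \<leftarrow> splits [0,1,2,3,4,5,6], length l = k]"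

lemma increasing_lists_5: "increasing_lists 5 = [[0,1,2,3,4],[0,1,2,3,5],[0,1,2,3,6],[0,1,2,4,5],[0,1,2,4,6],[0,1,2,5,6],
  [0,1,3,4,5],[0,1,3,4,6],[0,1,3,5,6],[0,1,4,5,6],[0,2,3,4,5],[0,2,3,4,6],[0,2,3,5,6],[0,2,4,5,6],[0,3,4,5,6],
  [1,2,3,4,5],[1,2,3,4,6],[1,2,3,5,6],[1,2,4,5,6],[1,3,4,5,6],[2,3,4,5,6]]"
  by code_simp

lemma increasing_lists_4: "increasing_lists 4 = [[0,1,2,3],[0,1,2,4],[0,1,2,5],[0,1,2,6],[0,1,3,4],[0,1,3,5],[0,1,3,6],
  [0,1,4,5],[0,1,4,6],[0,1,5,6],[0,2,3,4],[0,2,3,5],[0,2,3,6],[0,2,4,5],[0,2,4,6],[0,2,5,6],[0,3,4,5],[0,3,4,6],[0,3,5,6],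
  [0,4,5,6],[1,2,3,4],[1,2,3,5],[1,2,3,6],[1,2,4,5],[1,2,4,6],[1,2,5,6],[1,3,4,5],[1,3,4,6],[1,3,5,6],[1,4,5,6],
  [2,3,4,5],[2,3,4,6],[2,3,5,6],[2,4,5,6],[3,4,5,6]]"
  by code_simp

lemma increasing_lists_3: "increasing_lists 3 = [[0,1,2],[0,1,3],[0,1,4],[0,1,5],[0,1,6],[0,2,3],[0,2,4],[0,2,5],[0,2,6],
  [0,3,4],[0,3,5],[0,3,6],[0,4,5],[0,4,6],[0,5,6],[1,2,3],[1,2,4],[1,2,5],[1,2,6],[1,3,4],[1,3,5],[1,3,6],[1,4,5],[1,4,6],
  [1,5,6],[2,3,4],[2,3,5],[2,3,6],[2,4,5],[2,4,6],[2,5,6],[3,4,5],[3,4,6],[3,5,6],[4,5,6]]"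
  by code_simp

lemma (in frame7) form_zero_lists:
  assumes "\<alpha> \<in> alt_forms k" "\<forall>l\<in>set (increasing_lists k). \<alpha> (map e l) = 0"
  shows "\<alpha> = 0"
proof (rule form_zero_nths[OF assms(1)])
  fix A :: "nat set" assume A: "A \<subseteq> {..<7}" "card A = k"
  have "A \<subseteq> {..<length [0..<7]}" using A(1) by (simp only: length_upt diff_zero)
  from nths_in_splits[OF this] obtain s r where "(s, nths [0..<7] A, r) \<in> set (splits [0..<7])" by blast
  moreover have "length (nths [0..<7] A) = k" using length_nths_upt[OF A(1)] A(2) by simp
  ultimately have "nths [0..<7] A \<in> set (increasing_lists k)"
    unfolding increasing_lists_def upt7[symmetric] set_concat set_map by fastforce
  then show "\<alpha> (nths E A) = 0" using assms(2) by (simp add: nths_E)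
qed

lemma (in frame7) psi_basis:
  "i < 7 \<Longrightarrow> j < 7 \<Longrightarrow> k < 7 \<Longrightarrow> l < 7 \<Longrightarrow> psi [e i, e j, e k, e l] = of_int (form_coeff psi_terms [i, j, k, l])"
  using psi_map[of "[i, j, k, l]"] by simp

lemma (in frame7) psi_head:
  "psi (0 # xs) = 0" "psi (c *\<^sub>R x # xs) = c * psi (x # xs)" "psi ((- x) # xs) = - psi (x # xs)"
  using linear_0[OF alt_linear_head[OF psi_alt]] linear_scale[OF alt_linear_head[OF psi_alt]]
    linear_neg[OF alt_linear_head[OF psi_alt]] by auto

section \<open>Brackets on self-dual and anti-self-dual bivectors\<close>

context two_step_frame
begin

lemma so4_values:
  assumes p4: "p = 4" and s: "s = 1 \<or> s = -1" and D: "D \<in> skew_derivations metric br"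
    and v: "so4_part s D = vector [2 * a, 2 * b, 2 * c]" "so4_part (- s) D = 0"
  shows "D (e 0) = a *\<^sub>R e 1 + b *\<^sub>R e 2 + c *\<^sub>R e 3"
    "D (e 1) = (- a) *\<^sub>R e 0 + (s * c) *\<^sub>R e 2 + (- s * b) *\<^sub>R e 3"
    "D (e 2) = (- b) *\<^sub>R e 0 + (- s * c) *\<^sub>R e 1 + (s * a) *\<^sub>R e 3"
    "D (e 3) = (- c) *\<^sub>R e 0 + (s * b) *\<^sub>R e 1 + (- s * a) *\<^sub>R e 2"
proof -
  note D' = skew_derivationsD(5)[OF D]
  have z: "u 1 (D (e 0)) = a" "u 2 (D (e 0)) = b" "u 3 (D (e 0)) = c"
    "u 3 (D (e 2)) = s * a" "u 3 (D (e 1)) = - s * b" "u 2 (D (e 1)) = s * c"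
    using v s by (auto simp: vec_eq_iff forall_3 so4_part_nth)
  have w: "u 0 (D (e 0)) = 0" "u 1 (D (e 1)) = 0" "u 2 (D (e 2)) = 0" "u 3 (D (e 3)) = 0"
    "u 0 (D (e 1)) = - a" "u 0 (D (e 2)) = - b" "u 0 (D (e 3)) = - c"
    "u 1 (D (e 2)) = - s * c" "u 1 (D (e 3)) = s * b" "u 2 (D (e 3)) = - s * a"
    using D'[of 0 0] D'[of 1 1] D'[of 2 2] D'[of 3 3] D'[of 0 1] D'[of 0 2] D'[of 0 3] D'[of 1 2] D'[of 1 3] D'[of 2 3] z
    by auto
  have big: "u 4 (D (e j)) = 0" "u 5 (D (e j)) = 0" "u 6 (D (e j)) = 0" if "j < 4" for j
    using skew_derivations_block(2)[OF D, of j] that p4 by auto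
  note bigs = big[of 0] big[of 1] big[of 2] big[of 3]
  have ex: "x = y" if "\<forall>i<7. u i x = u i y" for x y
    using that by (intro coords_eqI) auto
  have lin: "u i (x + y) = u i x + u i y" "u i (c *\<^sub>R x) = c * u i x" if "i < 7" for i x y c
    using linear_u[OF that] by (simp_all add: linear_add linear_scale)
  show "D (e 0) = a *\<^sub>R e 1 + b *\<^sub>R e 2 + c *\<^sub>R e 3"
    by (rule ex, unfold all_less_7) (simp add: lin u_e z w bigs del: One_nat_def scaleR_minus_left)
  show "D (e 1) = (- a) *\<^sub>R e 0 + (s * c) *\<^sub>R e 2 + (- s * b) *\<^sub>R e 3"
    by (rule ex, unfold all_less_7) (simp add: lin u_e z w bigs del: One_nat_def scaleR_minus_left)
  show "D (e 2) = (- b) *\<^sub>R e 0 + (- s * c) *\<^sub>R e 1 + (s * a) *\<^sub>R e 3"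
    by (rule ex, unfold all_less_7) (simp add: lin u_e z w bigs del: One_nat_def scaleR_minus_left)
  show "D (e 3) = (- c) *\<^sub>R e 0 + (s * b) *\<^sub>R e 1 + (- s * a) *\<^sub>R e 2"
    by (rule ex, unfold all_less_7) (simp add: lin u_e z w bigs del: One_nat_def scaleR_minus_left)
qed

text \<open>The bracket as a linear map on bivectors of the complement, evaluated on the standard
  basis \<open>e01 + s e23\<close>, \<open>e02 - s e13\<close>, \<open>e03 + s e12\<close> of the
  self-dual (\<open>s = 1\<close>) or anti-self-dual (\<open>s = -1\<close>) ones.\<close>

definition b1 :: "real \<Rightarrow> 'a" where "b1 s = br (e 0) (e 1) + s *\<^sub>R br (e 2) (e 3)"
definition b2 :: "real \<Rightarrow> 'a" where "b2 s = br (e 0) (e 2) - s *\<^sub>R br (e 1) (e 3)"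
definition b3 :: "real \<Rightarrow> 'a" where "b3 s = br (e 0) (e 3) + s *\<^sub>R br (e 1) (e 2)"

text \<open>The factor with sign \<open>s\<close> rotates the triple of the same sign and fixes the
  triple of the opposite sign.\<close>

lemma so4_action:
  assumes p4: "p = 4" and s: "s = 1 \<or> s = -1" and D: "D \<in> skew_derivations metric br"
    and v: "so4_part s D = vector [2 * a, 2 * b, 2 * c]" "so4_part (- s) D = 0"
  shows "D (b1 s) = (2 * s) *\<^sub>R (c *\<^sub>R b2 s - b *\<^sub>R b3 s)"
    "D (b2 s) = (2 * s) *\<^sub>R (a *\<^sub>R b3 s - c *\<^sub>R b1 s)"
    "D (b3 s) = (2 * s) *\<^sub>R (b *\<^sub>R b1 s - a *\<^sub>R b2 s)"
    "D (b1 (- s)) = 0" "D (b2 (- s)) = 0" "D (b3 (- s)) = 0"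
proof -
  note D' = skew_derivationsD[OF D]
  note val = so4_values[OF p4 s D v]
  note bl = bilinear_ladd[OF bil] bilinear_radd[OF bil] bilinear_lmul[OF bil] bilinear_rmul[OF bil]
    bilinear_lneg[OF bil] bilinear_rneg[OF bil] bilinear_lsub[OF bil] bilinear_rsub[OF bil]
  note sw = br_swap[of "e 1" "e 0"] br_swap[of "e 2" "e 0"] br_swap[of "e 3" "e 0"]
    br_swap[of "e 2" "e 1"] br_swap[of "e 3" "e 1"] br_swap[of "e 3" "e 2"]
  note all = b1_def b2_def b3_def linear_add[OF D'(1)] linear_diff[OF D'(1)] linear_scale[OF D'(1)]
     D'(3) val bl sw br_self scaleR_add_right scaleR_diff_right
  note ul = linear_add[OF linear_u] linear_diff[OF linear_u] linear_scale[OF linear_u] linear_neg[OF linear_u]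
  show "D (b1 s) = (2 * s) *\<^sub>R (c *\<^sub>R b2 s - b *\<^sub>R b3 s)"
    using s by (elim disjE; intro coords_eqI; simp add: all ul del: One_nat_def; simp add: algebra_simps del: One_nat_def)
  show "D (b2 s) = (2 * s) *\<^sub>R (a *\<^sub>R b3 s - c *\<^sub>R b1 s)"
    using s by (elim disjE; intro coords_eqI; simp add: all ul del: One_nat_def; simp add: algebra_simps del: One_nat_def)
  show "D (b3 s) = (2 * s) *\<^sub>R (b *\<^sub>R b1 s - a *\<^sub>R b2 s)"
    using s by (elim disjE; intro coords_eqI; simp add: all ul del: One_nat_def; simp add: algebra_simps del: One_nat_def)
  show "D (b1 (- s)) = 0" "D (b2 (- s)) = 0" "D (b3 (- s)) = 0"
    using s by (elim disjE; intro coords_eqI; simp add: all ul linear_0[OF linear_u] del: One_nat_def)+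
qed

text \<open>Skew derivations rotate every coordinate plane of the triple with sign \<open>s\<close>
  and annihilate the opposite triple. Skewness on well-chosen pairs then makes the triple orthogonal
  with equal lengths, and orthogonal to the other one.\<close>

lemma so4_orthogonality:
  assumes p4: "p = 4" and s: "s = 1 \<or> s = -1" and big: "5 \<le> dim (skew_derivations metric br)"
  shows "metric (b1 s) (b2 s) = 0" "metric (b1 s) (b3 s) = 0" "metric (b2 s) (b3 s) = 0"
    "metric (b2 s) (b2 s) = metric (b1 s) (b1 s)" "metric (b3 s) (b3 s) = metric (b1 s) (b1 s)"
    "metric (b1 s) (b1 (- s)) = 0" "metric (b2 s) (b1 (- s)) = 0" "metric (b3 s) (b1 (- s)) = 0"
proof -
  obtain D1 where D1: "D1 \<in> skew_derivations metric br" "so4_part s D1 = vector [2 * 1, 2 * 0, 2 * 0]" "so4_part (- s) D1 = 0"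
    using so4_part_surj[OF p4 s big, of "vector [2 * 1, 2 * 0, 2 * 0]"] by blast
  obtain D2 where D2: "D2 \<in> skew_derivations metric br" "so4_part s D2 = vector [2 * 0, 2 * 1, 2 * 0]" "so4_part (- s) D2 = 0"
    using so4_part_surj[OF p4 s big, of "vector [2 * 0, 2 * 1, 2 * 0]"] by blast
  obtain D3 where D3: "D3 \<in> skew_derivations metric br" "so4_part s D3 = vector [2 * 0, 2 * 0, 2 * 1]" "so4_part (- s) D3 = 0"
    using so4_part_surj[OF p4 s big, of "vector [2 * 0, 2 * 0, 2 * 1]"] by blast
  note a1 = so4_action[OF p4 s D1, simplified] and a2 = so4_action[OF p4 s D2, simplified]
    and a3 = so4_action[OF p4 s D3, simplified]
  note ml = bilinear_lmul[OF bilinear_metric] bilinear_rmul[OF bilinear_metric]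
    bilinear_lneg[OF bilinear_metric] bilinear_rneg[OF bilinear_metric]
    bilinear_lzero[OF bilinear_metric] bilinear_rzero[OF bilinear_metric]
  have sym: "metric x y = metric y x" for x y by (simp add: metric_def mult.commute)
  note k1 = skew_derivationsD(4)[OF D1(1)] and k2 = skew_derivationsD(4)[OF D2(1)] and k3 = skew_derivationsD(4)[OF D3(1)]
  show "metric (b1 s) (b2 s) = 0"
    using k3[of "b1 s" "b1 s"] sym[of "b1 s" "b2 s"] s by (auto simp: a3 ml)
  show "metric (b1 s) (b3 s) = 0"
    using k2[of "b1 s" "b1 s"] sym[of "b1 s" "b3 s"] s by (auto simp: a2 ml)
  show "metric (b2 s) (b3 s) = 0"
    using k1[of "b2 s" "b2 s"] sym[of "b2 s" "b3 s"] s by (auto simp: a1 ml)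
  show "metric (b2 s) (b2 s) = metric (b1 s) (b1 s)"
    using k3[of "b1 s" "b2 s"] s by (auto simp: a3 ml)
  show "metric (b3 s) (b3 s) = metric (b1 s) (b1 s)"
    using k2[of "b1 s" "b3 s"] s by (auto simp: a2 ml)
  show "metric (b1 s) (b1 (- s)) = 0"
    using k3[of "b2 s" "b1 (- s)"] s by (auto simp: a3 ml)
  show "metric (b2 s) (b1 (- s)) = 0"
    using k3[of "b1 s" "b1 (- s)"] s by (auto simp: a3 ml)
  show "metric (b3 s) (b1 (- s)) = 0"
    using k2[of "b1 s" "b1 (- s)"] s by (auto simp: a2 ml)
qed

lemma metric_zero: "metric x x = 0 \<Longrightarrow> x = 0"
  using scalar_product_metric unfolding scalar_product_def by (metis less_irrefl)

lemma dim_center_block: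
  "dim {z. \<forall>i<p. u i z = 0} \<le> 7 - p" "fin_dim {z. \<forall>i<p. u i z = 0}"
proof -
  have sub: "subspace {z. \<forall>i<p. u i z = 0}"
    using p by (auto simp: subspace_def linear_0[OF linear_u] linear_add[OF linear_u] linear_scale[OF linear_u])
  have z: "x = 0" if x: "x \<in> {z. \<forall>i<p. u i z = 0}" and 0: "\<And>i. i \<in> {p..<7} \<Longrightarrow> u i x = 0" for x
  proof (rule coords_eqI)
    fix i :: nat assume "i < 7"
    then show "u i x = u i 0" using x 0[of i] linear_0[OF linear_u[of i]] by (cases "i < p") auto
  qed
  have lin: "linear (u i)" if "i \<in> {p..<7}" for i using that linear_u by simp
  have "dim {z. \<forall>i<p. u i z = 0} \<le> card {p..<7}"
    by (rule dim_le_functionals(2)[where f=u, OF finite_atLeastLessThan sub lin z])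
  then show "dim {z. \<forall>i<p. u i z = 0} \<le> 7 - p" by simp
  show "fin_dim {z. \<forall>i<p. u i z = 0}"
    by (rule dim_le_functionals(1)[where f=u, OF finite_atLeastLessThan sub lin z])
qed

text \<open>One of the two triples must vanish for lack of room in the derived algebra. Its
  vanishing is the set of relations of the quaternionic Heisenberg algebra, where the brackets of
  the complement are the imaginary units.\<close>

lemma quaternionic_relations:
  assumes p4: "p = 4" and big: "5 \<le> dim (skew_derivations metric br)"
  shows "\<exists>s. (s = 1 \<or> s = -1) \<and> br (e 2) (e 3) = s *\<^sub>R br (e 0) (e 1) \<and>
    br (e 1) (e 3) = (- s) *\<^sub>R br (e 0) (e 2) \<and> br (e 1) (e 2) = s *\<^sub>R br (e 0) (e 3) \<and>
    metric (br (e 0) (e 1)) (br (e 0) (e 2)) = 0 \<and> metric (br (e 0) (e 1)) (br (e 0) (e 3)) = 0 \<and>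
    metric (br (e 0) (e 2)) (br (e 0) (e 3)) = 0 \<and>
    br (e 0) (e 1) \<noteq> 0 \<and> br (e 0) (e 2) \<noteq> 0 \<and> br (e 0) (e 3) \<noteq> 0"
proof -
  note oP = so4_orthogonality[OF p4 _ big, of 1, simplified] and oM = so4_orthogonality[OF p4 _ big, of "-1", simplified]
  have sym: "metric x y = metric y x" for x y by (simp add: metric_def mult.commute)
  \<comment> \<open>If both were non-zero, \<open>b1 1\<close>, \<open>b2 1\<close>,
    \<open>b3 1\<close> and \<open>b1 (- 1)\<close> would be four orthogonal non-zero vectors in a
    space of dimension 3.\<close>
  have "b1 1 = 0 \<or> b1 (- 1) = 0"
  proof (rule ccontr)
    assume "\<not> ?thesis"
    then have nz: "metric (b1 1) (b1 1) \<noteq> 0" "metric (b1 (-1)) (b1 (-1)) \<noteq> 0" using metric_zero by auto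
    define X where "X i = [b1 1, b2 1, b3 1, b1 (- 1)] ! i" for i :: nat
    have X: "X 0 = b1 1" "X 1 = b2 1" "X 2 = b3 1" "X 3 = b1 (- 1)" by (simp_all add: X_def)
    let ?f = "\<lambda>i y. metric (X i) y / metric (X i) (X i)"
    have "card {..<4::nat} \<le> dim {z. \<forall>i<p. u i z = 0}"
    proof (rule card_dual_family_le[where x=X and f="?f"])
      show "fin_dim {z. \<forall>i<p. u i z = 0}" by (rule dim_center_block(2))
      have bz: "u i (b1 s) = 0" "u i (b2 s) = 0" "u i (b3 s) = 0" if "i < p" for i s
        using br_coord[OF that] that p linear_u[of i]
        by (simp_all add: b1_def b2_def b3_def linear_add linear_diff linear_scale)
      show "X i \<in> {z. \<forall>i<p. u i z = 0}" if "i \<in> {..<4}" for i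
      proof -
        have "i = 0 \<or> i = 1 \<or> i = 2 \<or> i = 3" using that by auto
        then show ?thesis using bz X by auto
      qed
      show "linear (?f i)" for i
        using bilinear_metric unfolding bilinear_def by (auto intro!: linearI simp: linear_add linear_scale add_divide_distrib)
      show "?f i (X j) = (if i = j then 1 else 0)" if "i \<in> {..<4}" "j \<in> {..<4}" for i j
      proof -
        have "i = 0 \<or> i = 1 \<or> i = 2 \<or> i = 3" "j = 0 \<or> j = 1 \<or> j = 2 \<or> j = 3" using that by auto
        then show ?thesis using nz oP sym[of "b2 1" "b1 1"] sym[of "b3 1" "b1 1"] sym[of "b3 1" "b2 1"]
           sym[of "b1 (-1)" "b1 1"] sym[of "b1 (-1)" "b2 1"] sym[of "b1 (-1)" "b3 1"]
          by (elim disjE) (simp_all only: X, auto)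
      qed
    qed simp
    then show False using dim_center_block(1) p4 by simp
  qed
  then obtain t where t: "t = 1 \<or> t = -1" "b1 t = 0" by blast
  \<comment> \<open>The triple with sign \<open>t\<close> vanishes, so the surviving one carries the
    opposite sign; \<open>t * t = 1\<close> is used to solve for the brackets.\<close>
  define s where "s = - t"
  have s: "s = 1 \<or> s = -1" using t by (auto simp: s_def)
  have bt: "b2 t = 0" "b3 t = 0"
    using so4_orthogonality(4,5)[OF p4 t(1) big] t(2) metric_zero bilinear_lzero[OF bilinear_metric] by auto
  have rel: "br (e 2) (e 3) = s *\<^sub>R br (e 0) (e 1)" "br (e 1) (e 3) = (- s) *\<^sub>R br (e 0) (e 2)"
    "br (e 1) (e 2) = s *\<^sub>R br (e 0) (e 3)"
  proof -
    have "br (e 0) (e 1) = (- t) *\<^sub>R br (e 2) (e 3)" "br (e 0) (e 2) = t *\<^sub>R br (e 1) (e 3)"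
      "br (e 0) (e 3) = (- t) *\<^sub>R br (e 1) (e 2)"
      using t(2) bt by (simp_all add: b1_def b2_def b3_def eq_neg_iff_add_eq_0 del: One_nat_def)
    moreover have "t * t = 1" using t(1) by auto
    ultimately show "br (e 2) (e 3) = s *\<^sub>R br (e 0) (e 1)" "br (e 1) (e 3) = (- s) *\<^sub>R br (e 0) (e 2)"
      "br (e 1) (e 2) = s *\<^sub>R br (e 0) (e 3)" by (simp_all add: s_def)
  qed
  have bs: "b1 s = 2 *\<^sub>R br (e 0) (e 1)" "b2 s = 2 *\<^sub>R br (e 0) (e 2)" "b3 s = 2 *\<^sub>R br (e 0) (e 3)"
    unfolding b1_def b2_def b3_def rel using s by (auto simp: scaleR_2)
  note o = so4_orthogonality[OF p4 s big, unfolded bs bilinear_lmul[OF bilinear_metric] bilinear_rmul[OF bilinear_metric]]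
  have nz: "br (e 0) (e 1) \<noteq> 0"
  proof
    assume 0: "br (e 0) (e 1) = 0"
    then have "br (e 0) (e 2) = 0" "br (e 0) (e 3) = 0"
      using o(4,5) metric_zero bilinear_lzero[OF bilinear_metric] by auto
    then have z: "br (e i) (e j) = 0" if "i < 7" "j < 7" for i j
    proof (cases "4 \<le> i \<or> 4 \<le> j")
      case True
      then show ?thesis using central[of i "e j"] central_right[of j "e i"] that p4 by auto
    next
      case False
      then have "i = 0 \<or> i = 1 \<or> i = 2 \<or> i = 3" "j = 0 \<or> j = 1 \<or> j = 2 \<or> j = 3" by auto
      then show ?thesis
        using 0 \<open>br (e 0) (e 2) = 0\<close> \<open>br (e 0) (e 3) = 0\<close> rel br_self br_swap[of "e 1" "e 0"] br_swap[of "e 2" "e 0"]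
          br_swap[of "e 3" "e 0"] br_swap[of "e 2" "e 1"] br_swap[of "e 3" "e 1"] br_swap[of "e 3" "e 2"]
        by (elim disjE; simp del: One_nat_def)
    qed
    have "br x y = 0" for x y
    proof -
      have "br (e i) y = 0" if "i < 7" for i
        using linear_expand[OF br_lin(1), of "e i" y] z[OF that] by simp
      then show ?thesis using linear_expand[OF br_lin(2), of x y] by simp
    qed
    then have "{br x y |x y. True} = {0}" by auto
    then have "e 4 = 0" using generated[of 4] p4 by simp
    then show False using u_e[of 4 4] linear_0[OF linear_u[of 4]] by simp
  qed
  then have "metric (br (e 0) (e 1)) (br (e 0) (e 1)) \<noteq> 0" using metric_zero by blast
  then have "br (e 0) (e 2) \<noteq> 0" "br (e 0) (e 3) \<noteq> 0"
    using o(4,5) bilinear_lzero[OF bilinear_metric] by auto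
  then show ?thesis using s rel nz o(1,2,3) by (intro exI[of _ s]) simp
qed

end

section \<open>Comparison of orbit dimensions with the rank on 3-forms\<close>

lemma moduli_lt_betti:
  fixes br :: "'a::euclidean_space \<Rightarrow> 'a \<Rightarrow> 'a"
  assumes "DIM('a) = 7" "lie_bracket br" "nilpotent br" "\<psi> \<in> Vcc br"
    "int (dim (ce_d br ` alt_forms 3)) < orbit_dim br \<psi>"
  shows "moduli_dim br < int (betti br 3)"
proof -
  have bil: "bilinear br" using assms(2) by (simp add: lie_bracket_def)
  obtain e :: "nat \<Rightarrow> 'a" and u where f: "frame7 e u" using Vcc_adapted_frame[OF assms(1,4) subspace_UNIV] by blast
  have "moduli_dim br \<le> int (dim (closed_forms br 4)) - orbit_dim br \<psi>"
    by (rule moduli_dim_le[OF f bil assms(4)])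
  then show ?thesis using assms(5) unfolding nilpotent_betti(2)[OF assms(1-3)] by linarith
qed

text \<open>A central vector outside a hyperplane that contains all brackets spans a direct summand,
  complementary to that hyperplane.\<close>

lemma (in frame7) central_summand_decomposable:
  assumes bil: "bilinear br" and c: "\<And>y. br x y = 0" and i: "i < 7" "u i x \<noteq> 0" and br: "\<And>a b. u i (br a b) = 0"
  shows "decomposable br"
  unfolding decomposable_def
proof (intro exI conjI ballI)
  let ?U = "span {x}" and ?W = "{y. u i y = 0}"
  note lin = linear_u[OF i(1)]
  have U: "y \<in> ?U \<longleftrightarrow> (\<exists>k. y = k *\<^sub>R x)" for y by (auto simp: span_singleton)
  show "subspace ?U" by simp
  show "subspace ?W" by (rule subspace_zero_set[OF lin])
  show "?U \<noteq> {0}" using i(2) linear_0[OF lin] by (metis insertI1 singletonD span_base)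
  show "?W \<noteq> {0}"
  proof -
    obtain j :: nat where j: "j < 7" "i \<noteq> j" using that[of 0] that[of 1] by (cases "i = 0") auto
    then have "e j \<in> ?W" using u_e[OF i(1)] by simp
    moreover have "e j \<noteq> 0" using u_e[of j j] linear_0[OF linear_u[of j]] j by auto
    ultimately show ?thesis by blast
  qed
  show "?U \<inter> ?W = {0}" using i(2) linear_0[OF lin] by (auto simp: U linear_scale[OF lin])
  show "{a + w |a w. a \<in> ?U \<and> w \<in> ?W} = UNIV"
  proof -
    have "y \<in> {a + w |a w. a \<in> ?U \<and> w \<in> ?W}" for y
    proof -
      let ?a = "(u i y / u i x) *\<^sub>R x"
      have "y = ?a + (y - ?a)" "?a \<in> ?U" "y - ?a \<in> ?W"
        using i(2) by (auto simp: U linear_diff[OF lin] linear_scale[OF lin])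
      then show ?thesis by blast
    qed
    then show ?thesis by blast
  qed
  show "br a b \<in> ?U" if "a \<in> ?U" "b \<in> ?U" for a b
    using that c by (auto simp: U bilinear_lmul[OF bil] bilinear_rmul[OF bil])
  show "br a b \<in> ?W" if "a \<in> ?W" "b \<in> ?W" for a b using br by simp
  show "br a b = 0" if "a \<in> ?U" "b \<in> ?W" for a b
    using that c by (auto simp: U bilinear_lmul[OF bil])
qed

context two_step_frame
begin

lemma central_decomposable:
  assumes c: "\<And>y. br x y = 0" and i: "i < p" "u i x \<noteq> 0"
  shows "decomposable br"
  by (rule central_summand_decomposable[OF bil c _ i(2) br_coord[OF i(1)]]) (use i(1) p in simp)

definition index_pairs :: "(nat \<times> nat) list" where
  "index_pairs = [(i, j). i \<leftarrow> [0..<p], j \<leftarrow> [Suc i..<p]]"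

text \<open>The brackets of pairs of complement vectors span the derived algebra. This excludes
  codimensions below 4.\<close>

lemma center_dim_le: "7 - p \<le> length index_pairs"
proof -
  let ?S = "(\<lambda>(i, j). br (e i) (e j)) ` set index_pairs"
  have bij: "br (e i) (e j) \<in> span ?S" if ij: "i < 7" "j < 7" for i j
  proof (cases "p \<le> i \<or> p \<le> j")
    case True
    then have "br (e i) (e j) = 0" using central[of i "e j"] central_right[of j "e i"] ij by blast
    then show ?thesis by (simp add: span_zero)
  next
    case False
    have in1: "br (e i) (e j) \<in> ?S" if "i < j" "j < p" for i j
    proof -
      have "(i, j) \<in> set index_pairs" using that unfolding index_pairs_def by force
      then show ?thesis by force
    qed
    consider "i < j" | "j < i" | "i = j" by linarith
    then show ?thesis
    proof cases
      case 1
      then show ?thesis using in1[of i j] False by (intro span_base) auto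
    next
      case 2
      then have "- br (e j) (e i) \<in> span ?S" using in1[of j i] False by (intro span_neg span_base) auto
      then show ?thesis using br_swap[of "e i" "e j"] by simp
    next
      case 3
      then show ?thesis by (simp add: br_self span_zero)
    qed
  qed
  have "br x y \<in> span ?S" for x y
  proof -
    have "br x y = (\<Sum>i<7. u i x *\<^sub>R br (e i) y)" by (rule linear_expand[OF br_lin(2)])
    also have "\<dots> = (\<Sum>i<7. u i x *\<^sub>R (\<Sum>j<7. u j y *\<^sub>R br (e i) (e j)))"
      by (intro sum.cong refl arg_cong2[where f="(*\<^sub>R)"] linear_expand[OF br_lin(1)])
    also have "\<dots> \<in> span ?S" using bij by (intro span_sum span_scale) auto
    finally show ?thesis .
  qed
  then have "span {br x y |x y. True} \<subseteq> span ?S" by (intro span_minimal subspace_span) auto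
  then have sub: "e ` {p..<7} \<subseteq> span ?S" using generated by auto
  have "independent (e ` {p..<7})" by (rule independent_mono[OF e_independent(2)]) auto
  then have "card (e ` {p..<7}) \<le> card ?S" using independent_span_bound[OF _ _ sub] by simp
  moreover have "inj_on e {p..<7}" by (rule inj_on_subset[OF e_independent(1)]) auto
  then have "card (e ` {p..<7}) = 7 - p" by (simp add: card_image)
  moreover have "card ?S \<le> length index_pairs"
    by (rule order_trans[OF card_image_le[OF finite_set] card_length])
  ultimately show ?thesis by linarith
qed

text \<open>The basis of the round quaternionic metric is stretched in the direction
  \<open>e 0\<close>. If the new metric still had five independent skew derivations, the
  quaternionic relations would hold in the new frame, where the brackets of \<open>f 0\<close>,
  \<open>f 1\<close> and of \<open>f 2\<close>, \<open>f 3\<close> have different lengths.\<close>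

lemma better_psi:
  assumes p4: "p = 4" and big: "5 \<le> dim (skew_derivations metric br)"
  shows "\<exists>\<psi>\<in>Vcc br. 15 \<le> orbit_dim br \<psi>"
proof -
  obtain s where s: "s = 1 \<or> s = -1" and rel: "br (e 2) (e 3) = s *\<^sub>R br (e 0) (e 1)"
    "br (e 1) (e 3) = (- s) *\<^sub>R br (e 0) (e 2)" "br (e 1) (e 2) = s *\<^sub>R br (e 0) (e 3)"
    and orth: "metric (br (e 0) (e 1)) (br (e 0) (e 2)) = 0" "metric (br (e 0) (e 1)) (br (e 0) (e 3)) = 0"
    "metric (br (e 0) (e 2)) (br (e 0) (e 3)) = 0"
    and nz: "br (e 0) (e 1) \<noteq> 0" "br (e 0) (e 2) \<noteq> 0" "br (e 0) (e 3) \<noteq> 0"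
    using quaternionic_relations[OF p4 big] by blast
  \<comment> \<open>The factor 2 breaks the symmetry. The order of the brackets fits
    \<open>psi\<close>: in it the pairs 45, 46, 56 of central indices are multiplied by 2-forms on
    the pairings 01|23, 03|12 and 02|13.\<close>
  define f where "f i = [2 *\<^sub>R e 0, e 1, e 2, e 3, br (e 0) (e 2), - br (e 0) (e 3), br (e 0) (e 1)] ! i" for i :: nat
  have fv: "f 0 = 2 *\<^sub>R e 0" "f 1 = e 1" "f 2 = e 2" "f 3 = e 3" "f 4 = br (e 0) (e 2)"
    "f 5 = - br (e 0) (e 3)" "f 6 = br (e 0) (e 1)"
    by (simp_all add: f_def)
  have sym: "metric x y = metric y x" for x y by (simp add: metric_def mult.commute)
  note ml = bilinear_lmul[OF bilinear_metric] bilinear_rmul[OF bilinear_metric]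
    bilinear_lneg[OF bilinear_metric] bilinear_rneg[OF bilinear_metric]
  have me: "metric (e i) (e j) = (if i = j then 1 else 0)" if "i < 7" "j < 7" for i j
    using that by (simp add: metric_e u_e)
  have mz: "metric (e i) (br x y) = 0" "metric (br x y) (e i) = 0" if "i < 4" for i x y
    using that br_coord[of i x y] p4 by (simp_all add: metric_e)
  have off: "\<forall>i<7. \<forall>j<7. i \<noteq> j \<longrightarrow> metric (f i) (f j) = 0"
    unfolding all_less_7
    by (simp add: fv ml me mz orth sym[of "br (e 0) (e 2)" "br (e 0) (e 1)"] sym[of "br (e 0) (e 3)" "br (e 0) (e 1)"]
       sym[of "br (e 0) (e 3)" "br (e 0) (e 2)"] del: One_nat_def)
  have fnz: "\<forall>i<7. f i \<noteq> 0"
  proof -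
    have "e i \<noteq> 0" if "i < 7" for i using u_e[OF that that] linear_0[OF linear_u[OF that]] by auto
    then show ?thesis unfolding all_less_7 using nz by (simp add: fv del: One_nat_def)
  qed
  then have diag: "metric (f i) (f i) \<noteq> 0" if "i < 7" for i using metric_zero that by blast
  let ?g = "\<lambda>i y. metric (f i) y / metric (f i) (f i)"
  have ling: "linear (?g i)" for i
    using bilinear_metric unfolding bilinear_def by (auto intro!: linearI simp: linear_add linear_scale add_divide_distrib)
  have dual: "?g i (f j) = (if i = j then 1 else 0)" if "i < 7" "j < 7" for i j
    using off diag that by auto
  have inj: "inj_on f {..<7}" and ind: "independent (f ` {..<7})"
    using dual_family_independent[of "{..<7}" ?g f] ling dual by auto
  have "card (f ` {..<7}) = DIM('a)" using card_image[OF inj] DIM7 by simp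
  then have spn: "span (f ` {..<7}) = UNIV"
    using card_ge_dim_independent[of "f ` {..<7}" UNIV] ind by auto
  obtain v where v: "frame 7 f v" using frame_of_basis[OF inj ind spn] by blast
  interpret f: frame7 f v using v by (simp add: frame7_def)
  have vbr: "v i (br x y) = 0" if i: "i < 4" for i x y
  proof -
    have i7: "i < 7" using i by simp
    note lin = linear_u
    have v0: "v i (br (e 0) (e 2)) = 0" "v i (br (e 0) (e 3)) = 0" "v i (br (e 0) (e 1)) = 0"
      using f.u_e[OF i7, of 4] f.u_e[OF i7, of 5] f.u_e[OF i7, of 6] i
      by (auto simp: fv linear_neg[OF f.linear_u[OF i7]])
    have z: "v i (br (e a) (e b)) = 0" if "a < 7" "b < 7" for a b
    proof (cases "4 \<le> a \<or> 4 \<le> b")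
      case True
      then have "br (e a) (e b) = 0" using central[of a "e b"] central_right[of b "e a"] that p4 by auto
      then show ?thesis using linear_0[OF f.linear_u[OF i7]] by simp
    next
      case False
      then have "a = 0 \<or> a = 1 \<or> a = 2 \<or> a = 3" "b = 0 \<or> b = 1 \<or> b = 2 \<or> b = 3" by auto
      then show ?thesis
        using v0 rel br_self br_swap[of "e 1" "e 0"] br_swap[of "e 2" "e 0"]
          br_swap[of "e 3" "e 0"] br_swap[of "e 2" "e 1"] br_swap[of "e 3" "e 1"] br_swap[of "e 3" "e 2"]
          linear_0[OF f.linear_u[OF i7]] linear_neg[OF f.linear_u[OF i7]] linear_scale[OF f.linear_u[OF i7]]
        by (elim disjE; simp del: One_nat_def)
    qed
    have l2: "linear (\<lambda>x. v i (br x y))" "linear (\<lambda>y. v i (br x y))" for x y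
      using linear_compose[OF br_lin(2) f.linear_u[OF i7]] linear_compose[OF br_lin(1) f.linear_u[OF i7]]
      by (auto simp: o_def)
    have "v i (br (e a) y) = 0" if "a < 7" for a
      using linear_expand[OF l2(2)[where x="e a"], of y] z[OF that] by simp
    then show ?thesis using linear_expand[OF l2(1)[where y=y], of x] by simp
  qed
  have fZ: "f j \<in> {br x y |x y. True} \<union> {- br x y |x y. True}" if "4 \<le> j" "j < 7" for j
  proof -
    have "j = 4 \<or> j = 5 \<or> j = 6" using that by auto
    then show ?thesis unfolding Un_iff mem_Collect_eq using fv(5-7) by metis
  qed
  interpret q: two_step_frame f v br 4
  proof unfold_locales
    show "lie_bracket br" by (rule lie)
    show "v i (br x y) = 0" if "i < 4" for i x y by (rule vbr[OF that])
    show "br (f j) x = 0" if j: "4 \<le> j" "j < 7" for j x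
    proof (rule br_central(1))
      fix i assume "i < p"
      then show "u i (f j) = 0" using fZ[OF j] br_coord[of i] linear_neg[OF linear_u, of i] p by auto
    qed
    have sp: "br x y \<in> span {br x y |x y. True}" for x y by (rule span_base) blast
    show "f j \<in> span {br x y |x y. True}" if j: "4 \<le> j" "j < 7" for j
      using fZ[OF j] sp span_neg[OF sp] by auto
  qed auto
  have fb: "br (f 0) (f 1) = 2 *\<^sub>R f 6" "br (f 2) (f 3) = s *\<^sub>R f 6" "br (f 0) (f 2) = 2 *\<^sub>R f 4"
    "br (f 1) (f 3) = (- s) *\<^sub>R f 4" "br (f 0) (f 3) = (- 2) *\<^sub>R f 5" "br (f 1) (f 2) = (- s) *\<^sub>R f 5"
    by (simp_all add: fv rel bilinear_lmul[OF bil] del: One_nat_def)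
  have fc: "br x (f 4) = 0" "br x (f 5) = 0" "br x (f 6) = 0" for x
    using q.central_right by auto
  \<comment> \<open>The differentials of the dual forms with index 4, 5, 6 live on the pairings
    02|13, 03|12 and 01|23. In each term they meet a 2-form on another pairing, so every product
    repeats an index; the scaling of \<open>f 0\<close> does not matter for this.\<close>
  have "ce_d br f.psi = 0"
  proof (rule f.form_zero_lists[of _ 5])
    show "ce_d br f.psi \<in> alt_forms 5" using ce_d_alt[OF bil br_self f.psi_alt] by simp
    show "\<forall>l\<in>set (increasing_lists 5). ce_d br f.psi (map f l) = 0"
      unfolding increasing_lists_5 using s
      by (simp add: ce_d_list5 fb fc f.psi_head f.psi_basis form_coeff_eval del: One_nat_def)
  qed
  then have psi: "f.psi \<in> Vcc br" by (simp add: Vcc_def f.psi_alt f.determines_G2_psi)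
  \<comment> \<open>Otherwise \<open>s = 2 * t\<close> with \<open>s\<close> and \<open>t\<close>
    both of absolute value 1.\<close>
  have small: "dim (skew_derivations f.metric br) \<le> 4"
  proof (rule ccontr)
    assume "\<not> ?thesis"
    then obtain t where t: "t = 1 \<or> t = -1" "br (f 2) (f 3) = t *\<^sub>R br (f 0) (f 1)"
      using q.quaternionic_relations by auto
    then have "s *\<^sub>R f 6 = (2 * t) *\<^sub>R f 6" unfolding fb by (simp add: mult.commute)
    then have "s = 2 * t" using fnz by (auto simp: scaleR_cancel_right)
    then show False using s t(1) by auto
  qed
  have "49 \<le> dim (derivations br) + length q.triangular_eqs + length q.leibniz_eqs" by (rule q.dim_derivations_ge)
  \<comment> \<open>49 - 12 - 18 = 19 for codimension 4.\<close>
  then have "19 \<le> dim (derivations br)"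
    by (simp add: q.triangular_eqs_def q.leibniz_eqs_def upt_rec)
  moreover have "int (dim (derivations br)) - int (dim (skew_derivations f.metric br)) \<le> orbit_dim br f.psi"
    by (rule orbit_dim_ge_diff[OF f.frame7_axioms bil f.psi_alt f.bilinear_metric f.lact_psi_skew])
  ultimately have "15 \<le> orbit_dim br f.psi" using small by linarith
  then show ?thesis using psi by blast
qed

lemma orbit_dim_ge_grading:
  assumes psi: "\<psi> \<in> alt_forms k" and skew: "\<And>D x y. linear D \<Longrightarrow> lact D \<psi> = 0 \<Longrightarrow> metric (D x) y = - metric x (D y)"
  shows "49 - int (length grading_eqs) \<le> orbit_dim br \<psi>"
  using orbit_dim_ge_transversal[OF frame7_axioms bil psi bilinear_metric skew subspace_graded_derivations
      graded_derivations_subset graded_derivations_not_skew] dim_graded_derivations by simp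

lemma orbit_dim_ge_skew:
  assumes psi: "\<psi> \<in> alt_forms k" and skew: "\<And>D x y. linear D \<Longrightarrow> lact D \<psi> = 0 \<Longrightarrow> metric (D x) y = - metric x (D y)"
  shows "49 - int (length triangular_eqs) - int (length leibniz_eqs) - int (dim (skew_derivations metric br)) \<le> orbit_dim br \<psi>"
  using orbit_dim_ge_diff[OF frame7_axioms bil psi bilinear_metric skew] dim_derivations_ge by simp

text \<open>In each of the possible dimensions 1, 2 and 3 of the derived algebra the rank of the differential on 3-forms
  is at most 15, 10 or 14, and some orbit has dimension at least 17, 11 or 15, respectively.\<close>

lemma orbit_gt_rank:
  assumes psi: "\<psi> \<in> Vcc br" and skew: "\<And>D x y. linear D \<Longrightarrow> lact D \<psi> = 0 \<Longrightarrow> metric (D x) y = - metric x (D y)"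
    and p456: "p = 5 \<or> \<not> decomposable br"
  shows "\<exists>\<psi>\<in>Vcc br. int (dim (ce_d br ` alt_forms 3)) < orbit_dim br \<psi>"
proof -
  have alt: "\<psi> \<in> alt_forms 4" using psi by (simp add: Vcc_def)
  have "p \<noteq> 1" "p \<noteq> 2" "p \<noteq> 3" using center_dim_le by (auto simp: index_pairs_def upt_rec)
  then consider "p = 4" | "p = 5" | "p = 6" using p by linarith
  then show ?thesis
  proof cases
    case 1
    have "4 choose 4 = (1::nat)" by simp
    then have r: "dim (ce_d br ` alt_forms 3) \<le> 14"
      using rank3_le unfolding rank_triples_def unfolding 1 by (simp add: upt_rec)
    show ?thesis
    proof (cases "5 \<le> dim (skew_derivations metric br)")
      case True
      then show ?thesis using better_psi[OF 1] r by force
    next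
      case False
      then have "15 \<le> orbit_dim br \<psi>"
        using orbit_dim_ge_skew[OF alt skew] unfolding triangular_eqs_def leibniz_eqs_def unfolding 1 by (simp add: upt_rec)
      then show ?thesis using psi r by force
    qed
  next
    case 2
    have "5 choose 4 = (5::nat)" by (simp add: numeral_eq_Suc)
    then have r: "dim (ce_d br ` alt_forms 3) \<le> 10"
      using rank3_le unfolding rank_triples_def unfolding 2 by (simp add: upt_rec)
    \<comment> \<open>Here the transversal family suffices: ten maps into the derived algebra and
      one grading.\<close>
    have "11 \<le> orbit_dim br \<psi>"
      using orbit_dim_ge_grading[OF alt skew] unfolding grading_eqs_def unfolding 2 by (simp add: upt_rec)
    then show ?thesis using psi r by force
  next
    case 3
    have "6 choose 4 = (15::nat)" by (simp add: numeral_eq_Suc)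
    then have r: "dim (ce_d br ` alt_forms 3) \<le> 15"
      using rank3_le unfolding rank_triples_def unfolding 3 by (simp add: upt_rec)
    \<comment> \<open>Indecomposability enters only here, as nondegeneracy of the bracket: a central
      vector outside the derived algebra would split off.\<close>
    have "dim (skew_derivations metric br) \<le> 11"
      by (rule dim_skew_heisenberg[OF 3]) (use central_decomposable p456 3 in auto)
    then have "17 \<le> orbit_dim br \<psi>"
      using orbit_dim_ge_skew[OF alt skew] unfolding triangular_eqs_def leibniz_eqs_def unfolding 3 by (simp add: upt_rec)
    then show ?thesis using psi r by force
  qed
qed

end

text \<open>The alternative in the last hypothesis serves two purposes: indecomposable algebras, and
  the decomposable example \<open>br_lt\<close>, whose derived algebra has dimension 2.\<close>

lemma two_step_moduli_lt:
  fixes br :: "'a::euclidean_space \<Rightarrow> 'a \<Rightarrow> 'a"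
  assumes dim: "DIM('a) = 7" and lie: "lie_bracket br" and st: "step_nilpotent 2 br" and V: "Vcc br \<noteq> {}"
    and dec: "dim (lower_central br 1) = 2 \<or> \<not> decomposable br"
  shows "moduli_dim br < int (betti br 3)"
proof -
  have bil: "bilinear br" using lie by (simp add: lie_bracket_def)
  obtain \<psi> where psi: "\<psi> \<in> Vcc br" using V by blast
  define Z where "Z = lower_central br 1"
  have Z: "Z = span {br x y |x y. True}" by (simp add: Z_def)
  have Z2: "br z x = 0" if "z \<in> Z" for z x
  proof -
    have "br z x \<in> lower_central br 2"
      using that by (auto simp: Z_def numeral_2_eq_2 intro!: span_base)
    then show ?thesis using st by (simp add: step_nilpotent_def)
  qed
  have subZ: "subspace Z" by (simp add: Z)
  have Z0: "Z \<noteq> {0}" using st unfolding step_nilpotent_def Z_def by (metis one_less_numeral_iff semiring_norm(76))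
  obtain e :: "nat \<Rightarrow> 'a" and u where f: "frame7 e u" and Ze: "Z = span (e ` {7 - dim Z..<7})"
    and skew: "\<And>D x y. linear D \<Longrightarrow> lact D \<psi> = 0 \<Longrightarrow> frame.metric 7 u (D x) y = - frame.metric 7 u x (D y)"
    using Vcc_adapted_frame[OF dim psi subZ] by blast
  interpret frame7 e u by (rule f)
  let ?p = "7 - dim Z"
  have dZ: "dim Z \<le> 7" using dim_subset_UNIV[of Z] dim by simp
  have "dim Z \<noteq> 0" using Z0 subspace_0[OF subZ] by auto
  moreover have "dim Z \<noteq> 7"
  proof
    assume "dim Z = 7"
    then have "Z = UNIV" using dim_eq_full[of Z] dim subZ by (metis span_eq_iff)
    then have "br x y = 0" for x y using Z2 by auto
    then have "Z = {0}" by (simp add: Z)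
    then show False using Z0 by simp
  qed
  ultimately have p: "0 < ?p" "?p < 7" using dZ by linarith+
  interpret t: two_step_frame e u br ?p
  proof unfold_locales
    show "lie_bracket br" "0 < ?p" "?p < 7" by fact+
    show "u i (br x y) = 0" if i: "i < ?p" for i x y
    proof -
      have i7: "i < 7" using i by simp
      have "br x y \<in> Z" unfolding Z by (rule span_base) blast
      then have "br x y \<in> span (e ` {?p..<7})" by (subst Ze[symmetric])
      moreover have "span (e ` {?p..<7}) \<subseteq> {z. u i z = 0}"
        by (rule span_minimal[OF _ subspace_zero_set[OF linear_u[OF i7]]]) (use u_e[OF i7] i in auto)
      ultimately show ?thesis by auto
    qed
    show "br (e j) x = 0" if "?p \<le> j" "j < 7" for j x
      using that by (intro Z2) (subst Ze, intro span_base, auto)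
    show "e j \<in> span {br x y |x y. True}" if "?p \<le> j" "j < 7" for j
      unfolding Z[symmetric] using that by (subst Ze) (intro span_base, auto)
  qed
  have "?p = 5 \<or> \<not> decomposable br" using dec by (auto simp: Z_def)
  then obtain \<psi>' where "\<psi>' \<in> Vcc br" "int (dim (ce_d br ` alt_forms 3)) < orbit_dim br \<psi>'"
    using t.orbit_gt_rank[OF psi skew] by blast
  moreover have "nilpotent br" using st by (auto simp: nilpotent_def)
  ultimately show ?thesis using moduli_lt_betti[OF dim lie] by blast
qed

section \<open>Three decomposable nilpotent Lie algebras\<close>

lemma nilpotent_of_lower_central:
  assumes "lower_central br m = {0}"
  shows "nilpotent br"
proof -
  have "step_nilpotent (LEAST m. lower_central br m = {0}) br"
    unfolding step_nilpotent_def using LeastI[of "\<lambda>m. lower_central br m = {0}", OF assms] not_less_Least by blast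
  then show ?thesis by (auto simp: nilpotent_def)
qed

locale lie_frame7 = frame7 e u for e :: "nat \<Rightarrow> 'a::euclidean_space" and u +
  fixes br :: "'a \<Rightarrow> 'a \<Rightarrow> 'a"
  assumes lie: "lie_bracket br"
begin

lemma bil: "bilinear br"
  using lie by (simp add: lie_bracket_def)

lemma br_self: "br x x = 0"
  using lie by (simp add: lie_bracket_def)

text \<open>\<open>w\<close> assigns weights to the basis vectors. If bracketing raises the weight,
  term \<open>i\<close> of the series lies in the span of the vectors of weight above
  \<open>i\<close>; the series starts at index 0, so all weights are positive.\<close>

lemma lower_central_coords:
  assumes w: "\<And>j. j < 7 \<Longrightarrow> 0 < w j"
    and step: "\<And>i x y. \<forall>j<7. w j \<le> i \<longrightarrow> u j x = 0 \<Longrightarrow> \<forall>j<7. w j \<le> Suc i \<longrightarrow> u j (br x y) = 0"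
    and j: "j < 7" "w j \<le> i" and x: "x \<in> lower_central br i"
  shows "u j x = 0"
  using j x
proof (induction i arbitrary: j x)
  case 0
  then show ?case using w[of j] by simp
next
  case (Suc i)
  have "{br x y |x y. x \<in> lower_central br i} \<subseteq> {x. u j x = 0}"
    using step[of i] Suc.IH Suc.prems(1,2) by blast
  then show ?case
    using Suc.prems(3) span_minimal[OF _ subspace_zero_set[OF linear_u[OF Suc.prems(1)]]] by auto
qed

lemma lower_central_trivial:
  assumes w: "\<And>j. j < 7 \<Longrightarrow> 0 < w j \<and> w j \<le> m"
    and step: "\<And>i x y. \<forall>j<7. w j \<le> i \<longrightarrow> u j x = 0 \<Longrightarrow> \<forall>j<7. w j \<le> Suc i \<longrightarrow> u j (br x y) = 0"
  shows "lower_central br m = {0}"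
proof -
  have "x = 0" if "x \<in> lower_central br m" for x
  proof (rule coords_eqI)
    show "u j x = u j 0" if j: "j < 7" for j
      using lower_central_coords[where w=w, OF _ step j _ \<open>x \<in> lower_central br m\<close>] w j linear_0[OF linear_u[OF j]] by auto
  qed
  then show ?thesis using subspace_0[OF subspace_lower_central[of br m]] by blast
qed

lemma derivationI:
  assumes D: "linear D"
    and ij: "\<And>i j. i < j \<Longrightarrow> j < 7 \<Longrightarrow> D (br (e i) (e j)) = br (D (e i)) (e j) + br (e i) (D (e j))"
  shows "D \<in> derivations br"
proof -
  have br: "linear (br x)" "linear (\<lambda>x. br x y)" for x y using bil by (auto simp: bilinear_def)
  note sw = lie_bracket_swap[OF lie]
  have 0: "D (br (e i) (e j)) = br (D (e i)) (e j) + br (e i) (D (e j))" if "i < 7" "j < 7" for i j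
  proof (cases i j rule: linorder_cases)
    case equal
    then show ?thesis using sw[of "D (e i)" "e i"] linear_0[OF D] by (simp add: br_self)
  next
    case greater
    have "D (br (e i) (e j)) = - D (br (e j) (e i))"
      using sw[of "e i" "e j"] linear_neg[OF D] by simp
    also have "\<dots> = br (D (e i)) (e j) + br (e i) (D (e j))"
      using ij[OF greater that(1)] sw[of "D (e j)" "e i"] sw[of "e j" "D (e i)"] by simp
    finally show ?thesis .
  qed (use ij that in blast)
  have 1: "D (br (e i) y) = br (D (e i)) y + br (e i) (D y)" if i: "i < 7" for i y
  proof -
    have "(\<lambda>y. D (br (e i) y)) = (\<lambda>y. br (D (e i)) y + br (e i) (D y))"
    proof (rule linear_eqI)
      show "linear (\<lambda>y. D (br (e i) y))" using linear_compose[OF br(1) D] by (simp add: o_def)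
      show "linear (\<lambda>y. br (D (e i)) y + br (e i) (D y))"
        using linear_compose_add[OF br(1) linear_compose[OF D br(1)]] by (simp add: o_def)
    qed (rule 0[OF i])
    then show ?thesis by (rule fun_cong)
  qed
  have "D (br x y) = br (D x) y + br x (D y)" for x y
  proof -
    have "(\<lambda>x. D (br x y)) = (\<lambda>x. br (D x) y + br x (D y))"
    proof (rule linear_eqI)
      show "linear (\<lambda>x. D (br x y))" using linear_compose[OF br(2) D] by (simp add: o_def)
      show "linear (\<lambda>x. br (D x) y + br x (D y))"
        using linear_compose_add[OF linear_compose[OF D br(2)] br(2)] by (simp add: o_def)
    qed (rule 1)
    then show ?thesis by (rule fun_cong)
  qed
  then show ?thesis using D by (simp add: derivations_def)
qed

end

text \<open>Free coordinates of a closed 3-form: the remaining 14 of the 35 components are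
  determined by closedness. The later lists are similar choices of pivots for the linear systems of
  the examples.\<close>

definition closed_br_eq_free :: "nat list list" where
  "closed_br_eq_free = [[0,1,2],[0,1,3],[0,1,4],[0,1,5],[0,1,6],[0,2,3],[0,2,4],[0,2,5],[0,3,5],[0,4,5],[0,5,6],
    [1,2,3],[1,2,4],[1,2,5],[1,3,4],[1,3,5],[1,4,5],[1,4,6],[2,3,4],[2,3,5],[2,4,5]]"

text \<open>Components of the differential of a 3-form that determine all its other
  components.\<close>

definition rank_br_eq_lists :: "nat list list" where
  "rank_br_eq_lists = [[0,1,2,3],[0,1,2,4],[0,1,2,5],[0,1,2,6],[0,1,3,4],[0,1,3,5],[0,1,3,6],[0,1,4,5],[0,1,4,6],
    [0,1,5,6],[0,2,3,4],[0,2,3,6],[0,2,4,6],[1,2,3,6]]"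

definition closed_br_gt_free :: "nat list list" where
  "closed_br_gt_free = [[0,1,2],[0,1,3],[0,1,4],[0,1,5],[0,2,3],[0,2,4],[0,2,5],[0,2,6],[0,3,4],[0,3,5],[0,3,6],
    [1,2,3],[1,2,4],[1,2,5],[1,3,4],[1,3,5],[2,3,4],[2,3,5],[2,4,5]]"

text \<open>The pairs meeting the indices 3, 5, 6 of the derived algebra. The differential evaluates
  a 2-form only with a bracket in the first place, so the other pairs do not influence it.\<close>

definition rank_br_gt_lists :: "nat list list" where
  "rank_br_gt_lists = [[0,3],[0,5],[0,6],[1,3],[1,5],[1,6],[2,3],[2,5],[2,6],[3,4],[3,5],[3,6],[4,5],[4,6],[5,6]]"

definition der_br_gt_free :: "(nat \<times> nat) list" where
  "der_br_gt_free = [(3,2),(4,0),(4,1),(4,2),(4,4),(5,0),(5,2),(5,5),(6,0),(6,1),(6,2),(6,3),(6,4),(6,5),(6,6)]"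

definition der_br_eq_free :: "(nat \<times> nat) list" where
  "der_br_eq_free = [(3,0),(3,1),(3,3),(4,0),(5,0),(5,1),(5,5),(6,0),(6,1),(6,2),(6,3),(6,4),(6,5),(6,6)]"

definition der_br_eq_bound :: "(nat \<times> nat) list" where
  "der_br_eq_bound = [(i, j). i \<leftarrow> [0..<7], j \<leftarrow> [0..<7], (i, j) \<notin> set der_br_eq_free]"

lemma der_br_eq_bound_list: "der_br_eq_bound = [(0,0),(0,1),(0,2),(0,3),(0,4),(0,5),(0,6),(1,0),(1,1),(1,2),(1,3),(1,4),(1,5),(1,6),
  (2,0),(2,1),(2,2),(2,3),(2,4),(2,5),(2,6),(3,2),(3,4),(3,5),(3,6),(4,1),(4,2),(4,3),(4,4),(4,5),(4,6),(5,2),(5,3),(5,4),(5,6)]"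
  by code_simp

context frame7
begin

lemma alt3_simps:
  assumes "\<alpha> \<in> alt_forms 3"
  shows "\<alpha> (0 # xs) = 0" "\<alpha> (c *\<^sub>R x # xs) = c * \<alpha> (x # xs)" "\<alpha> ((- x) # xs) = - \<alpha> (x # xs)"
    "j < i \<Longrightarrow> \<alpha> [e i, e j, x] = - \<alpha> [e j, e i, x]" "j < i \<Longrightarrow> \<alpha> [x, e i, e j] = - \<alpha> [x, e j, e i]"
    "\<alpha> [x, x, y] = 0" "\<alpha> [y, x, x] = 0"
proof -
  show "\<alpha> (0 # xs) = 0" "\<alpha> (c *\<^sub>R x # xs) = c * \<alpha> (x # xs)" "\<alpha> ((- x) # xs) = - \<alpha> (x # xs)"
    using linear_0[OF alt_linear_head[OF assms]] linear_scale[OF alt_linear_head[OF assms]]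
      linear_neg[OF alt_linear_head[OF assms]] by auto
  show "\<alpha> [e i, e j, x] = - \<alpha> [e j, e i, x]" by (rule alt_swap[OF assms])
  show "\<alpha> [x, e i, e j] = - \<alpha> [x, e j, e i]"
    using alt_swap[OF interior_alt[OF assms, of x], of "e i" "e j" "[]"] by (simp only: interior_def)
  show "\<alpha> [x, x, y] = 0" "\<alpha> [y, x, x] = 0" using alt_forms_not_distinct[OF assms] by simp_all
qed

lemma coords_eq_iff: "x = y \<longleftrightarrow> (\<forall>i<7. u i x = u i y)"
  using coords_eqI by blast

lemma u_linear:
  assumes "i < 7"
  shows "u i (x + y) = u i x + u i y" "u i (x - y) = u i x - u i y" "u i (c *\<^sub>R x) = c * u i x" "u i (- x) = - u i x" "u i 0 = 0"
  using linear_u[OF assms] by (simp_all add: linear_add linear_diff linear_scale linear_neg linear_0)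

definition minor :: "nat \<Rightarrow> nat \<Rightarrow> 'a \<Rightarrow> 'a \<Rightarrow> real" where
  "minor i j x y = u i x * u j y - u j x * u i y"

text \<open>The structure constants are such that the 4-form \<open>psi\<close> of the frame is closed.\<close>

definition br_lt :: "'a \<Rightarrow> 'a \<Rightarrow> 'a" where
  "br_lt x y = (- minor 0 1 x y) *\<^sub>R e 4 - minor 0 2 x y *\<^sub>R e 6"

definition br_eq :: "'a \<Rightarrow> 'a \<Rightarrow> 'a" where
  "br_eq x y = (2 * minor 0 1 x y) *\<^sub>R e 2 - minor 1 2 x y *\<^sub>R e 4 + minor 0 2 x y *\<^sub>R e 5
     + (minor 1 5 x y - minor 0 4 x y) *\<^sub>R e 6"

definition br_gt :: "'a \<Rightarrow> 'a \<Rightarrow> 'a" where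
  "br_gt x y = (- minor 0 1 x y) *\<^sub>R e 3 - (minor 0 3 x y + minor 1 2 x y) *\<^sub>R e 5
     + (minor 2 3 x y - minor 0 5 x y) *\<^sub>R e 6"

lemma lie_bracket_coords:
  assumes c: "\<forall>i<7. \<forall>x y z c. u i (br (x + z) y) = u i (br x y) + u i (br z y) \<and> u i (br (c *\<^sub>R x) y) = c * u i (br x y)
    \<and> u i (br x y) + u i (br y x) = 0 \<and> u i (br x (br y z)) + u i (br y (br z x)) + u i (br z (br x y)) = 0"
  shows "lie_bracket br"
proof -
  have l: "br (x + z) y = br x y + br z y" "br (c *\<^sub>R x) y = c *\<^sub>R br x y" for x y z c
    using c by (auto simp: coords_eq_iff u_linear)
  have sw: "br x y + br y x = 0" for x y
    unfolding coords_eq_iff using c by (auto simp: u_linear)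
  have sw': "br x y = - br y x" for x y using sw[of x y] by (simp add: eq_neg_iff_add_eq_0)
  have r: "br x (y + z) = br x y + br x z" "br x (c *\<^sub>R y) = c *\<^sub>R br x y" for x y z c
    using l sw'[of x "y + z"] sw'[of x "c *\<^sub>R y"] sw'[of y x] sw'[of z x] by simp_all
  have "br x x = 0" for x
    using sw[of x x] by (simp add: scaleR_2[symmetric])
  moreover have "br x (br y z) + br y (br z x) + br z (br x y) = 0" for x y z
    unfolding coords_eq_iff using c by (auto simp: u_linear)
  moreover have "bilinear br"
    unfolding bilinear_def using l r by (auto intro!: linearI)
  ultimately show ?thesis unfolding lie_bracket_def by blast
qed

lemma coord_br_lt:
  "u 0 (br_lt x y) = 0" "u 1 (br_lt x y) = 0" "u 2 (br_lt x y) = 0" "u 3 (br_lt x y) = 0"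
  "u 4 (br_lt x y) = - minor 0 1 x y" "u 5 (br_lt x y) = 0" "u 6 (br_lt x y) = - minor 0 2 x y"
  by (simp_all add: br_lt_def u_linear u_e del: One_nat_def)

lemma coord_br_eq:
  "u 0 (br_eq x y) = 0" "u 1 (br_eq x y) = 0" "u 2 (br_eq x y) = 2 * minor 0 1 x y" "u 3 (br_eq x y) = 0"
  "u 4 (br_eq x y) = - minor 1 2 x y" "u 5 (br_eq x y) = minor 0 2 x y" "u 6 (br_eq x y) = minor 1 5 x y - minor 0 4 x y"
  by (simp_all add: br_eq_def u_linear u_e del: One_nat_def)

lemma coord_br_gt:
  "u 0 (br_gt x y) = 0" "u 1 (br_gt x y) = 0" "u 2 (br_gt x y) = 0" "u 3 (br_gt x y) = - minor 0 1 x y"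
  "u 4 (br_gt x y) = 0" "u 5 (br_gt x y) = - (minor 0 3 x y + minor 1 2 x y)" "u 6 (br_gt x y) = minor 2 3 x y - minor 0 5 x y"
  by (simp_all add: br_gt_def u_linear u_e del: One_nat_def)

lemma lie_br_lt: "lie_bracket br_lt"
  by (rule lie_bracket_coords, unfold all_less_7)
    (simp add: coord_br_lt minor_def u_linear algebra_simps del: One_nat_def)

lemma lie_br_eq: "lie_bracket br_eq"
  by (rule lie_bracket_coords, unfold all_less_7)
    (simp add: coord_br_eq minor_def u_linear algebra_simps del: One_nat_def)

lemma lie_br_gt: "lie_bracket br_gt"
  by (rule lie_bracket_coords, unfold all_less_7)
    (simp add: coord_br_gt minor_def u_linear algebra_simps del: One_nat_def)

lemma minor_e:
  assumes "a < b" "b < 7" "i < j" "j < 7"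
  shows "minor a b (e i) (e j) = (if (i, j) = (a, b) then 1 else 0)"
  using assms by (auto simp: minor_def u_e)

lemma br_lt_e:
  "br_lt (e 0) (e 1) = - e 4" "br_lt (e 0) (e 2) = - e 6"
  "i < j \<Longrightarrow> j < 7 \<Longrightarrow> (i, j) \<notin> {(0, 1), (0, 2)} \<Longrightarrow> br_lt (e i) (e j) = 0"
  by (simp_all add: br_lt_def minor_e del: One_nat_def) auto

lemma br_eq_e:
  "br_eq (e 0) (e 1) = 2 *\<^sub>R e 2" "br_eq (e 0) (e 2) = e 5" "br_eq (e 1) (e 2) = - e 4" "br_eq (e 0) (e 4) = - e 6" "br_eq (e 1) (e 5) = e 6"
  "i < j \<Longrightarrow> j < 7 \<Longrightarrow> (i, j) \<notin> {(0, 1), (0, 2), (1, 2), (0, 4), (1, 5)} \<Longrightarrow> br_eq (e i) (e j) = 0"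
  by (simp_all add: br_eq_def minor_e del: One_nat_def) auto

lemma br_gt_e:
  "br_gt (e 0) (e 1) = - e 3" "br_gt (e 0) (e 3) = - e 5" "br_gt (e 1) (e 2) = - e 5" "br_gt (e 0) (e 5) = - e 6" "br_gt (e 2) (e 3) = e 6"
  "i < j \<Longrightarrow> j < 7 \<Longrightarrow> (i, j) \<notin> {(0, 1), (0, 3), (1, 2), (0, 5), (2, 3)} \<Longrightarrow> br_gt (e i) (e j) = 0"
  by (simp_all add: br_gt_def minor_e del: One_nat_def) auto

lemma psi_in_Vcc:
  assumes "lie_bracket br" "\<forall>l\<in>set (increasing_lists 5). ce_d br psi (map e l) = 0"
  shows "psi \<in> Vcc br"
proof -
  have "ce_d br psi \<in> alt_forms 5"
    using assms(1) ce_d_alt[OF _ _ psi_alt, of br] by (simp add: lie_bracket_def)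
  then have "ce_d br psi = 0" by (rule form_zero_lists[OF _ assms(2)])
  then show ?thesis by (simp add: Vcc_def psi_alt determines_G2_psi)
qed

lemma psi_br_lt: "psi \<in> Vcc br_lt"
  by (rule psi_in_Vcc[OF lie_br_lt], unfold increasing_lists_5)
    (simp add: ce_d_list5 br_lt_e psi_head psi_basis form_coeff_eval del: One_nat_def)

lemma psi_br_eq: "psi \<in> Vcc br_eq"
  by (rule psi_in_Vcc[OF lie_br_eq], unfold increasing_lists_5)
    (simp add: ce_d_list5 br_eq_e psi_head psi_basis form_coeff_eval del: One_nat_def)

lemma psi_br_gt: "psi \<in> Vcc br_gt"
  by (rule psi_in_Vcc[OF lie_br_gt], unfold increasing_lists_5)
    (simp add: ce_d_list5 br_gt_e psi_head psi_basis form_coeff_eval del: One_nat_def)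

interpretation lt: lie_frame7 e u br_lt by unfold_locales (rule lie_br_lt)
interpretation eq: lie_frame7 e u br_eq by unfold_locales (rule lie_br_eq)
interpretation gt: lie_frame7 e u br_gt by unfold_locales (rule lie_br_gt)

lemma not_abelian:
  "\<not> abelian br_lt" "\<not> abelian br_eq" "\<not> abelian br_gt"
proof -
  have c: "u 4 (br_lt (e 0) (e 1)) = -1" "u 2 (br_eq (e 0) (e 1)) = 2" "u 3 (br_gt (e 0) (e 1)) = -1"
    by (simp_all add: br_lt_e br_eq_e br_gt_e u_linear u_e del: One_nat_def)
  have z: "u 4 0 = 0" "u 2 0 = 0" "u 3 0 = 0" by (simp_all add: u_linear)
  show "\<not> abelian br_lt"
  proof
    assume "abelian br_lt"
    then show False using c(1) z by (simp add: abelian_def del: One_nat_def)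
  qed
  show "\<not> abelian br_eq"
  proof
    assume "abelian br_eq"
    then show False using c(2) z by (simp add: abelian_def del: One_nat_def)
  qed
  show "\<not> abelian br_gt"
  proof
    assume "abelian br_gt"
    then show False using c(3) z by (simp add: abelian_def del: One_nat_def)
  qed
qed

lemma lower_central_br_lt: "lower_central br_lt 2 = {0}"
proof (rule lt.lower_central_trivial)
  \<comment> \<open>Weights are depths in the lower central series: only \<open>e 4\<close> and
    \<open>e 6\<close> come from brackets.\<close>
  let ?w = "\<lambda>j. [1::nat, 1, 1, 1, 2, 1, 2] ! j"
  have "\<forall>j<7. 0 < ?w j \<and> ?w j \<le> (2::nat)" unfolding all_less_7 by simp
  then show "0 < ?w j \<and> ?w j \<le> (2::nat)" if "j < 7" for j using that by blast
  show "\<forall>j<7. ?w j \<le> Suc i \<longrightarrow> u j (br_lt x y) = 0" if "\<forall>j<7. ?w j \<le> i \<longrightarrow> u j x = 0" for i x y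
    using that unfolding all_less_7 by (simp add: coord_br_lt minor_def del: One_nat_def)
qed

lemma lower_central_br_eq: "lower_central br_eq 4 = {0}"
proof (rule eq.lower_central_trivial)
  let ?w = "\<lambda>j. [1::nat, 1, 2, 1, 3, 3, 4] ! j"
  have "\<forall>j<7. 0 < ?w j \<and> ?w j \<le> (4::nat)" unfolding all_less_7 by simp
  then show "0 < ?w j \<and> ?w j \<le> (4::nat)" if "j < 7" for j using that by blast
  show "\<forall>j<7. ?w j \<le> Suc i \<longrightarrow> u j (br_eq x y) = 0" if "\<forall>j<7. ?w j \<le> i \<longrightarrow> u j x = 0" for i x y
    using that unfolding all_less_7 by (simp add: coord_br_eq minor_def del: One_nat_def)
qed

lemma lower_central_br_gt: "lower_central br_gt 4 = {0}"
proof (rule gt.lower_central_trivial)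
  let ?w = "\<lambda>j. [1::nat, 1, 1, 2, 1, 3, 4] ! j"
  have "\<forall>j<7. 0 < ?w j \<and> ?w j \<le> (4::nat)" unfolding all_less_7 by simp
  then show "0 < ?w j \<and> ?w j \<le> (4::nat)" if "j < 7" for j using that by blast
  show "\<forall>j<7. ?w j \<le> Suc i \<longrightarrow> u j (br_gt x y) = 0" if "\<forall>j<7. ?w j \<le> i \<longrightarrow> u j x = 0" for i x y
    using that unfolding all_less_7 by (simp add: coord_br_gt minor_def del: One_nat_def)
qed

lemma decomposable_examples: "decomposable br_lt" "decomposable br_eq" "decomposable br_gt"
proof -
  have m: "minor i j (e a) y = 0" if "i < 7" "j < 7" "a < 7" "i \<noteq> a" "j \<noteq> a" for i j a y
    using that by (simp add: minor_def u_e)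
  show "decomposable br_lt"
  proof (rule central_summand_decomposable[OF lt.bil, of "e 3" 3])
    show "br_lt (e 3) y = 0" for y by (simp add: br_lt_def m del: One_nat_def)
    show "u 3 (br_lt x y) = 0" for x y by (rule coord_br_lt)
  qed (simp_all add: u_e)
  show "decomposable br_eq"
  proof (rule central_summand_decomposable[OF eq.bil, of "e 3" 3])
    show "br_eq (e 3) y = 0" for y by (simp add: br_eq_def m del: One_nat_def)
    show "u 3 (br_eq x y) = 0" for x y by (rule coord_br_eq)
  qed (simp_all add: u_e)
  show "decomposable br_gt"
  proof (rule central_summand_decomposable[OF gt.bil, of "e 4" 4])
    show "br_gt (e 4) y = 0" for y by (simp add: br_gt_def m del: One_nat_def)
    show "u 4 (br_gt x y) = 0" for x y by (rule coord_br_gt)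
  qed (simp_all add: u_e)
qed

lemma derived_br_lt: "lower_central br_lt 1 = span (e ` {4, 6})"
proof -
  let ?S = "{br_lt x y |x y. x \<in> lower_central br_lt 0}"
  have "br_lt x y \<in> span (e ` {4, 6})" for x y
    unfolding br_lt_def by (intro span_diff span_scale span_base) auto
  then have "span ?S \<subseteq> span (e ` {4, 6})" by (intro span_minimal) auto
  moreover have s: "br_lt x y \<in> span ?S" for x y by (rule span_base) auto
  have "- br_lt (e 0) (e 1) \<in> span ?S" "- br_lt (e 0) (e 2) \<in> span ?S" by (rule span_neg[OF s])+
  then have "e 4 \<in> span ?S" "e 6 \<in> span ?S" by (simp_all only: br_lt_e minus_minus)
  then have "span (e ` {4, 6}) \<subseteq> span ?S" by (intro span_minimal subspace_span) blast
  ultimately show ?thesis unfolding One_nat_def lower_central.simps(2) by (rule subset_antisym)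
qed

lemma dim_derived_br_lt: "dim (lower_central br_lt 1) = 2"
proof -
  have ind: "independent (e ` {4, 6})" by (rule independent_mono[OF e_independent(2)]) auto
  have "card (e ` {4, 6}) = 2" using e_inj[of 4 6] by simp
  then show ?thesis unfolding derived_br_lt dim_span using dim_eq_card_independent[OF ind] by linarith
qed

lemma moduli_br_lt: "moduli_dim br_lt < int (betti br_lt 3)"
proof (rule two_step_moduli_lt[OF DIM7 lie_br_lt])
  have 1: "lower_central br_lt 1 \<noteq> {0}"
  proof
    assume "lower_central br_lt 1 = {0}"
    then have "dim (lower_central br_lt 1) = 0" by (simp only: dim_eq_0)
    then show False using dim_derived_br_lt by linarith
  qed
  have "br_lt (e 0) (e 1) \<noteq> 0"
  proof
    assume "br_lt (e 0) (e 1) = 0"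
    then have "u 4 (- e 4) = 0" using u_linear(5)[of 4] by (simp only: br_lt_e)
    then show False by (simp add: u_linear u_e)
  qed
  then have 0: "lower_central br_lt 0 \<noteq> {0}" unfolding lower_central.simps(1) by (metis UNIV_I singletonD)
  have "lower_central br_lt k \<noteq> {0}" if k: "k < 2" for k
  proof (cases "k = 0")
    case False
    then have "k = 1" using k by linarith
    then show ?thesis using 1 by (simp only: simp_thms)
  qed (use 0 in \<open>simp only: simp_thms\<close>)
  then show "step_nilpotent 2 br_lt"
    unfolding step_nilpotent_def using lower_central_br_lt by blast
  show "Vcc br_lt \<noteq> {}" using psi_br_lt by blast
  show "dim (lower_central br_lt 1) = 2 \<or> \<not> decomposable br_lt" using dim_derived_br_lt by blast
qed

section \<open>Ranks and derivations of the examples\<close>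

lemma closed_forms_br_eq: "dim (closed_forms br_eq 3) \<le> 21"
proof -
  have "dim (closed_forms br_eq 3) \<le> card (set closed_br_eq_free)"
  proof (rule dim_le_functionals(2)[where f="\<lambda>l \<alpha>. \<alpha> (map e l)", OF finite_set subspace_closed_forms linear_apply])
    fix \<alpha> assume "\<alpha> \<in> closed_forms br_eq 3" and z: "\<And>l. l \<in> set closed_br_eq_free \<Longrightarrow> \<alpha> (map e l) = 0"
    then have a: "\<alpha> \<in> alt_forms 3" and d: "\<forall>l\<in>set rank_br_eq_lists. ce_d br_eq \<alpha> (map e l) = 0"
      by (auto simp: closed_forms_def)
    have z: "\<forall>l\<in>set closed_br_eq_free. \<alpha> (map e l) = 0" using z by blast
    show "\<alpha> = 0"
    proof (rule form_zero_lists[OF a])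
      show "\<forall>l\<in>set (increasing_lists 3). \<alpha> (map e l) = 0"
        using d z unfolding increasing_lists_3 closed_br_eq_free_def rank_br_eq_lists_def
        by (simp add: ce_d_list4 br_eq_e alt3_simps[OF a] del: One_nat_def)
    qed
  qed
  also have "\<dots> \<le> length closed_br_eq_free" by (rule card_length)
  finally show ?thesis by (simp add: closed_br_eq_free_def)
qed

lemma closed_forms_br_gt: "dim (closed_forms br_gt 3) \<le> 19"
proof -
  have "dim (closed_forms br_gt 3) \<le> card (set closed_br_gt_free)"
  proof (rule dim_le_functionals(2)[where f="\<lambda>l \<alpha>. \<alpha> (map e l)", OF finite_set subspace_closed_forms linear_apply])
    fix \<alpha> assume "\<alpha> \<in> closed_forms br_gt 3" and z: "\<And>l. l \<in> set closed_br_gt_free \<Longrightarrow> \<alpha> (map e l) = 0"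
    then have a: "\<alpha> \<in> alt_forms 3" and d: "\<forall>l\<in>set (increasing_lists 4). ce_d br_gt \<alpha> (map e l) = 0"
      by (auto simp: closed_forms_def)
    have z: "\<forall>l\<in>set closed_br_gt_free. \<alpha> (map e l) = 0" using z by blast
    show "\<alpha> = 0"
    proof (rule form_zero_lists[OF a])
      show "\<forall>l\<in>set (increasing_lists 3). \<alpha> (map e l) = 0"
        using d z unfolding increasing_lists_3 increasing_lists_4 closed_br_gt_free_def
        by (simp add: ce_d_list4 br_gt_e alt3_simps[OF a] del: One_nat_def)
    qed
  qed
  also have "\<dots> \<le> length closed_br_gt_free" by (rule card_length)
  finally show ?thesis by (simp add: closed_br_gt_free_def)
qed

text \<open>Together with \<open>closed_forms_br_eq\<close> this fixes the rank at exactly 14, as an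
  equality of dimensions requires.\<close>

lemma rank_br_eq: "dim (ce_d br_eq ` alt_forms 3) \<le> 14"
proof -
  have bil: "bilinear br_eq" "\<And>x. br_eq x x = 0" using lie_br_eq by (auto simp: lie_bracket_def)
  have "dim (ce_d br_eq ` alt_forms 3) \<le> card (set rank_br_eq_lists)"
  proof (rule rank_le_functionals[where f="\<lambda>l \<alpha>. ce_d br_eq \<alpha> (map e l)", OF finite_set])
    show "linear (\<lambda>\<alpha>. ce_d br_eq \<alpha> (map e l))" for l
      using linear_compose[OF linear_ce_d linear_apply] by (simp add: o_def)
    fix \<alpha> :: "'a form" assume a: "\<alpha> \<in> alt_forms 3" and z: "\<And>l. l \<in> set rank_br_eq_lists \<Longrightarrow> ce_d br_eq \<alpha> (map e l) = 0"
    have z: "\<forall>l\<in>set rank_br_eq_lists. ce_d br_eq \<alpha> (map e l) = 0" using z by blast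
    show "ce_d br_eq \<alpha> = 0"
    proof (rule form_zero_lists)
      show "ce_d br_eq \<alpha> \<in> alt_forms 4" using ce_d_alt[OF bil a] by simp
      show "\<forall>l\<in>set (increasing_lists 4). ce_d br_eq \<alpha> (map e l) = 0"
        using z unfolding increasing_lists_4 rank_br_eq_lists_def
        by (simp add: ce_d_list4 br_eq_e alt3_simps[OF a] del: One_nat_def)
    qed
  qed
  also have "\<dots> \<le> length rank_br_eq_lists" by (rule card_length)
  finally show ?thesis by (simp add: rank_br_eq_lists_def)
qed

text \<open>By duality this gives at least 20 independent closed 4-forms, which keeps the truncated
  difference in \<open>betti\<close> under control.\<close>

lemma rank_br_gt: "dim (ce_d br_gt ` alt_forms 2) \<le> 15"
proof -
  have bil: "bilinear br_gt" "\<And>x. br_gt x x = 0" using lie_br_gt by (auto simp: lie_bracket_def)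
  have "dim (ce_d br_gt ` alt_forms 2) \<le> card (set rank_br_gt_lists)"
  proof (rule rank_le_functionals[where f="\<lambda>l \<alpha>. \<alpha> (map e l)", OF finite_set linear_apply])
    fix \<alpha> :: "'a form" assume a: "\<alpha> \<in> alt_forms 2" and z: "\<And>l. l \<in> set rank_br_gt_lists \<Longrightarrow> \<alpha> (map e l) = 0"
    have z: "\<forall>l\<in>set rank_br_gt_lists. \<alpha> (map e l) = 0" using z by blast
    have h: "\<alpha> (0 # xs) = 0" "\<alpha> (c *\<^sub>R x # xs) = c * \<alpha> (x # xs)" "\<alpha> ((- x) # xs) = - \<alpha> (x # xs)"
      "j < i \<Longrightarrow> \<alpha> [e i, e j] = - \<alpha> [e j, e i]" "\<alpha> [x, x] = 0" for x xs c i j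
      using linear_0[OF alt_linear_head[OF a]] linear_scale[OF alt_linear_head[OF a]]
        linear_neg[OF alt_linear_head[OF a]] alt_swap[OF a, of "e i" "e j" "[]"] alt_forms_not_distinct[OF a] by auto
    show "ce_d br_gt \<alpha> = 0"
    proof (rule form_zero_lists)
      show "ce_d br_gt \<alpha> \<in> alt_forms 3" using ce_d_alt[OF bil a] by simp
      show "\<forall>l\<in>set (increasing_lists 3). ce_d br_gt \<alpha> (map e l) = 0"
        using z unfolding increasing_lists_3 rank_br_gt_lists_def
        by (simp add: ce_d_list3 br_gt_e h del: One_nat_def)
    qed
  qed
  also have "\<dots> \<le> length rank_br_gt_lists" by (rule card_length)
  finally show ?thesis by (simp add: rank_br_gt_lists_def)
qed

lemma linear_zero_coords:
  assumes "linear D" "\<forall>i<7. \<forall>j<7. u i (D (e j)) = 0"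
  shows "D = 0"
proof (rule linear_eqI[OF assms(1)])
  show "linear (0 :: 'a \<Rightarrow> 'a)" by (simp add: zero_fun_def linear_zero)
  show "D (e j) = 0 (e j)" if "j < 7" for j
    using that assms(2) by (intro coords_eqI) (simp add: zero_fun_def u_linear)
qed

lemma leibniz_coord:
  assumes "D \<in> derivations br" "l < 7"
  shows "u l (D (br (e i) (e j))) = u l (br (D (e i)) (e j)) + u l (br (e i) (D (e j)))"
  using assms by (simp add: derivations_def u_linear)

text \<open>The Leibniz rule solved for the 35 matrix entries in \<^const>\<open>der_br_eq_bound\<close>; the other 14
  entries are free.\<close>

definition der_br_eq_value :: "('a \<Rightarrow> 'a) \<Rightarrow> nat \<times> nat \<Rightarrow> real" where
  "der_br_eq_value D = (let m = \<lambda>i j. u i (D (e j)) in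
     (\<lambda>_. 0)((0,0) := m 5 5 - m 6 6 / 2, (1,1) := m 6 6 - m 5 5, (2,0) := - 2 * m 6 5, (2,1) := - 2 * m 6 4,
       (2,2) := m 6 6 / 2, (4,1) := - 2 * m 6 2 - m 5 0, (4,2) := - m 6 5, (4,4) := 3 / 2 * m 6 6 - m 5 5, (5,2) := - m 6 4))"

lemma derivations_br_eq:
  "derivations br_eq = {D \<in> {D. linear D}. \<forall>(i, j)\<in>set der_br_eq_bound. u i (D (e j)) - der_br_eq_value D (i, j) = 0}"
proof (intro set_eqI iffI)
  fix D assume D: "D \<in> derivations br_eq"
  have lin: "linear D" using D by (simp add: derivations_def)
  note One_nat_def [simp del]
  note [simp] = br_eq_e coord_br_eq minor_def u_e u_linear linear_scale[OF lin] linear_neg[OF lin] linear_0[OF lin]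
  \<comment> \<open>A selection of 35 components \<open>l\<close> of the Leibniz rule for
    \<open>e i\<close>, \<open>e j\<close>, as many as there are entries to solve for.\<close>
  have "\<forall>(i, j, l)\<in>set [(0,1,0),(0,1,1),(0,1,2),(0,1,3),(0,1,4),(0,1,5),(0,1,6),(0,2,0),(0,2,1),(0,2,3),(0,2,4),(0,2,5),(0,2,6),
      (0,3,2),(0,3,5),(0,3,6),(0,4,0),(0,4,1),(0,4,3),(0,4,4),(0,4,6),(0,5,5),(0,5,6),(0,6,5),(1,2,0),(1,2,1),(1,2,3),(1,2,4),
      (1,2,5),(1,2,6),(1,3,2),(1,3,6),(1,4,4),(1,4,6),(1,5,5)].
      u l (D (br_eq (e i) (e j))) = u l (br_eq (D (e i)) (e j)) + u l (br_eq (e i) (D (e j)))"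
    by (simp only: list.set ball_simps prod.case leibniz_coord[OF D])
  note L = this[simplified]
  have "\<forall>(i, j)\<in>set der_br_eq_bound. u i (D (e j)) - der_br_eq_value D (i, j) = 0"
    unfolding der_br_eq_bound_list
    by (simp add: der_br_eq_value_def) (intro conjI; insert L; elim conjE; linarith)
  then show "D \<in> {D \<in> {D. linear D}. \<forall>(i, j)\<in>set der_br_eq_bound. u i (D (e j)) - der_br_eq_value D (i, j) = 0}"
    using lin by simp
next
  fix D assume "D \<in> {D \<in> {D. linear D}. \<forall>(i, j)\<in>set der_br_eq_bound. u i (D (e j)) - der_br_eq_value D (i, j) = 0}"
  then have lin: "linear D" and v: "\<forall>(i, j)\<in>set der_br_eq_bound. u i (D (e j)) = der_br_eq_value D (i, j)" by auto
  note One_nat_def [simp del]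
  note V = v[unfolded der_br_eq_bound_list der_br_eq_value_def, simplified]
  have "\<forall>j<7. \<forall>i<7. i < j \<longrightarrow> (\<forall>l<7. u l (D (br_eq (e i) (e j))) = u l (br_eq (D (e i)) (e j) + br_eq (e i) (D (e j))))"
    unfolding all_less_7
    by (simp add: br_eq_e coord_br_eq minor_def u_e u_linear linear_scale[OF lin] linear_neg[OF lin] linear_0[OF lin])
      (intro conjI; insert V; elim conjE; linarith)
  then have "D (br_eq (e i) (e j)) = br_eq (D (e i)) (e j) + br_eq (e i) (D (e j))" if "i < j" "j < 7" for i j
    using that by (intro coords_eqI) auto
  then show "D \<in> derivations br_eq" by (rule eq.derivationI[OF lin])
qed

lemma linear_der_br_eq: "linear (\<lambda>D. case q of (i, j) \<Rightarrow> u i (D (e j)) - der_br_eq_value D (i, j))" if "q \<in> set der_br_eq_bound"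
proof -
  have "fst q < 7" using that by (auto simp: der_br_eq_bound_def)
  then show ?thesis
    by (cases q) (auto intro!: linearI simp: der_br_eq_value_def u_linear algebra_simps)
qed

lemma dim_derivations_br_eq: "dim (derivations br_eq) = 14"
proof (rule antisym)
  have "dim (derivations br_eq) \<le> card (set der_br_eq_free)"
  proof (rule dim_le_functionals(2)[where f="\<lambda>(i, j) D. u i (D (e j))", OF finite_set subspace_derivations[OF eq.bil]])
    show "linear (case q of (i, j) \<Rightarrow> \<lambda>D. u i (D (e j)))" if "q \<in> set der_br_eq_free" for q
    proof -
      have "fst q < 7" using that by (auto simp: der_br_eq_free_def)
      then show ?thesis by (cases q) (auto intro: linear_coeff)
    qed
    fix D assume D: "D \<in> derivations br_eq" and z: "\<And>q. q \<in> set der_br_eq_free \<Longrightarrow> (case q of (i, j) \<Rightarrow> \<lambda>D. u i (D (e j))) D = 0"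
    have z': "\<forall>(i, j)\<in>set der_br_eq_free. u i (D (e j)) = 0" using z by auto
    have "\<forall>(i, j)\<in>set der_br_eq_bound. u i (D (e j)) - der_br_eq_value D (i, j) = 0"
      using D unfolding derivations_br_eq by blast
    then have "\<forall>i<7. \<forall>j<7. u i (D (e j)) = 0"
      using z' unfolding all_less_7 der_br_eq_bound_list der_br_eq_free_def
      by (simp add: der_br_eq_value_def del: One_nat_def)
    then show "D = 0" using D by (intro linear_zero_coords) (auto simp: derivations_def)
  qed
  also have "\<dots> \<le> length der_br_eq_free" by (rule card_length)
  finally show "dim (derivations br_eq) \<le> 14" by (simp add: der_br_eq_free_def)
  have "dim {D :: 'a \<Rightarrow> 'a. linear D} \<le> dim (derivations br_eq) + card (set der_br_eq_bound)"
    unfolding derivations_br_eq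
    using dim_common_kernel_ge[OF finite_set subspace_endos fin_dim_endos linear_der_br_eq] by (simp only: case_prod_unfold)
  moreover have "card (set der_br_eq_bound) \<le> 35"
    using card_length[of der_br_eq_bound] by (simp add: der_br_eq_bound_list)
  ultimately show "14 \<le> dim (derivations br_eq)" by (simp add: dim_endos)
qed

text \<open>Skewness ties the free entries to bound ones; with the solved Leibniz rule the linear
  system has only the zero solution. The stabilizer of \<open>psi\<close> is therefore
  discrete.\<close>

lemma skew_derivations_br_eq: "skew_derivations metric br_eq = {0}"
proof -
  have "D = 0" if D: "D \<in> skew_derivations metric br_eq" for D
  proof -
    have d: "D \<in> derivations br_eq" and s: "metric (D x) y = - metric x (D y)" for x y
      using D by (auto simp: skew_derivations_def)
    have sk: "u i (D (e j)) = - u j (D (e i))" if "i < 7" "j < 7" for i j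
      using s[of "e j" "e i"] that by (simp add: metric_e)
    have v: "\<forall>(i, j)\<in>set der_br_eq_bound. u i (D (e j)) - der_br_eq_value D (i, j) = 0"
      using d unfolding derivations_br_eq by blast
    have sk': "\<forall>(i, j)\<in>set der_br_eq_free. u i (D (e j)) = - u j (D (e i))"
      by (simp only: der_br_eq_free_def list.set ball_simps prod.case) (intro conjI TrueI; rule sk; simp)
    note One_nat_def [simp del]
    note V = v[unfolded der_br_eq_bound_list der_br_eq_value_def, simplified]
    note S = sk'[unfolded der_br_eq_free_def, simplified]
    have "\<forall>i<7. \<forall>j<7. u i (D (e j)) = 0"
      unfolding all_less_7 by (intro conjI; insert V S; elim conjE; linarith)
    then show "D = 0" using d by (intro linear_zero_coords) (auto simp: derivations_def)
  qed
  then show ?thesis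
    using subspace_0[OF subspace_skew_derivations[OF bilinear_metric eq.bil]] by blast
qed

lemma dim_derivations_br_gt: "dim (derivations br_gt) \<le> 15"
proof -
  have "dim (derivations br_gt) \<le> card (set der_br_gt_free)"
  proof (rule dim_le_functionals(2)[where f="\<lambda>(i, j) D. u i (D (e j))", OF finite_set subspace_derivations[OF gt.bil]])
    show "linear (case q of (i, j) \<Rightarrow> \<lambda>D. u i (D (e j)))" if "q \<in> set der_br_gt_free" for q
    proof -
      have "fst q < 7" using that by (auto simp: der_br_gt_free_def)
      then show ?thesis by (cases q) (auto intro: linear_coeff)
    qed
    fix D assume D: "D \<in> derivations br_gt" and z: "\<And>q. q \<in> set der_br_gt_free \<Longrightarrow> (case q of (i, j) \<Rightarrow> \<lambda>D. u i (D (e j))) D = 0"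
    have lin: "linear D" using D by (simp add: derivations_def)
    note One_nat_def [simp del]
    note [simp] = br_gt_e coord_br_gt minor_def u_e u_linear linear_scale[OF lin] linear_neg[OF lin] linear_0[OF lin]
    have z': "\<forall>(i, j)\<in>set der_br_gt_free. u i (D (e j)) = 0" using z by auto
    \<comment> \<open>34 components of the Leibniz rule, one for each entry outside
      \<open>der_br_gt_free\<close>.\<close>
    have "\<forall>(i, j, l)\<in>set [(0,1,0),(0,1,1),(0,1,2),(0,1,3),(0,1,4),(0,1,5),(0,1,6),(0,2,3),(0,2,5),(0,2,6),(0,3,0),(0,3,1),(0,3,2),
       (0,3,3),(0,3,4),(0,3,5),(0,3,6),(0,4,3),(0,4,5),(0,4,6),(0,5,0),(0,5,1),(0,5,2),(0,5,4),(0,5,6),(0,6,5),(0,6,6),(1,2,3),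
       (1,2,5),(1,2,6),(1,3,6),(1,4,3),(1,4,5),(1,5,6)].
      u l (D (br_gt (e i) (e j))) = u l (br_gt (D (e i)) (e j)) + u l (br_gt (e i) (D (e j)))"
      by (simp only: list.set ball_simps prod.case leibniz_coord[OF D])
    note L = this[simplified]
    note Z = z'[unfolded der_br_gt_free_def, simplified]
    have "\<forall>i<7. \<forall>j<7. u i (D (e j)) = 0"
      unfolding all_less_7 by (intro conjI; insert L Z; elim conjE; linarith)
    then show "D = 0" by (rule linear_zero_coords[OF lin])
  qed
  also have "\<dots> \<le> length der_br_gt_free" by (rule card_length)
  finally show ?thesis by (simp add: der_br_gt_free_def)
qed

text \<open>The orbit of \<open>psi\<close> has the full dimension 14 of the derivation algebra, and
  14 is also the rank on 3-forms.\<close>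

lemma moduli_br_eq: "moduli_dim br_eq = int (betti br_eq 3)"
proof -
  note b = nilpotent_betti[OF DIM7 lie_br_eq nilpotent_of_lower_central[OF lower_central_br_eq]]
  have "int (dim (derivations br_eq)) - int (dim (skew_derivations metric br_eq)) \<le> orbit_dim br_eq psi"
    by (rule orbit_dim_ge_diff[OF frame7_axioms eq.bil psi_alt bilinear_metric lact_psi_skew])
  moreover have "dim (skew_derivations metric br_eq) = 0" unfolding skew_derivations_br_eq
    using real_vector.dim_le_card[of "{0 :: 'a \<Rightarrow> 'a}" "{}"] by simp
  ultimately have "14 \<le> orbit_dim br_eq psi" by (simp add: dim_derivations_br_eq)
  then have "moduli_dim br_eq \<le> int (dim (closed_forms br_eq 4)) - 14"
    using moduli_dim_le[OF frame7_axioms eq.bil psi_br_eq] by linarith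
  moreover have "moduli_dim br_eq \<ge> int (dim (closed_forms br_eq 4)) - int (dim (derivations br_eq))"
    by (rule moduli_dim_ge[OF frame7_axioms eq.bil]) (use psi_br_eq in blast)
  ultimately have "moduli_dim br_eq = int (dim (closed_forms br_eq 4)) - 14" by (simp add: dim_derivations_br_eq)
  moreover have "dim (ce_d br_eq ` alt_forms 3) = 14" using b(4) closed_forms_br_eq rank_br_eq by linarith
  moreover have "dim (closed_forms br_eq 2) + dim (ce_d br_eq ` alt_forms 2) = 7 choose 2"
    by (rule closed_plus_rank)
  \<comment> \<open>The rank on 2-forms is at most 21, so there are at least 14 closed 4-forms and
    the difference in \<open>betti\<close> is not truncated.\<close>
  then have "14 \<le> dim (closed_forms br_eq 4)" using b(3) by (simp add: choose_two)
  ultimately show ?thesis unfolding b(2) by linarith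
qed

text \<open>There are at most 15 independent derivations while the rank on 3-forms is at least 16,
  so even an orbit of full dimension falls short of the rank.\<close>

lemma moduli_br_gt: "int (betti br_gt 3) < moduli_dim br_gt"
proof -
  note b = nilpotent_betti[OF DIM7 lie_br_gt nilpotent_of_lower_central[OF lower_central_br_gt]]
  have "moduli_dim br_gt \<ge> int (dim (closed_forms br_gt 4)) - int (dim (derivations br_gt))"
    by (rule moduli_dim_ge[OF frame7_axioms gt.bil]) (use psi_br_gt in blast)
  then have "int (dim (closed_forms br_gt 4)) - 15 \<le> moduli_dim br_gt" using dim_derivations_br_gt by linarith
  \<comment> \<open>Covers the case of truncation: even if \<open>betti\<close> were cut off at 0,
    the lower bound for the moduli dimension is positive.\<close>
  moreover have "20 \<le> dim (closed_forms br_gt 4)" using b(3) rank_br_gt by linarith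
  moreover have "16 \<le> dim (ce_d br_gt ` alt_forms 3)" using b(4) closed_forms_br_gt by linarith
  ultimately show ?thesis unfolding b(2) by linarith
qed

end

lemma frame7_exists:
  assumes "DIM('a::euclidean_space) = 7"
  shows "\<exists>(e :: nat \<Rightarrow> 'a) u. frame7 e u"
proof -
  obtain b :: "nat \<Rightarrow> 'a" where b: "bij_betw b {..<7} Basis"
    using ex_bij_betw_nat_finite[of "Basis :: 'a set"] assms by (auto simp: atLeast0LessThan)
  then have "inj_on b {..<7}" "b ` {..<7} = Basis" by (auto simp: bij_betw_def)
  then have "\<exists>u. frame 7 b u" by (intro frame_of_basis) (simp_all add: independent_Basis)
  then show ?thesis by (auto simp: frame7_def)
qed

theorem theorem3p10:
  shows
    "(\<forall>br :: 'a::euclidean_space \<Rightarrow> 'a \<Rightarrow> 'a.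
        DIM('a) = 7 \<and> lie_bracket br \<and> nilpotent br \<and> \<not> abelian br \<and> Vcc br \<noteq> {} \<longrightarrow>
        betti br 3 = betti br 4) \<and>
     (\<exists>br :: real ^ 7 \<Rightarrow> real ^ 7 \<Rightarrow> real ^ 7.
        lie_bracket br \<and> nilpotent br \<and> \<not> abelian br \<and> decomposable br \<and> Vcc br \<noteq> {} \<and>
        moduli_dim br < int (betti br 3)) \<and>
     (\<exists>br :: real ^ 7 \<Rightarrow> real ^ 7 \<Rightarrow> real ^ 7.
        lie_bracket br \<and> nilpotent br \<and> \<not> abelian br \<and> decomposable br \<and> Vcc br \<noteq> {} \<and>
        moduli_dim br = int (betti br 3)) \<and>
     (\<exists>br :: real ^ 7 \<Rightarrow> real ^ 7 \<Rightarrow> real ^ 7.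
        lie_bracket br \<and> nilpotent br \<and> \<not> abelian br \<and> decomposable br \<and> Vcc br \<noteq> {} \<and>
        moduli_dim br > int (betti br 3)) \<and>
     (\<forall>br :: 'a \<Rightarrow> 'a \<Rightarrow> 'a.
        DIM('a) = 7 \<and> lie_bracket br \<and> step_nilpotent 2 br \<and> \<not> decomposable br \<and> Vcc br \<noteq> {} \<longrightarrow>
        moduli_dim br < int (betti br 3))"
proof -
  have "DIM(real ^ 7) = 7" by simp
  then obtain e :: "nat \<Rightarrow> real ^ 7" and u where "frame7 e u" using frame7_exists by blast
  then interpret frame7 e u .
  have lt: "lie_bracket br_lt \<and> nilpotent br_lt \<and> \<not> abelian br_lt \<and> decomposable br_lt \<and> Vcc br_lt \<noteq> {} \<and>
      moduli_dim br_lt < int (betti br_lt 3)"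
    using lie_br_lt nilpotent_of_lower_central[OF lower_central_br_lt] not_abelian decomposable_examples psi_br_lt moduli_br_lt
    by blast
  have eq: "lie_bracket br_eq \<and> nilpotent br_eq \<and> \<not> abelian br_eq \<and> decomposable br_eq \<and> Vcc br_eq \<noteq> {} \<and>
      moduli_dim br_eq = int (betti br_eq 3)"
    using lie_br_eq nilpotent_of_lower_central[OF lower_central_br_eq] not_abelian decomposable_examples psi_br_eq moduli_br_eq
    by blast
  have gt: "lie_bracket br_gt \<and> nilpotent br_gt \<and> \<not> abelian br_gt \<and> decomposable br_gt \<and> Vcc br_gt \<noteq> {} \<and>
      moduli_dim br_gt > int (betti br_gt 3)"
    using lie_br_gt nilpotent_of_lower_central[OF lower_central_br_gt] not_abelian decomposable_examples psi_br_gt moduli_br_gt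
    by blast
  show ?thesis
  proof (intro conjI)
    show "\<forall>br :: 'a \<Rightarrow> 'a \<Rightarrow> 'a. DIM('a) = 7 \<and> lie_bracket br \<and> nilpotent br \<and> \<not> abelian br \<and> Vcc br \<noteq> {} \<longrightarrow>
        betti br 3 = betti br 4"
      using nilpotent_betti(1) by blast
    show "\<forall>br :: 'a \<Rightarrow> 'a \<Rightarrow> 'a. DIM('a) = 7 \<and> lie_bracket br \<and> step_nilpotent 2 br \<and> \<not> decomposable br \<and> Vcc br \<noteq> {} \<longrightarrow>
        moduli_dim br < int (betti br 3)"
      using two_step_moduli_lt by blast
  qed (rule exI, rule lt, rule exI, rule eq, rule exI, rule gt)
qed

end
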